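(* There is a randomized algorithm which, given query access to a function $f:\{-1,1\}^n\to\{-1,1\}$ and parameters $s\in\mathbb{N}$ and $\varepsilon\in(0,1)$, provides query access to a fixed decision tree $T$ such that: (i) $T$ has size $s^{O((\log s)^2/\varepsilon^3)}$; (ii) with high probability, $\mathrm{dist}(T,f)\le O(\mathrm{opt}_s)+\varepsilon$, where $\mathrm{opt}_s$ denotes the distance of $f$ to the closest size-$s$ decision tree; (iii) every query to $T$ (i.e. every request for the value $T(z)$ at an input $z\in\{-1,1\}^n$) is answered using $\mathrm{poly}((\log s)/\varepsilon)\cdot\log n$ queries to $f$ and in $\mathrm{poly}((\log s)/\varepsilon)\cdot n\log n$ time.
   Context: Decision trees compute functions $\{-1,1\}^n\to\{-1,1\}$ by querying coordinates $x_i$ at internal nodes and outputting a label in $\{-1,1\}$ at leaves; the size of a decision tree is its number of leaves. For $f,g:\{-1,1\}^n\to\{-1,1\}$, $\mathrm{dist}(f,g)=\Pr_{\mathbf{x}}[f(\mathbf{x})\ne g(\mathbf{x})]$ with $\mathbf{x}$ uniform on $\{-1,1\}^n$. "Provides query access to a fixed decision tree $T$" means that all answers given by the algorithm (for any sequence of inputs) are consistent with a single decision tree $T$, determined by $f$, $s$, $\varepsilon$ and the algorithm's randomness. *)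

theory Defs
  imports "HOL-Probability.Probability" "HOL-Computational_Algebra.Polynomial"
begin

section \<open>Boolean functions and decision trees\<close>

definition cube :: "nat \<Rightarrow> (nat \<Rightarrow> int) set" where
  "cube n = {..<n} \<rightarrow>\<^sub>E {-1, 1}"

datatype dtree = Leaf int | Node nat dtree dtree

text \<open>In \<open>Node i l r\<close> the left subtree is taken when the queried coordinate is \<open>-1\<close>.\<close>

primrec dt_eval :: "dtree \<Rightarrow> (nat \<Rightarrow> int) \<Rightarrow> int" where
  "dt_eval (Leaf b) x = b"
| "dt_eval (Node i l r) x = (if x i = -1 then dt_eval l x else dt_eval r x)"

primrec dt_size :: "dtree \<Rightarrow> nat" where
  "dt_size (Leaf b) = 1"
| "dt_size (Node i l r) = dt_size l + dt_size r"

primrec decision_tree :: "nat \<Rightarrow> dtree \<Rightarrow> bool" where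
  "decision_tree n (Leaf b) \<longleftrightarrow> b \<in> {-1, 1}"
| "decision_tree n (Node i l r) \<longleftrightarrow> i < n \<and> decision_tree n l \<and> decision_tree n r"

definition dist_fun :: "nat \<Rightarrow> ((nat \<Rightarrow> int) \<Rightarrow> int) \<Rightarrow> ((nat \<Rightarrow> int) \<Rightarrow> int) \<Rightarrow> real" where
  "dist_fun n f g = measure_pmf.prob (pmf_of_set (cube n)) {x. f x \<noteq> g x}"

text \<open>``Size-\<open>s\<close>'' means at most \<open>s\<close> leaves.  The infimum is attained, because the distance
  takes only finitely many values.\<close>

definition opt :: "nat \<Rightarrow> nat \<Rightarrow> ((nat \<Rightarrow> int) \<Rightarrow> int) \<Rightarrow> real" where
  "opt n s f = (INF T \<in> {T. decision_tree n T \<and> dt_size T \<le> s}. dist_fun n f (dt_eval T))"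


section \<open>Randomized oracle algorithms on a word RAM\<close>

text \<open>
  Algorithms are while-programs over finitely many registers and a random-access memory.  Registers
  and memory cells hold \<open>w\<close>-bit words: the result of every operation is reduced modulo \<open>2 ^ w\<close>
  (subtraction is cut off at 0, and division by 0 gives 0).  Every operation of an expression,
  every assignment, store, coin flip and branch takes one unit of time.
\<close>

datatype binop = Plus | Minus | Times | Divide | Modulo | Less | Equal

datatype exp = Const nat | Reg nat | Load exp | Op binop exp exp

datatype com =
    Skip
  | Assign nat exp
  | Store exp exp
  | Flip nat
  | Query nat exp
  | Seq com com
  | Cond exp com com
  | While exp com

primrec binop_val :: "binop \<Rightarrow> nat \<Rightarrow> nat \<Rightarrow> nat" where
  "binop_val Plus a b = a + b"
| "binop_val Minus a b = a - b"
| "binop_val Times a b = a * b"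
| "binop_val Divide a b = a div b"
| "binop_val Modulo a b = a mod b"
| "binop_val Less a b = (if a < b then 1 else 0)"
| "binop_val Equal a b = (if a = b then 1 else 0)"

text \<open>The last three components are counters: coins flipped, queries asked and time spent so far.
  A program cannot read them.\<close>

record config =
  regs :: "nat \<Rightarrow> nat"
  mem :: "nat \<Rightarrow> nat"
  flips :: nat
  queries :: nat
  time :: nat

primrec exp_val :: "nat \<Rightarrow> config \<Rightarrow> exp \<Rightarrow> nat" where
  "exp_val w \<sigma> (Const k) = k mod 2 ^ w"
| "exp_val w \<sigma> (Reg r) = regs \<sigma> r"
| "exp_val w \<sigma> (Load e) = mem \<sigma> (exp_val w \<sigma> e)"
| "exp_val w \<sigma> (Op bop d e) = binop_val bop (exp_val w \<sigma> d) (exp_val w \<sigma> e) mod 2 ^ w"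

primrec exp_cost :: "exp \<Rightarrow> nat" where
  "exp_cost (Const k) = 1"
| "exp_cost (Reg r) = 1"
| "exp_cost (Load e) = exp_cost e + 1"
| "exp_cost (Op bop d e) = exp_cost d + exp_cost e + 1"

text \<open>In memory, \<open>-1\<close> is represented by 0 and \<open>1\<close> by 1.\<close>

definition encode_bit :: "int \<Rightarrow> nat" where
  "encode_bit b = (if b = 1 then 1 else 0)"

definition decode_bit :: "nat \<Rightarrow> int" where
  "decode_bit v = (if v = 0 then -1 else 1)"

definition point_at :: "nat \<Rightarrow> (nat \<Rightarrow> nat) \<Rightarrow> nat \<Rightarrow> (nat \<Rightarrow> int)" where
  "point_at n m a = (\<lambda>i\<in>{..<n}. decode_bit (m (a + i)))"

text \<open>
  \<open>exec n w f \<omega> c \<sigma> \<sigma>'\<close>: with oracle \<open>f\<close> and coins \<open>\<omega>\<close>, program \<open>c\<close> started in \<open>\<sigma>\<close> terminates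
  in \<open>\<sigma>'\<close>.  The oracle is reached only through \<open>Query r e\<close>, which evaluates \<open>f\<close> at the point stored
  in the \<open>n\<close> memory cells from address \<open>e\<close> on; transferring this point is charged \<open>n\<close> units of time.
  The coins are reached only through \<open>Flip r\<close>, which reads the next coin of \<open>\<omega>\<close>.
\<close>

inductive exec :: "nat \<Rightarrow> nat \<Rightarrow> ((nat \<Rightarrow> int) \<Rightarrow> int) \<Rightarrow> (nat \<Rightarrow> bool) \<Rightarrow>
    com \<Rightarrow> config \<Rightarrow> config \<Rightarrow> bool"
  for n w :: nat and f :: "(nat \<Rightarrow> int) \<Rightarrow> int" and \<omega> :: "nat \<Rightarrow> bool"
where
  Skip: "exec n w f \<omega> Skip \<sigma> (\<sigma>\<lparr>time := time \<sigma> + 1\<rparr>)"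
| Assign: "exec n w f \<omega> (Assign r e) \<sigma>
    (\<sigma>\<lparr>regs := (regs \<sigma>)(r := exp_val w \<sigma> e), time := time \<sigma> + exp_cost e + 1\<rparr>)"
| Store: "exec n w f \<omega> (Store d e) \<sigma>
    (\<sigma>\<lparr>mem := (mem \<sigma>)(exp_val w \<sigma> d := exp_val w \<sigma> e),
       time := time \<sigma> + exp_cost d + exp_cost e + 1\<rparr>)"
| Flip: "exec n w f \<omega> (Flip r) \<sigma>
    (\<sigma>\<lparr>regs := (regs \<sigma>)(r := (if \<omega> (flips \<sigma>) then 1 else 0)),
       flips := flips \<sigma> + 1, time := time \<sigma> + 1\<rparr>)"
| Query: "exec n w f \<omega> (Query r e) \<sigma>
    (\<sigma>\<lparr>regs := (regs \<sigma>)(r := encode_bit (f (point_at n (mem \<sigma>) (exp_val w \<sigma> e)))),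
       queries := queries \<sigma> + 1, time := time \<sigma> + exp_cost e + n + 1\<rparr>)"
| Seq: "exec n w f \<omega> c \<sigma> \<sigma>' \<Longrightarrow> exec n w f \<omega> d \<sigma>' \<sigma>'' \<Longrightarrow> exec n w f \<omega> (Seq c d) \<sigma> \<sigma>''"
| CondTrue: "exp_val w \<sigma> e \<noteq> 0 \<Longrightarrow> exec n w f \<omega> c (\<sigma>\<lparr>time := time \<sigma> + exp_cost e + 1\<rparr>) \<sigma>' \<Longrightarrow>
    exec n w f \<omega> (Cond e c d) \<sigma> \<sigma>'"
| CondFalse: "exp_val w \<sigma> e = 0 \<Longrightarrow> exec n w f \<omega> d (\<sigma>\<lparr>time := time \<sigma> + exp_cost e + 1\<rparr>) \<sigma>' \<Longrightarrow>
    exec n w f \<omega> (Cond e c d) \<sigma> \<sigma>'"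
| WhileFalse: "exp_val w \<sigma> e = 0 \<Longrightarrow>
    exec n w f \<omega> (While e c) \<sigma> (\<sigma>\<lparr>time := time \<sigma> + exp_cost e + 1\<rparr>)"
| WhileTrue: "exp_val w \<sigma> e \<noteq> 0 \<Longrightarrow> exec n w f \<omega> c (\<sigma>\<lparr>time := time \<sigma> + exp_cost e + 1\<rparr>) \<sigma>' \<Longrightarrow>
    exec n w f \<omega> (While e c) \<sigma>' \<sigma>'' \<Longrightarrow> exec n w f \<omega> (While e c) \<sigma> \<sigma>''"

inductive_cases exec_cases:
  "exec n w f \<omega> Skip \<sigma> \<sigma>'"
  "exec n w f \<omega> (Assign r e) \<sigma> \<sigma>'"
  "exec n w f \<omega> (Store d e) \<sigma> \<sigma>'"
  "exec n w f \<omega> (Flip r) \<sigma> \<sigma>'"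
  "exec n w f \<omega> (Query r e) \<sigma> \<sigma>'"
  "exec n w f \<omega> (Seq c d) \<sigma> \<sigma>'"
  "exec n w f \<omega> (Cond e c d) \<sigma> \<sigma>'"
  "exec n w f \<omega> (While e c) \<sigma> \<sigma>'"

lemma exec_deterministic:
  assumes "exec n w f \<omega> c \<sigma> \<sigma>'" "exec n w f \<omega> c \<sigma> \<sigma>''"
  shows "\<sigma>'' = \<sigma>'"
  using assms
proof (induction arbitrary: \<sigma>'' rule: exec.induct)
  case Skip show ?case using Skip.prems by (rule exec_cases(1)) simp
next
  case Assign show ?case using Assign.prems by (rule exec_cases(2)) simp
next
  case Store show ?case using Store.prems by (rule exec_cases(3)) simp
next
  case Flip show ?case using Flip.prems by (rule exec_cases(4)) simp
next
  case Query show ?case using Query.prems by (rule exec_cases(5)) simp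
next
  case (Seq c \<sigma> \<sigma>1 d \<sigma>2)
  from Seq.prems obtain \<tau> where "exec n w f \<omega> c \<sigma> \<tau>" and rest: "exec n w f \<omega> d \<tau> \<sigma>''"
    by (rule exec_cases(6))
  then have "\<tau> = \<sigma>1" by (intro Seq.IH(1))
  with rest show ?case by (intro Seq.IH(2)) simp
next
  case (CondTrue \<sigma> e c \<sigma>1 d)
  from CondTrue.prems show ?case
    by (rule exec_cases(7)) (simp_all add: CondTrue.hyps CondTrue.IH)
next
  case (CondFalse \<sigma> e d \<sigma>1 c)
  from CondFalse.prems show ?case
    by (rule exec_cases(7)) (simp_all add: CondFalse.hyps CondFalse.IH)
next
  case WhileFalse show ?case using WhileFalse.prems by (rule exec_cases(8)) (simp_all add: WhileFalse.hyps)
next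
  case (WhileTrue \<sigma> e c \<sigma>1 \<sigma>2)
  from WhileTrue.prems show ?case
  proof (rule exec_cases(8))
    assume "exp_val w \<sigma> e = 0"
    with WhileTrue.hyps show ?thesis by simp
  next
    fix \<tau>
    assume "exec n w f \<omega> c (\<sigma>\<lparr>time := Suc (time \<sigma> + exp_cost e)\<rparr>) \<tau>"
      and rest: "exec n w f \<omega> (While e c) \<tau> \<sigma>''"
    then have "\<tau> = \<sigma>1" by (intro WhileTrue.IH(1)) simp
    with rest show ?thesis by (intro WhileTrue.IH(2)) simp
  qed
qed

text \<open>
  The real parameter \<open>\<epsilon>\<close> is presented to the algorithm as the integer \<open>\<lceil>1/\<epsilon>\<rceil>\<close>, which determines
  \<open>\<epsilon>\<close> up to a factor of 2.  Initially registers 0, 1, 2 hold \<open>n\<close>, \<open>s\<close>, \<open>\<lceil>1/\<epsilon>\<rceil>\<close>, the first \<open>n\<close>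
  memory cells hold the input point \<open>z\<close>, and everything else is 0.
\<close>

definition init_config :: "nat \<Rightarrow> nat \<Rightarrow> real \<Rightarrow> (nat \<Rightarrow> int) \<Rightarrow> config" where
  "init_config n s \<epsilon> z =
     \<lparr>regs = (\<lambda>_. 0)(0 := n, 1 := s, 2 := nat \<lceil>1 / \<epsilon>\<rceil>),
      mem = (\<lambda>i. if i < n then encode_bit (z i) else 0),
      flips = 0, queries = 0, time = 0\<rparr>"

text \<open>Words have \<open>O(log (n + s + 1/\<epsilon>))\<close> bits, with constant factor \<open>K\<close>.\<close>

definition word_length :: "nat \<Rightarrow> nat \<Rightarrow> nat \<Rightarrow> real \<Rightarrow> nat" where
  "word_length K n s \<epsilon> = K * nat \<lceil>log 2 (real n + real s + 1 / \<epsilon>)\<rceil>"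

text \<open>
  \<open>answers A K n s \<epsilon> f \<omega> z b q t\<close>: asked for the value at \<open>z\<close>, algorithm \<open>A\<close> returns \<open>b\<close> (in register 0)
  after \<open>q\<close> queries to \<open>f\<close> and \<open>t\<close> units of time.  All requests are served with the same coins \<open>\<omega>\<close>
  and start from the same initial configuration, so an answer does not depend on earlier requests.
\<close>

definition answers :: "com \<Rightarrow> nat \<Rightarrow> nat \<Rightarrow> nat \<Rightarrow> real \<Rightarrow> ((nat \<Rightarrow> int) \<Rightarrow> int) \<Rightarrow> (nat \<Rightarrow> bool) \<Rightarrow>
    (nat \<Rightarrow> int) \<Rightarrow> int \<Rightarrow> nat \<Rightarrow> nat \<Rightarrow> bool" where
  "answers A K n s \<epsilon> f \<omega> z b q t \<longleftrightarrow>
     (\<exists>\<sigma>. exec n (word_length K n s \<epsilon>) f \<omega> A (init_config n s \<epsilon> z) \<sigma> \<and>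
          decode_bit (regs \<sigma> 0) = b \<and> queries \<sigma> = q \<and> time \<sigma> = t)"

definition coins :: "(nat \<Rightarrow> bool) measure" where
  "coins = (\<Pi>\<^sub>M i\<in>UNIV. measure_pmf (bernoulli_pmf (1 / 2)))"

end

theory Submission
  imports Defs
begin

text \<open>
  Let \<open>P\<close> be about \<open>log s / \<epsilon>\<close>.  The tree \<open>T\<close> is the complete tree of depth \<open>384 P\<^sup>3\<close> that always splits on
  the coordinate whose fixing most increases the noise stability \<open>E[f(x) f(y)]\<close> of the current restriction
  of \<open>f\<close>, where \<open>y\<close> rerandomizes each coordinate of \<open>x\<close> with probability \<open>r \<approx> 1 / P\<close>.  Stability lies
  between 0 and 1, so at some level the average gain is at most \<open>1 / (384 P\<^sup>3)\<close>.  The gain of \<open>i\<close> bounds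
  the squared influence of \<open>i\<close> on a smoothed version of \<open>f\<close>, and the inequality of O'Donnell, Saks, Schramm
  and Servedio (OSSS) together with the noise stability of small trees then shows that at this level \<open>f\<close> is,
  on average, as close to a constant as it is to a size-\<open>s\<close> tree, up to \<open>O(\<epsilon>)\<close>.  Further splits do no harm.

  All gains at a node are estimated from the same pairs \<open>(x, y)\<close>, and the same pairs serve all nodes: a union
  bound over the at most \<open>(2 n + 1)\<^sup>D\<close> restrictions by at most \<open>D\<close> coordinates costs only a factor \<open>O(D)\<close> in
  their number.  So a request at \<open>z\<close> is answered by drawing the pairs and walking down one path of \<open>T\<close>.
\<close>

section \<open>Averages and noise on the cube\<close>

text \<open>The cubic depth comes from balancing the losses in the correlation with a small tree g.
  Writing h for the smoothed f, E[f g] is E[h g] plus a loss from smoothing g, at most about r log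
  s. OSSS bounds E[h g] by |E f| plus log s times the largest L1 influence on h, whereas the gain
  controls r times an L2 influence. The inequality 2 |v| \<le> v^2 / a + a bridges the two norms;
  unlike a square root it is linear in the gain, so it survives averaging over a level with one
  fixed a. With r and a of order 1 / P, the gain must be of order r a^2, that is P^-3; this sets
  both the inverse depth and the sampling accuracy. The tree depends on the very samples that
  estimate its gains, so no fresh randomness is available at a node. Coordinate and label are
  therefore functions of the restriction and the samples alone, and the estimates must be accurate
  at all restrictions, whether or not the tree reaches them. Beating about n^(2 D) events with
  accuracy P^-3 takes D P^6 log n pairs up to constants, hence the ninth power of P.\<close>

type_synonym point = "nat \<Rightarrow> int"

definition mean :: "nat \<Rightarrow> (point \<Rightarrow> real) \<Rightarrow> real" where
  "mean n F = (\<Sum>x\<in>cube n. F x) / 2 ^ n"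

definition avg :: "nat \<Rightarrow> (point \<Rightarrow> real) \<Rightarrow> point \<Rightarrow> real" where
  "avg i F = (\<lambda>x. (F (x(i := -1)) + F (x(i := 1))) / 2)"

definition blur :: "real \<Rightarrow> nat \<Rightarrow> (point \<Rightarrow> real) \<Rightarrow> point \<Rightarrow> real" where
  "blur q i F = (\<lambda>x. (1 - q) * F x + q * avg i F x)"

text \<open>A list of coordinates instead of a set gives structural induction. All
  \<open>blur\<close> operators commute, so the order is immaterial and any one coordinate can be
  brought to the front with \<open>remove1\<close>.\<close>

definition noise :: "real \<Rightarrow> nat list \<Rightarrow> (point \<Rightarrow> real) \<Rightarrow> point \<Rightarrow> real" where
  "noise q js F = foldr (blur q) js F"

lemma nzs_Nil [simp]: "noise q [] F = F"
  and nzs_Cons [simp]: "noise q (i # js) F = blur q i (noise q js F)"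
  by (simp_all add: noise_def)

lemma finite_cube [simp]: "finite (cube n)"
  by (simp add: cube_def finite_PiE)

lemma card_cube: "card (cube n) = 2 ^ n"
  by (simp add: cube_def card_PiE numeral_2_eq_2)

lemma cube_nonempty [simp]: "cube n \<noteq> {}"
  using card_cube[of n] by (metis card.empty power_not_zero zero_neq_numeral)

lemma cube_val: "x \<in> cube n \<Longrightarrow> i < n \<Longrightarrow> x i = -1 \<or> x i = 1"
  by (auto simp: cube_def PiE_iff)

lemma cube_upd [simp]: "x \<in> cube n \<Longrightarrow> i < n \<Longrightarrow> b = -1 \<or> b = 1 \<Longrightarrow> x(i := b) \<in> cube n"
  by (auto simp: cube_def PiE_iff extensional_def)

lemma mean_add: "mean n (\<lambda>x. F x + G x) = mean n F + mean n G"
  by (simp add: mean_def sum.distrib add_divide_distrib)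

lemma mean_diff: "mean n (\<lambda>x. F x - G x) = mean n F - mean n G"
  by (simp add: mean_def sum_subtractf diff_divide_distrib)

lemma mean_cmult: "mean n (\<lambda>x. k * F x) = k * mean n F"
  by (simp add: mean_def sum_distrib_left[symmetric])

lemma mean_divide: "mean n (\<lambda>x. F x / k) = mean n F / k"
  using mean_cmult[of n "1 / k" F] by simp

lemma mean_const [simp]: "mean n (\<lambda>x. k) = k"
  by (simp add: mean_def card_cube)

lemma mean_mono: "(\<And>x. x \<in> cube n \<Longrightarrow> F x \<le> G x) \<Longrightarrow> mean n F \<le> mean n G"
  unfolding mean_def by (intro divide_right_mono sum_mono) auto

lemma mean_cong: "(\<And>x. x \<in> cube n \<Longrightarrow> F x = G x) \<Longrightarrow> mean n F = mean n G"
  unfolding mean_def by (metis (no_types, lifting) sum.cong)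

lemma mean_abs: "\<bar>mean n F\<bar> \<le> mean n (\<lambda>x. \<bar>F x\<bar>)"
  unfolding mean_def by (simp add: divide_right_mono sum_abs)

text \<open>Flipping coordinate \<open>i\<close> permutes the cube, and the two restrictions at
  \<open>x\<close> are the values at \<open>x\<close> and at its flip.\<close>

lemma mean_split:
  assumes "i < n"
  shows "mean n F = (mean n (\<lambda>x. F (x(i := -1))) + mean n (\<lambda>x. F (x(i := 1)))) / 2"
proof -
  define flip where "flip x = x(i := - x i)" for x :: point
  have "bij_betw flip (cube n) (cube n)"
    by (rule bij_betwI[where g = flip])
      (use assms in \<open>auto simp: flip_def dest: cube_val\<close>, (use cube_val assms in force)+)
  then have 1: "(\<Sum>x\<in>cube n. F (flip x)) = (\<Sum>x\<in>cube n. F x)"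
    by (rule sum.reindex_bij_betw)
  have "F (x(i := -1)) + F (x(i := 1)) = F x + F (flip x)" if "x \<in> cube n" for x
    using cube_val[OF that assms] by (auto simp: flip_def fun_upd_idem)
  then have "(\<Sum>x\<in>cube n. F (x(i := -1)) + F (x(i := 1))) = (\<Sum>x\<in>cube n. F x + F (flip x))"
    by (rule sum.cong[OF refl])
  then show ?thesis
    by (simp add: mean_def sum.distrib 1 field_simps)
qed

lemma mean_av: "i < n \<Longrightarrow> mean n (avg i F) = mean n F"
  using mean_split[of i n F] by (simp add: avg_def mean_divide mean_add)

lemma avg_mult_av: "avg i (\<lambda>x. F x * avg i G x) = (\<lambda>x. avg i F x * avg i G x)"
  by (simp add: avg_def fun_eq_iff field_simps)

text \<open>\<open>avg i\<close> is an orthogonal projection for the inner product given by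
  \<open>mean n\<close>: both sides equal the inner product of the two averages.\<close>

lemma mean_av_adjoint:
  assumes "i < n"
  shows "mean n (\<lambda>x. F x * avg i G x) = mean n (\<lambda>x. avg i F x * G x)"
proof -
  have "mean n (\<lambda>x. F x * avg i G x) = mean n (\<lambda>x. avg i F x * avg i G x)"
    using mean_av[OF assms, of "\<lambda>x. F x * avg i G x"] by (simp add: avg_mult_av)
  moreover have "mean n (\<lambda>x. G x * avg i F x) = mean n (\<lambda>x. avg i G x * avg i F x)"
    using mean_av[OF assms, of "\<lambda>x. G x * avg i F x"] by (simp add: avg_mult_av)
  ultimately show ?thesis
    by (simp add: mult.commute)
qed

lemma avg_commute: "avg i (avg j F) = avg j (avg i F)"
proof (cases "i = j")
  case False
  then have "x(j := b, i := a) = x(i := a, j := b)" for a b and x :: point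
    by (simp add: fun_upd_twist)
  then show ?thesis by (intro ext) (simp add: avg_def field_simps)
qed simp

lemma avg_av [simp]: "avg i (avg i F) = avg i F"
  by (simp add: avg_def)

lemma avg_linear: "avg i (\<lambda>x. k * F x + l * G x) = (\<lambda>x. k * avg i F x + l * avg i G x)"
  by (simp add: avg_def fun_eq_iff algebra_simps add_divide_distrib)

lemma avg_nz: "avg i (blur q j F) = blur q j (avg i F)"
  by (simp add: blur_def avg_linear avg_commute[of i j])

lemma blur_commute: "blur q i (blur q' j F) = blur q' j (blur q i F)"
  by (simp add: blur_def avg_linear avg_commute[of i j]) (simp add: algebra_simps)

lemma avg_nzs: "avg i (noise q js F) = noise q js (avg i F)"
  by (induction js) (simp_all add: avg_nz)

lemma blur_nzs: "blur q i (noise q' js F) = noise q' js (blur q i F)"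
proof (induction js)
  case (Cons j js)
  have "blur q i (blur q' j (noise q' js F)) = blur q' j (blur q i (noise q' js F))"
    by (rule blur_commute)
  with Cons show ?case by simp
qed simp

lemma noise_remove1: "i \<in> set js \<Longrightarrow> noise q js F = blur q i (noise q (remove1 i js) F)"
  by (induction js) (auto simp: blur_commute)

lemma blur_adjoint: "i < n \<Longrightarrow> mean n (\<lambda>x. F x * blur q i G x) = mean n (\<lambda>x. blur q i F x * G x)"
  using mean_av_adjoint[of i n F G]
  by (simp add: blur_def algebra_simps mean_add mean_diff mean_cmult)

lemma noise_adjoint:
  "set js \<subseteq> {..<n} \<Longrightarrow> mean n (\<lambda>x. F x * noise q js G x) = mean n (\<lambda>x. noise q js F x * G x)"
proof (induction js arbitrary: F)
  case (Cons j js)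
  have "mean n (\<lambda>x. F x * blur q j (noise q js G) x) = mean n (\<lambda>x. blur q j F x * noise q js G x)"
    using Cons.prems by (intro blur_adjoint) simp
  with Cons show ?case by (simp add: blur_nzs)
qed simp

text \<open>The projection \<open>avg i\<close> splits functions into its range, where
  \<open>blur q i\<close> is the identity, and its kernel, where \<open>blur q i\<close> is
  multiplication by 1 - q.\<close>

lemma blur_square: "(1 - q)\<^sup>2 = 1 - r \<Longrightarrow> blur q i (blur q i F) = blur r i F"
proof -
  assume *: "(1 - q)\<^sup>2 = 1 - r"
  then have "r = 2 * q - q\<^sup>2" by (simp add: power2_eq_square algebra_simps)
  then show ?thesis
    by (simp add: blur_def avg_linear power2_eq_square fun_eq_iff) (simp add: algebra_simps)
qed

lemma noise_square: "(1 - q)\<^sup>2 = 1 - r \<Longrightarrow> noise q js (noise q js F) = noise r js F"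
proof (induction js arbitrary: F)
  case (Cons i js)
  have "noise q (i # js) (noise q (i # js) F) = blur q i (blur q i (noise q js (noise q js F)))"
    by (simp add: blur_nzs)
  with Cons show ?case by (simp add: blur_square)
qed simp

lemma abs_nzs_le:
  assumes "0 \<le> q" "q \<le> 1" "set js \<subseteq> {..<n}" "\<And>x. x \<in> cube n \<Longrightarrow> \<bar>F x\<bar> \<le> 1" "x \<in> cube n"
  shows "\<bar>noise q js F x\<bar> \<le> 1"
  using assms(3,5)
proof (induction js arbitrary: x)
  case (Cons i js)
  let ?G = "noise q js F"
  have 1: "\<bar>?G x\<bar> \<le> 1" "\<bar>?G (x(i := -1))\<bar> \<le> 1" "\<bar>?G (x(i := 1))\<bar> \<le> 1"
    using Cons by auto
  then have 2: "\<bar>avg i ?G x\<bar> \<le> 1" by (simp add: avg_def)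
  have "\<bar>(1 - q) * ?G x + q * avg i ?G x\<bar> \<le> (1 - q) * 1 + q * 1"
    using assms(1,2) 1(1) 2
    by (intro order_trans[OF abs_triangle_ineq] add_mono) (auto simp: abs_mult intro: mult_left_le)
  then show ?case by (simp add: blur_def)
qed (use assms in auto)

lemma avg_upd [simp]: "avg i F (x(i := b)) = avg i F x"
  by (simp add: avg_def)

lemma noise_upd:
  assumes "i \<notin> set js"
  shows "noise q js F (x(i := b)) = noise q js (\<lambda>x. F (x(i := b))) x"
  using assms
proof (induction js arbitrary: x)
  case (Cons j js)
  then have "j \<noteq> i" "i \<notin> set js" by auto
  note IH = Cons.IH[OF this(2)]
  from \<open>j \<noteq> i\<close> have tw: "x(i := b, j := a) = x(j := a, i := b)" for a
    by (rule fun_upd_twist[symmetric])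
  show ?case
    by (simp only: nzs_Cons blur_def avg_def tw IH)
qed simp

lemma avg_indep: "(\<And>x b. F (x(i := b)) = F x) \<Longrightarrow> avg i F = F"
  by (simp add: avg_def)

lemma blur_indep: "(\<And>x b. F (x(i := b)) = F x) \<Longrightarrow> blur q i F = F"
  by (simp add: blur_def avg_indep algebra_simps)

section \<open>Small trees: influence and noise stability\<close>

text \<open>Later queries of \<open>i\<close> are removed too. The plain subtrees of a node may
  query \<open>i\<close> again, while the inductions below need subtrees that ignore it.\<close>

primrec dt_restr :: "nat \<Rightarrow> int \<Rightarrow> dtree \<Rightarrow> dtree" where
  "dt_restr i b (Leaf a) = Leaf a"
| "dt_restr i b (Node j l r) =
     (if j = i then if b = -1 then dt_restr i b l else dt_restr i b r
      else Node j (dt_restr i b l) (dt_restr i b r))"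

lemma dt_eval_restr: "dt_eval (dt_restr i b T) x = dt_eval T (x(i := b))"
  by (induction T) auto

lemma dt_size_pos [simp]: "0 < dt_size T"
  by (induction T) auto

lemma dt_size_restr: "dt_size (dt_restr i b T) \<le> dt_size T"
  by (induction T) auto

lemma decision_tree_restr: "decision_tree n T \<Longrightarrow> decision_tree n (dt_restr i b T)"
  by (induction T) auto

lemma dt_eval_val: "decision_tree n T \<Longrightarrow> dt_eval T x = -1 \<or> dt_eval T x = 1"
  by (induction T) auto

text \<open>AM-GM in the form 4 a b \<le> (a + b)^2 for the leaf counts of the two branches. It lets
  log2 of the size replace the average depth in inductions where a node pays 1 plus the average over
  its branches.\<close>

lemma log2_size_Node:
  "1 + (log 2 (dt_size (dt_restr i (-1) l)) + log 2 (dt_size (dt_restr i 1 r))) / 2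
    \<le> log 2 (dt_size (Node i l r))"
proof -
  let ?a = "real (dt_size l)" and ?b = "real (dt_size r)"
  have pos: "?a > 0" "?b > 0" by auto
  have "log 2 (dt_size (dt_restr i (-1) l)) + log 2 (dt_size (dt_restr i 1 r)) \<le> log 2 ?a + log 2 ?b"
    by (intro add_mono) (simp_all add: dt_size_restr)
  moreover have "log 2 4 + (log 2 ?a + log 2 ?b) = log 2 (4 * (?a * ?b))"
    using pos by (simp add: log_mult_pos)
  moreover have "log 2 (4 * (?a * ?b)) \<le> log 2 ((?a + ?b)\<^sup>2)"
  proof (subst log_le_cancel_iff)
    show "4 * (?a * ?b) \<le> (?a + ?b)\<^sup>2"
      using zero_le_power2[of "?a - ?b"] by (simp add: power2_eq_square algebra_simps)
    then show "0 < (?a + ?b)\<^sup>2" using pos by (smt (verit) mult_pos_pos)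
  qed (use pos in auto)
  moreover have "log 2 ((?a + ?b)\<^sup>2) = 2 * log 2 (?a + ?b)"
    using pos by (simp add: log_nat_power)
  moreover have "log 2 (4 :: real) = 2"
    using log_pow_cancel[of 2 2] by simp
  ultimately show ?thesis by (simp add: add_divide_distrib)
qed

text \<open>Averaging over \<open>i\<close> does not increase the L1 influence of \<open>j\<close>.
  So the bound \<open>M\<close> survives when the induction for \<open>osss\<close> passes from
  \<open>h\<close> to \<open>avg i h\<close>.\<close>

lemma abs_avg_diff_le: "\<bar>avg i h x - avg j (avg i h) x\<bar> \<le> avg i (\<lambda>x. \<bar>h x - avg j h x\<bar>) x"
proof -
  let ?u = "\<lambda>b. h (x(i := b)) - avg j h (x(i := b))"
  have "\<bar>avg i h x - avg j (avg i h) x\<bar> = \<bar>(?u (-1) + ?u 1) / 2\<bar>"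
    by (subst avg_commute[of j i], subst avg_def[of i], subst avg_def[of i])
      (simp only: add_divide_distrib diff_divide_distrib)
  also have "\<dots> = \<bar>?u (-1) + ?u 1\<bar> / 2"
    by (simp only: abs_divide abs_numeral)
  also have "\<dots> \<le> (\<bar>?u (-1)\<bar> + \<bar>?u 1\<bar>) / 2"
    by (intro divide_right_mono abs_triangle_ineq) simp
  finally show ?thesis by (simp only: avg_def[of i])
qed

text \<open>The OSSS inequality, with the average depth of the tree bounded by the logarithm of its size.\<close>

lemma osss:
  assumes "decision_tree n T" "\<And>j. j < n \<Longrightarrow> mean n (\<lambda>x. \<bar>h x - avg j h x\<bar>) \<le> M"
  shows "mean n (\<lambda>x. h x * dt_eval T x) - mean n h * mean n (dt_eval T) \<le> M * log 2 (dt_size T)"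
  using assms
proof (induction "dt_size T" arbitrary: T h rule: less_induct)
  case less
  show ?case
  proof (cases T)
    case (Leaf b)
    then show ?thesis using mean_cmult[of n "real_of_int b" h] by (simp add: mult.commute)
  next
    case (Node i l r)
    from less.prems Node have i: "i < n" and dt: "decision_tree n l" "decision_tree n r" by auto
    let ?g = "\<lambda>x. real_of_int (dt_eval T x)"
    define T1 where "T1 = dt_restr i (-1) l"
    define T2 where "T2 = dt_restr i 1 r"
    have sz: "dt_size T1 < dt_size T" "dt_size T2 < dt_size T"
      unfolding T1_def T2_def Node dt_size.simps
      using dt_size_restr[of i "-1" l] dt_size_restr[of i 1 r] dt_size_pos[of l] dt_size_pos[of r]
      by linarith+
    have dt': "decision_tree n T1" "decision_tree n T2"
      by (simp_all add: T1_def T2_def dt decision_tree_restr)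
    have ev: "dt_eval T (x(i := -1)) = dt_eval T1 x" "dt_eval T (x(i := 1)) = dt_eval T2 x" for x
      by (simp_all add: Node T1_def T2_def dt_eval_restr)
    have avg_le: "mean n (\<lambda>x. \<bar>avg i h x - avg j (avg i h) x\<bar>) \<le> M" if j: "j < n" for j
    proof -
      have "mean n (\<lambda>x. \<bar>avg i h x - avg j (avg i h) x\<bar>) \<le> mean n (avg i (\<lambda>x. \<bar>h x - avg j h x\<bar>))"
        by (intro mean_mono abs_avg_diff_le)
      also have "\<dots> = mean n (\<lambda>x. \<bar>h x - avg j h x\<bar>)" by (rule mean_av[OF i])
      also have "\<dots> \<le> M" by (rule less.prems(2)[OF j])
      finally show ?thesis .
    qed
    have M: "0 \<le> M"
      using less.prems(2)[OF i] mean_mono[of n "\<lambda>_. 0" "\<lambda>x. \<bar>h x - avg i h x\<bar>"] by simp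
    \<comment> \<open>The root query is paid for here: \<open>h\<close> is replaced by
      \<open>avg i h\<close>, at the price of one influence. The rest no longer depends on
      coordinate \<open>i\<close> and splits into the two branches.\<close>
    have 1: "mean n (\<lambda>x. (h x - avg i h x) * ?g x) \<le> M"
    proof -
      have "(h x - avg i h x) * ?g x \<le> \<bar>h x - avg i h x\<bar>" for x
        using dt_eval_val[OF less.prems(1), of x] by (elim disjE) simp_all
      then have "mean n (\<lambda>x. (h x - avg i h x) * ?g x) \<le> mean n (\<lambda>x. \<bar>h x - avg i h x\<bar>)"
        by (intro mean_mono)
      also have "\<dots> \<le> M" by (rule less.prems(2)[OF i])
      finally show ?thesis .
    qed
    have 2: "mean n (\<lambda>x. avg i h x * ?g x) =
        (mean n (\<lambda>x. avg i h x * dt_eval T1 x) + mean n (\<lambda>x. avg i h x * dt_eval T2 x)) / 2"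
      by (subst mean_split[OF i]) (simp only: ev avg_upd)
    have 3: "mean n ?g = (mean n (dt_eval T1) + mean n (dt_eval T2)) / 2"
      by (subst mean_split[OF i]) (simp only: ev)
    have "mean n (\<lambda>x. h x * ?g x) = mean n (\<lambda>x. (h x - avg i h x) * ?g x) + mean n (\<lambda>x. avg i h x * ?g x)"
      by (simp only: mean_add[symmetric]) (simp add: algebra_simps)
    moreover have "mean n (\<lambda>x. avg i h x * dt_eval T1 x) - mean n h * mean n (dt_eval T1) \<le> M * log 2 (dt_size T1)"
      using less.hyps[OF sz(1) dt'(1) avg_le] by (simp add: mean_av[OF i])
    moreover have "mean n (\<lambda>x. avg i h x * dt_eval T2 x) - mean n h * mean n (dt_eval T2) \<le> M * log 2 (dt_size T2)"
      using less.hyps[OF sz(2) dt'(2) avg_le] by (simp add: mean_av[OF i])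
    ultimately have "mean n (\<lambda>x. h x * ?g x) - mean n h * mean n ?g
        \<le> M + (M * log 2 (dt_size T1) + M * log 2 (dt_size T2)) / 2"
      using 1 unfolding 2 3 times_divide_eq_right distrib_left by argo
    also have "\<dots> = M * (1 + (log 2 (dt_size T1) + log 2 (dt_size T2)) / 2)"
      by (simp add: algebra_simps add_divide_distrib)
    also have "\<dots> \<le> M * log 2 (dt_size T)"
      using log2_size_Node[of i l r] M unfolding T1_def T2_def Node by (intro mult_left_mono) simp_all
    finally show ?thesis .
  qed
qed

lemma mean_mult_le_1:
  assumes "\<And>x. x \<in> cube n \<Longrightarrow> \<bar>F x\<bar> \<le> 1" "\<And>x. x \<in> cube n \<Longrightarrow> \<bar>G x\<bar> \<le> 1"
  shows "\<bar>mean n (\<lambda>x. F x * G x)\<bar> \<le> 1"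
proof -
  have "mean n (\<lambda>x. \<bar>F x * G x\<bar>) \<le> mean n (\<lambda>x. 1)"
    using assms by (intro mean_mono) (simp add: abs_mult mult_le_one)
  then show ?thesis using mean_abs[of n "\<lambda>x. F x * G x"] by simp
qed

text \<open>Two points can be separated at the root only if its coordinate is rerandomized, so each
  query costs at most \<open>q\<close>. The costs add up to \<open>q\<close> times the average
  depth, again bounded through \<open>log2_size_Node\<close>.\<close>

lemma dt_noise_stability:
  assumes "decision_tree n T" "0 \<le> q" "q \<le> 1" "distinct js" "set js = {..<n}"
  shows "mean n (\<lambda>x. dt_eval T x * noise q js (dt_eval T) x) \<ge> 1 - q * log 2 (dt_size T)"
  using assms(1)
proof (induction "dt_size T" arbitrary: T rule: less_induct)
  case less
  show ?case
  proof (cases T)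
    case (Leaf b)
    have "noise q js (\<lambda>x. real_of_int b) = (\<lambda>x. real_of_int b)"
      by (induction js) (simp_all add: blur_indep)
    moreover have "real_of_int b * real_of_int b = 1" using less.prems Leaf by auto
    ultimately show ?thesis using Leaf by simp
  next
    case (Node i l r)
    from less.prems Node have i: "i < n" and dt: "decision_tree n l" "decision_tree n r" by auto
    let ?g = "\<lambda>x. real_of_int (dt_eval T x)"
    define T1 where "T1 = dt_restr i (-1) l"
    define T2 where "T2 = dt_restr i 1 r"
    let ?g1 = "\<lambda>x. real_of_int (dt_eval T1 x)" and ?g2 = "\<lambda>x. real_of_int (dt_eval T2 x)"
    have sz: "dt_size T1 < dt_size T" "dt_size T2 < dt_size T"
      unfolding T1_def T2_def Node dt_size.simps
      using dt_size_restr[of i "-1" l] dt_size_restr[of i 1 r] dt_size_pos[of l] dt_size_pos[of r]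
      by linarith+
    have dt': "decision_tree n T1" "decision_tree n T2"
      by (simp_all add: T1_def T2_def dt decision_tree_restr)
    have ev: "dt_eval T (x(i := -1)) = dt_eval T1 x" "dt_eval T (x(i := 1)) = dt_eval T2 x" for x
      by (simp_all add: Node T1_def T2_def dt_eval_restr)
    have ind: "?g1 (x(i := b)) = ?g1 x" "?g2 (x(i := b)) = ?g2 x" for x b
      by (simp_all add: T1_def T2_def dt_eval_restr)
    define js' where "js' = remove1 i js"
    have i': "i \<in> set js" "i \<notin> set js'" "set js' \<subseteq> {..<n}"
      using i assms(4,5) by (auto simp: js'_def)
    let ?G = "noise q js' ?g" and ?G1 = "noise q js' ?g1" and ?G2 = "noise q js' ?g2"
    have G_upd: "?G (x(i := -1)) = ?G1 x" "?G (x(i := 1)) = ?G2 x" for x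
      by (simp_all only: noise_upd[OF i'(2)] ev)
    have G_ind: "?G1 (x(i := b)) = ?G1 x" "?G2 (x(i := b)) = ?G2 x" for x b
      by (simp_all only: noise_upd[OF i'(2)] ind)
    have full: "noise q js ?g1 = ?G1" "noise q js ?g2 = ?G2" "noise q js ?g = blur q i ?G"
      by (simp_all only: noise_remove1[OF i'(1)] js'_def[symmetric] blur_indep[OF G_ind(1)] blur_indep[OF G_ind(2)])
    \<comment> \<open>\<open>s1\<close> and \<open>s2\<close> belong to pairs of points that enter
      the same branch, \<open>c1\<close> and \<open>c2\<close> to pairs that the root query
      separates.\<close>
    define s1 where "s1 = mean n (\<lambda>x. ?g1 x * ?G1 x)"
    define s2 where "s2 = mean n (\<lambda>x. ?g2 x * ?G2 x)"
    define c1 where "c1 = mean n (\<lambda>x. ?g1 x * ?G2 x)"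
    define c2 where "c2 = mean n (\<lambda>x. ?g2 x * ?G1 x)"
    have IH: "s1 \<ge> 1 - q * log 2 (dt_size T1)" "s2 \<ge> 1 - q * log 2 (dt_size T2)"
      using less.hyps[OF sz(1) dt'(1)] less.hyps[OF sz(2) dt'(2)] by (simp_all add: full s1_def s2_def)
    have g_bd: "\<bar>?g1 x\<bar> \<le> 1" "\<bar>?g2 x\<bar> \<le> 1" for x
      using dt_eval_val[OF dt'(1), of x] dt_eval_val[OF dt'(2), of x] by auto
    have G_bd: "\<bar>?G1 x\<bar> \<le> 1" "\<bar>?G2 x\<bar> \<le> 1" if "x \<in> cube n" for x
      using that g_bd assms(2,3) i'(3) by (auto intro!: abs_nzs_le)
    have bds: "\<bar>s1\<bar> \<le> 1" "\<bar>s2\<bar> \<le> 1" "\<bar>c1\<bar> \<le> 1" "\<bar>c2\<bar> \<le> 1"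
      unfolding s1_def s2_def c1_def c2_def using g_bd G_bd by (auto intro!: mean_mult_le_1)
    have 1: "mean n (\<lambda>x. ?g x * ?G x) = (s1 + s2) / 2"
      unfolding s1_def s2_def by (subst mean_split[OF i]) (simp only: ev G_upd)
    have 2: "mean n (\<lambda>x. ?g x * avg i ?G x) = (s1 + s2 + c1 + c2) / 4"
      unfolding s1_def s2_def c1_def c2_def
      by (subst mean_split[OF i]) (simp only: ev avg_upd, simp only: avg_def G_upd,
         simp add: mean_add mean_divide algebra_simps add_divide_distrib)
    have "mean n (\<lambda>x. ?g x * blur q i ?G x) = (1 - q) * mean n (\<lambda>x. ?g x * ?G x) + q * mean n (\<lambda>x. ?g x * avg i ?G x)"
      unfolding blur_def by (simp only: mean_add[symmetric] mean_cmult[symmetric]) (simp add: algebra_simps)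
    also have "\<dots> = (s1 + s2) / 2 - q * ((s1 + s2) / 4 - (c1 + c2) / 4)"
      unfolding 1 2 by (simp add: field_simps)
    also have "\<dots> \<ge> (s1 + s2) / 2 - q * 1"
    proof (intro diff_left_mono mult_left_mono)
      show "(s1 + s2) / 4 - (c1 + c2) / 4 \<le> 1" using bds by (simp add: abs_le_iff field_simps)
    qed (use assms(2) in auto)
    finally have "mean n (\<lambda>x. ?g x * blur q i ?G x) \<ge> 1 - q * (1 + (log 2 (dt_size T1) + log 2 (dt_size T2)) / 2)"
      using IH by (simp add: algebra_simps add_divide_distrib)
    moreover have "q * (1 + (log 2 (dt_size T1) + log 2 (dt_size T2)) / 2) \<le> q * log 2 (dt_size T)"
      using log2_size_Node[of i l r] assms(2) unfolding T1_def T2_def Node by (intro mult_left_mono) simp_all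
    ultimately show ?thesis unfolding full by linarith
  qed
qed

section \<open>Stability gain of a coordinate\<close>

definition pm :: "nat \<Rightarrow> (point \<Rightarrow> int) \<Rightarrow> bool" where
  "pm n F \<longleftrightarrow> (\<forall>x\<in>cube n. F x = -1 \<or> F x = 1)"

lemma pm_D: "pm n F \<Longrightarrow> x \<in> cube n \<Longrightarrow> F x = -1 \<or> F x = 1"
  by (simp add: pm_def)

lemma pm_abs: "pm n F \<Longrightarrow> x \<in> cube n \<Longrightarrow> \<bar>real_of_int (F x)\<bar> \<le> 1"
  using pm_D by fastforce

lemma pm_dt: "decision_tree n T \<Longrightarrow> pm n (dt_eval T)"
  using dt_eval_val by (simp add: pm_def)

lemma prob_cube: "measure_pmf.prob (pmf_of_set (cube n)) {x. P x} = mean n (\<lambda>x. if P x then 1 else 0)"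
proof -
  have "(\<Sum>x\<in>cube n. if P x then 1 else 0 :: real) = real (card (cube n \<inter> {x. P x}))"
    by (simp add: sum.If_cases)
  then show ?thesis
    by (simp add: measure_pmf_of_set mean_def card_cube)
qed

lemma dist_fun_ex:
  assumes "pm n f" "pm n g"
  shows "dist_fun n f g = (1 - mean n (\<lambda>x. real_of_int (f x) * real_of_int (g x))) / 2"
proof -
  have *: "(if f x \<noteq> g x then 1 else 0) = 1 / 2 - (1 / 2) * (real_of_int (f x) * real_of_int (g x))"
    if "x \<in> cube n" for x
    using pm_D[OF assms(1) that] pm_D[OF assms(2) that] by auto
  have "dist_fun n f g = mean n (\<lambda>x. 1 / 2 - (1 / 2) * (real_of_int (f x) * real_of_int (g x)))"
    unfolding dist_fun_def prob_cube by (rule mean_cong) (rule *)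
  also have "\<dots> = 1 / 2 - (1 / 2) * mean n (\<lambda>x. real_of_int (f x) * real_of_int (g x))"
    by (simp only: mean_diff mean_cmult mean_const)
  finally show ?thesis by simp
qed

lemma dist_fun_commute: "dist_fun n f g = dist_fun n g f"
  by (simp add: dist_fun_def eq_commute)

definition restr :: "(point \<Rightarrow> int) \<Rightarrow> nat \<Rightarrow> int \<Rightarrow> point \<Rightarrow> int" where
  "restr F i b = (\<lambda>x. F (x(i := b)))"

lemma pm_restr: "pm n F \<Longrightarrow> i < n \<Longrightarrow> b = -1 \<or> b = 1 \<Longrightarrow> pm n (restr F i b)"
  by (simp add: pm_def restr_def)

definition stability :: "nat \<Rightarrow> real \<Rightarrow> (point \<Rightarrow> int) \<Rightarrow> real" where
  "stability n r F = mean n (\<lambda>x. F x * noise r [0..<n] F x)"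

definition gain :: "nat \<Rightarrow> real \<Rightarrow> nat \<Rightarrow> (point \<Rightarrow> int) \<Rightarrow> real" where
  "gain n r i F = (stability n r (restr F i (-1)) + stability n r (restr F i 1)) / 2 - stability n r F"

lemma noise_upt: "i < n \<Longrightarrow> noise r [0..<n] F = blur r i (noise r (remove1 i [0..<n]) F)"
  by (rule noise_remove1) simp

lemma set_remove1_upt: "set (remove1 i [0..<n]) \<subseteq> {..<n}" "i \<notin> set (remove1 i [0..<n])"
  by auto

text \<open>In a restriction both points share the fixed value of \<open>i\<close>. Averaging over
  that value leaves \<open>i\<close> a uniform coordinate without noise, and only the others are
  smoothed.\<close>

lemma stability_restr:
  assumes i: "i < n"
  shows "(stability n r (restr F i (-1)) + stability n r (restr F i 1)) / 2
    = mean n (\<lambda>x. F x * noise r (remove1 i [0..<n]) F x)"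
proof -
  let ?N = "noise r (remove1 i [0..<n])"
  have upd: "?N F (x(i := b)) = ?N (\<lambda>x. restr F i b x) x" for b x
    unfolding restr_def by (rule noise_upd[OF set_remove1_upt(2)])
  have ind: "?N (\<lambda>x. restr F i b x) (x(i := a)) = ?N (\<lambda>x. restr F i b x) x" for a b x
  proof -
    have "?N (\<lambda>x. restr F i b x) (x(i := a)) = ?N F ((x(i := a))(i := b))"
      by (simp only: upd)
    also have "\<dots> = ?N (\<lambda>x. restr F i b x) x"
      by (simp only: fun_upd_upd upd)
    finally show ?thesis .
  qed
  have stability: "stability n r (restr F i b) = mean n (\<lambda>x. F (x(i := b)) * ?N F (x(i := b)))" for b
    unfolding stability_def noise_upt[OF i] by (subst blur_indep[OF ind]) (simp only: upd, simp only: restr_def)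
  show ?thesis
    unfolding stability by (rule mean_split[OF i, symmetric])
qed

lemma stability_split:
  assumes i: "i < n"
  shows "stability n r F = (1 - r) * mean n (\<lambda>x. F x * noise r (remove1 i [0..<n]) F x)
    + r * mean n (\<lambda>x. F x * avg i (noise r (remove1 i [0..<n]) F) x)"
  unfolding stability_def noise_upt[OF i] blur_def
  by (simp only: mean_add[symmetric] mean_cmult[symmetric]) (simp only: algebra_simps)

text \<open>Smoothing twice at rate \<open>q\<close> is smoothing once at rate \<open>r\<close>; this makes stability a squared norm.\<close>

lemma noise_root:
  assumes "0 \<le> r" "r \<le> (1 :: real)"
  obtains q where "0 \<le> q" "q \<le> r" "q \<le> 1" "(1 - q)\<^sup>2 = 1 - r"
proof
  let ?q = "1 - sqrt (1 - r)"
  have "(1 - r)\<^sup>2 \<le> 1 - r"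
    using assms by (simp add: power2_eq_square mult_left_le)
  then have "1 - r \<le> sqrt (1 - r)" by (rule real_le_rsqrt)
  then show "?q \<le> r" by simp
qed (use assms in auto)

text \<open>Let \<open>u\<close> be \<open>F\<close> smoothed in all coordinates but
  \<open>i\<close>. The gain equals \<open>r\<close> times the squared L2 norm of
  \<open>u - avg i u\<close>; smoothing \<open>i\<close> as well multiplies this difference by 1 -
  q, which leaves an inequality for \<open>h\<close>.\<close>

lemma gain_influence:
  fixes F :: "point \<Rightarrow> int"
  assumes i: "i < n" and r: "0 \<le> r" "r \<le> 1" and q: "(1 - q)\<^sup>2 = 1 - r"
  defines "h \<equiv> noise q [0..<n] F"
  shows "r * mean n (\<lambda>x. (h x - avg i h x)\<^sup>2) \<le> gain n r i F"
proof -
  define js where "js = remove1 i [0..<n]"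
  have js: "set js \<subseteq> {..<n}" unfolding js_def by (rule set_remove1_upt)
  define u where "u = noise q js F"
  let ?F = "\<lambda>x. real_of_int (F x)"
  let ?I = "mean n (\<lambda>x. (u x - avg i u x)\<^sup>2)"
  have 1: "noise r js ?F = noise q js u"
    unfolding u_def by (rule noise_square[OF q, symmetric])
  have X: "mean n (\<lambda>x. F x * noise r js F x) = mean n (\<lambda>x. u x * u x)"
    unfolding 1 by (subst noise_adjoint[OF js]) (simp only: u_def)
  have Y: "mean n (\<lambda>x. F x * avg i (noise r js F) x) = mean n (\<lambda>x. u x * avg i u x)"
    unfolding 1 avg_nzs by (subst noise_adjoint[OF js]) (simp only: u_def)
  have Z: "mean n (\<lambda>x. avg i u x * avg i u x) = mean n (\<lambda>x. u x * avg i u x)"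
    by (subst mean_av[OF i, symmetric, of "\<lambda>x. u x * avg i u x"]) (simp only: avg_mult_av)
  have "?I = mean n (\<lambda>x. u x * u x) - 2 * mean n (\<lambda>x. u x * avg i u x) + mean n (\<lambda>x. avg i u x * avg i u x)"
    by (simp only: mean_cmult[symmetric] mean_diff[symmetric] mean_add[symmetric])
      (simp add: power2_eq_square algebra_simps)
  then have I: "?I = mean n (\<lambda>x. u x * u x) - mean n (\<lambda>x. u x * avg i u x)"
    using Z by simp
  have "gain n r i F = r * ?I"
    unfolding gain_def stability_restr[OF i] stability_split[OF i, of r F] js_def[symmetric] X Y I by algebra
  moreover have "h x - avg i h x = (1 - q) * (u x - avg i u x)" for x
    unfolding h_def noise_upt[OF i] js_def[symmetric] u_def[symmetric] avg_nz
    by (simp add: blur_def algebra_simps)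
  then have "mean n (\<lambda>x. (h x - avg i h x)\<^sup>2) = (1 - r) * ?I"
    by (simp only: power_mult_distrib q mean_cmult)
  moreover have "0 \<le> ?I"
    using mean_mono[of n "\<lambda>_. 0" "\<lambda>x. (u x - avg i u x)\<^sup>2"] by simp
  then have "(1 - r) * ?I \<le> 1 * ?I" using r by (intro mult_right_mono) auto
  ultimately show ?thesis using r by (simp add: mult_left_mono)
qed

lemma mean_nzs: "set js \<subseteq> {..<n} \<Longrightarrow> mean n (noise q js F) = mean n F"
proof (induction js)
  case (Cons i js)
  have "mean n (blur q i (noise q js F)) = (1 - q) * mean n (noise q js F) + q * mean n (avg i (noise q js F))"
    by (simp only: blur_def mean_add mean_cmult)
  with Cons show ?case by (simp add: mean_av algebra_simps)
qed simp

text \<open>The sampled statistic is the mean of \<open>F(x) F(y) x\<^sub>i y\<^sub>i\<close>.  Its part that is not proportional to the gain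
  does not depend on \<open>i\<close>, so the statistic ranks coordinates by gain without separate queries for each.\<close>

lemma score_mean:
  assumes i: "i < n"
  shows "mean n (\<lambda>x. F x * x i * noise r [0..<n] (\<lambda>x. F x * x i) x)
    = (1 - r) * stability n r F + (2 - r) * gain n r i F"
proof -
  define js where "js = remove1 i [0..<n]"
  let ?F = "\<lambda>x. real_of_int (F x)"
  define G where "G = noise r js ?F"
  have chi: "noise r js (\<lambda>x. F x * x i) x = noise r js ?F x * x i" for x
  proof -
    have "noise r ks (\<lambda>x. F x * x i) x = noise r ks ?F x * x i" if "i \<notin> set ks" for ks
      using that
    proof (induction ks arbitrary: x)
      case (Cons k ks)
      then show ?case by (simp add: blur_def avg_def field_simps)
    qed simp
    then show ?thesis using set_remove1_upt by (simp add: js_def)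
  qed
  \<comment> \<open>The factor \<open>x i\<close> commutes with the noise on the other coordinates.
    Noise on \<open>i\<close> itself averages \<open>G x * x i\<close>, and multiplying by
    \<open>x i\<close> once more turns that average into \<open>G - avg i G\<close>, the part from
    which the gain is made.\<close>
  have pt: "F x * x i * noise r [0..<n] (\<lambda>x. F x * x i) x
      = (1 - r) * (F x * G x) + r * (F x * G x - F x * avg i G x)" if "x \<in> cube n" for x
  proof -
    have "real_of_int (x i) * real_of_int (x i) = 1"
      using cube_val[OF that i] by auto
    moreover have "real_of_int (x i) * avg i (\<lambda>x. G x * x i) x = G x - avg i G x"
      using cube_val[OF that i] by (auto simp: avg_def fun_upd_idem field_simps)
    moreover have "noise r [0..<n] (\<lambda>x. F x * x i) x = (1 - r) * (G x * x i) + r * avg i (\<lambda>x. G x * x i) x"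
      unfolding noise_upt[OF i] js_def[symmetric] blur_def chi G_def ..
    ultimately show ?thesis unfolding of_int_mult by algebra
  qed
  have "mean n (\<lambda>x. F x * x i * noise r [0..<n] (\<lambda>x. F x * x i) x)
    = (1 - r) * mean n (\<lambda>x. F x * G x) + r * (mean n (\<lambda>x. F x * G x) - mean n (\<lambda>x. F x * avg i G x))"
    by (simp only: mean_cmult[symmetric] mean_diff[symmetric] mean_add[symmetric]) (rule mean_cong[OF pt])
  then show ?thesis
    unfolding gain_def stability_restr[OF i] stability_split[OF i, of r F] js_def[symmetric] G_def[symmetric] by algebra
qed

lemma stability_bounds:
  assumes "pm n F" "0 \<le> r" "r \<le> 1"
  shows "0 \<le> stability n r F" "stability n r F \<le> 1"
proof -
  obtain q where q: "(1 - q)\<^sup>2 = 1 - r" using noise_root[OF assms(2,3)] by metis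
  have "stability n r F = mean n (\<lambda>x. noise q [0..<n] F x * noise q [0..<n] F x)"
    unfolding stability_def noise_square[OF q, symmetric] by (rule noise_adjoint) auto
  then show "0 \<le> stability n r F"
    using mean_mono[of n "\<lambda>_. 0" "\<lambda>x. noise q [0..<n] F x * noise q [0..<n] F x"] by simp
  have "\<bar>stability n r F\<bar> \<le> 1"
    unfolding stability_def using pm_abs[OF assms(1)] assms(2,3)
    by (intro mean_mult_le_1 abs_nzs_le) auto
  then show "stability n r F \<le> 1" by simp
qed

text \<open>For a function with values -1 and 1 this is the distance to the nearer of the two
  constants.\<close>

definition imbalance :: "nat \<Rightarrow> (point \<Rightarrow> int) \<Rightarrow> real" where
  "imbalance n F = (1 - \<bar>mean n F\<bar>) / 2"

text \<open>The correlation of \<open>F\<close> with the tree g is E[F (g - N g)] + E[h g], where N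
  is smoothing at rate \<open>q\<close> and h = N F. Stability of the tree bounds the first term,
  \<open>osss\<close> the second. Large correlation with a small tree thus forces a large |E F|,
  unless some gain is large.\<close>

lemma imbalance_le:
  assumes F: "pm n F" and T: "decision_tree n T" "dt_size T \<le> s" and r: "0 < r" "r \<le> 1" and a: "0 < a"
    and u: "\<And>i. i < n \<Longrightarrow> gain n r i F \<le> u" and u0: "0 \<le> u"
  shows "imbalance n F \<le> dist_fun n F (dt_eval T) + r * log 2 s / 2 + log 2 s / 2 * ((u / (r * a) + a) / 2)"
proof -
  obtain q where q: "0 \<le> q" "q \<le> r" "q \<le> 1" "(1 - q)\<^sup>2 = 1 - r"
    using noise_root[of r] r by auto
  let ?g = "\<lambda>x. real_of_int (dt_eval T x)" and ?F = "\<lambda>x. real_of_int (F x)"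
  define h where "h = noise q [0..<n] F"
  define M where "M = (u / (r * a) + a) / 2"
  \<comment> \<open>The weight \<open>a\<close> stays free here. A square root of the gain would be
    sharper at one node, but the bound must be linear in \<open>u\<close> to be averaged over a
    level.\<close>
  have M: "mean n (\<lambda>x. \<bar>h x - avg j h x\<bar>) \<le> M" if j: "j < n" for j
  proof -
    have "\<bar>v\<bar> \<le> (1 / (2 * a)) * v\<^sup>2 + a / 2" for v :: real
    proof -
      have "0 \<le> (\<bar>v\<bar> - a)\<^sup>2" by simp
      then have "2 * a * \<bar>v\<bar> \<le> v\<^sup>2 + a\<^sup>2"
        by (simp add: power2_eq_square algebra_simps)
      then show ?thesis using a by (simp add: field_simps power2_eq_square)
    qed
    then have "mean n (\<lambda>x. \<bar>h x - avg j h x\<bar>) \<le> mean n (\<lambda>x. (1 / (2 * a)) * (h x - avg j h x)\<^sup>2 + a / 2)"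
      by (intro mean_mono)
    also have "\<dots> = (1 / (2 * a)) * mean n (\<lambda>x. (h x - avg j h x)\<^sup>2) + a / 2"
      by (simp only: mean_add mean_cmult mean_const)
    also have "\<dots> \<le> (1 / (2 * a)) * (u / r) + a / 2"
    proof (intro add_right_mono mult_left_mono)
      have "r * mean n (\<lambda>x. (h x - avg j h x)\<^sup>2) \<le> u"
        using gain_influence[OF j _ r(2) q(4), of F] u[OF j] r unfolding h_def by linarith
      then show "mean n (\<lambda>x. (h x - avg j h x)\<^sup>2) \<le> u / r"
        using r by (simp add: field_simps)
    qed (use a in auto)
    also have "\<dots> = M" by (simp add: M_def add_divide_distrib)
    finally show ?thesis .
  qed
  have M0: "0 \<le> M" using u0 r a by (simp add: M_def)
  have logs: "0 \<le> log 2 (dt_size T)" "log 2 (dt_size T) \<le> log 2 s"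
    using T(2) dt_size_pos[of T] less_le_trans[OF dt_size_pos T(2)] by (simp_all add: Suc_le_eq)
  have eh: "mean n h = mean n F"
    unfolding h_def by (rule mean_nzs) auto
  have e1: "mean n (\<lambda>x. h x * ?g x) \<le> \<bar>mean n F\<bar> + M * log 2 s"
  proof -
    have "\<bar>mean n ?g\<bar> \<le> 1"
      using mean_mult_le_1[of n "\<lambda>_. 1" ?g] pm_abs[OF pm_dt[OF T(1)]] by simp
    then have "\<bar>mean n F * mean n ?g\<bar> \<le> \<bar>mean n F\<bar> * 1"
      unfolding abs_mult by (intro mult_left_mono) auto
    moreover have "M * log 2 (dt_size T) \<le> M * log 2 s"
      using logs M0 by (intro mult_left_mono) auto
    ultimately show ?thesis using osss[OF T(1) M] unfolding eh by fastforce
  qed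
  \<comment> \<open>\<open>F\<close> and g are signs and |N g| \<le> 1, so F (g - N g) \<le> |g - N
    g| = 1 - g N g pointwise.\<close>
  have e2: "mean n (\<lambda>x. ?F x * (?g x - noise q [0..<n] ?g x)) \<le> r * log 2 s"
  proof -
    have "?F x * (?g x - noise q [0..<n] ?g x) \<le> 1 - ?g x * noise q [0..<n] ?g x" if "x \<in> cube n" for x
    proof -
      have "\<bar>noise q [0..<n] ?g x\<bar> \<le> 1"
        using that pm_abs[OF pm_dt[OF T(1)]] q by (intro abs_nzs_le) auto
      then show ?thesis
        using pm_D[OF F that] dt_eval_val[OF T(1), of x] by (elim disjE) auto
    qed
    then have "mean n (\<lambda>x. ?F x * (?g x - noise q [0..<n] ?g x)) \<le> mean n (\<lambda>x. 1 - ?g x * noise q [0..<n] ?g x)"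
      by (rule mean_mono)
    also have "\<dots> = 1 - mean n (\<lambda>x. ?g x * noise q [0..<n] ?g x)"
      by (simp only: mean_diff mean_const)
    also have "\<dots> \<le> q * log 2 (dt_size T)"
      using dt_noise_stability[OF T(1) q(1,3), of "[0..<n]"] by (simp add: lessThan_atLeast0)
    also have "\<dots> \<le> r * log 2 s"
      using logs q by (intro mult_mono) auto
    finally show ?thesis .
  qed
  have "mean n (\<lambda>x. ?F x * ?g x) = mean n (\<lambda>x. ?F x * (?g x - noise q [0..<n] ?g x)) + mean n (\<lambda>x. ?F x * noise q [0..<n] ?g x)"
    by (simp only: mean_add[symmetric]) (simp add: algebra_simps)
  moreover have "mean n (\<lambda>x. ?F x * noise q [0..<n] ?g x) = mean n (\<lambda>x. h x * ?g x)"
    unfolding h_def by (rule noise_adjoint) auto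
  ultimately have "mean n (\<lambda>x. ?F x * ?g x) \<le> r * log 2 s + \<bar>mean n F\<bar> + M * log 2 s"
    using e1 e2 by linarith
  then show ?thesis
    unfolding imbalance_def dist_fun_ex[OF F pm_dt[OF T(1)]] M_def[symmetric] by argo
qed

section \<open>Trees grown greedily\<close>

text \<open>\<open>ch\<close> and \<open>lb\<close> see only the current restriction, not the path
  to it. Hence a request can recompute its own branch without knowing the rest of the tree.\<close>

primrec build :: "((point \<Rightarrow> int) \<Rightarrow> nat) \<Rightarrow> ((point \<Rightarrow> int) \<Rightarrow> int) \<Rightarrow> nat \<Rightarrow>
    (point \<Rightarrow> int) \<Rightarrow> dtree" where
  "build ch lb 0 F = Leaf (lb F)"
| "build ch lb (Suc k) F =
     Node (ch F) (build ch lb k (restr F (ch F) (-1))) (build ch lb k (restr F (ch F) 1))"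

lemma dt_size_build: "dt_size (build ch lb k F) = 2 ^ k"
  by (induction k arbitrary: F) auto

lemma decision_tree_build:
  assumes "\<And>G. ch G < n" "\<And>G. lb G \<in> {-1, 1}"
  shows "decision_tree n (build ch lb k F)"
  using assms by (induction k arbitrary: F) auto

text \<open>So querying a coordinate again further down is harmless.\<close>

lemma build_indep:
  assumes "\<And>x b. F (x(i := b)) = F x"
  shows "dt_eval (build ch lb k F) (x(i := b)) = dt_eval (build ch lb k F) x"
  using assms
proof (induction k arbitrary: F)
  case (Suc k)
  show ?case
  proof (cases "ch F = i")
    case True
    have "restr F (ch F) c = F" for c
      unfolding restr_def True by (rule ext) (simp only: Suc.prems)
    then show ?thesis using Suc.IH[OF Suc.prems] by simp
  next
    case False
    have "restr F (ch F) c (y(i := b)) = restr F (ch F) c y" for c y b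
      unfolding restr_def by (subst fun_upd_twist) (use False in simp, simp only: Suc.prems)
    note IH = Suc.IH[OF this]
    show ?thesis by (simp only: build.simps dt_eval.simps IH fun_upd_other[OF False])
  qed
qed simp

primrec level_mean :: "((point \<Rightarrow> int) \<Rightarrow> nat) \<Rightarrow> nat \<Rightarrow> ((point \<Rightarrow> int) \<Rightarrow> real) \<Rightarrow>
    (point \<Rightarrow> int) \<Rightarrow> real" where
  "level_mean ch 0 G F = G F"
| "level_mean ch (Suc t) G F = (level_mean ch t G (restr F (ch F) (-1)) + level_mean ch t G (restr F (ch F) 1)) / 2"

definition restrs :: "(nat \<times> int) list \<Rightarrow> (point \<Rightarrow> int) \<Rightarrow> point \<Rightarrow> int" where
  "restrs \<pi> F = foldl (\<lambda>F (i, b). restr F i b) F \<pi>"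

lemma restrs_Nil [simp]: "restrs [] F = F"
  and restrs_Cons [simp]: "restrs ((i, b) # \<pi>) F = restrs \<pi> (restr F i b)"
  by (simp_all add: restrs_def)

text \<open>Chosen without reference to the tree, which depends on the samples: these are all paths
  that any choice of coordinates could produce, repeated queries included.\<close>

definition paths :: "nat \<Rightarrow> nat \<Rightarrow> (nat \<times> int) list set" where
  "paths n k = {\<pi>. length \<pi> = k \<and> set \<pi> \<subseteq> {..<n} \<times> {-1, 1}}"

lemma paths_0 [simp]: "[] \<in> paths n 0"
  by (simp add: paths_def)

lemma paths_Suc: "\<pi> \<in> paths n k \<Longrightarrow> i < n \<Longrightarrow> b = -1 \<or> b = 1 \<Longrightarrow> (i, b) # \<pi> \<in> paths n (Suc k)"
  by (auto simp: paths_def)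

lemma pm_restrs: "pm n F \<Longrightarrow> \<pi> \<in> paths n k \<Longrightarrow> pm n (restrs \<pi> F)"
  by (induction \<pi> arbitrary: F k) (auto simp: paths_def pm_restr)

lemma level_mean_mono:
  assumes "\<And>G. ch G < n" "\<And>\<pi>. \<pi> \<in> paths n t \<Longrightarrow> G1 (restrs \<pi> F) \<le> G2 (restrs \<pi> F)"
  shows "level_mean ch t G1 F \<le> level_mean ch t G2 F"
  using assms(2)
proof (induction t arbitrary: F)
  case 0
  then show ?case using paths_0 by fastforce
next
  case (Suc t)
  have "level_mean ch t G1 (restr F (ch F) b) \<le> level_mean ch t G2 (restr F (ch F) b)" if "b = -1 \<or> b = 1" for b
    using Suc.prems[OF paths_Suc[OF _ assms(1)[of F] that]] by (intro Suc.IH) simp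
  from this[of "-1"] this[of 1] show ?case by simp
qed

lemma level_mean_add: "level_mean ch t (\<lambda>G. G1 G + G2 G) F = level_mean ch t G1 F + level_mean ch t G2 F"
  by (induction t arbitrary: F) (simp_all add: field_simps)

lemma level_mean_cmult: "level_mean ch t (\<lambda>G. k * G1 G) F = k * level_mean ch t G1 F"
  by (induction t arbitrary: F) (simp_all add: field_simps)

lemma level_mean_const: "level_mean ch t (\<lambda>G. k) F = k"
  by (induction t arbitrary: F) simp_all

lemma level_mean_gain:
  "level_mean ch (Suc t) (stability n r) F = level_mean ch t (stability n r) F + level_mean ch t (\<lambda>G. gain n r (ch G) G) F"
proof (induction t arbitrary: F)
  case 0
  then show ?case by (simp add: gain_def)
next
  case (Suc t)
  have "level_mean ch (Suc (Suc t)) (stability n r) F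
    = (level_mean ch (Suc t) (stability n r) (restr F (ch F) (-1)) + level_mean ch (Suc t) (stability n r) (restr F (ch F) 1)) / 2"
    by (rule level_mean.simps(2))
  then show ?case
    unfolding Suc.IH level_mean.simps(2)[of ch t _ F] by argo
qed

lemma level_mean_small_gain:
  fixes D :: nat
  assumes "\<And>G. ch G < n" "pm n F" "0 \<le> r" "r \<le> 1" "0 < D"
  obtains t where "t < D" "level_mean ch t (\<lambda>G. gain n r (ch G) G) F \<le> 1 / D"
proof -
  have sum: "level_mean ch d (stability n r) F = stability n r F + (\<Sum>t<d. level_mean ch t (\<lambda>G. gain n r (ch G) G) F)" for d
    by (induction d) (simp_all only: level_mean_gain level_mean.simps(1) sum.lessThan_Suc, simp_all)
  have "level_mean ch D (stability n r) F \<le> level_mean ch D (\<lambda>G. 1) F"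
    by (rule level_mean_mono[OF assms(1)]) (rule stability_bounds[OF pm_restrs[OF assms(2)] assms(3,4)])
  then have le1: "(\<Sum>t<D. level_mean ch t (\<lambda>G. gain n r (ch G) G) F) \<le> 1"
    using stability_bounds(1)[OF assms(2-4)] unfolding sum level_mean_const by linarith
  have "\<exists>t<D. level_mean ch t (\<lambda>G. gain n r (ch G) G) F \<le> 1 / D"
  proof (rule ccontr)
    assume "\<not> ?thesis"
    then have "(\<Sum>t<D. 1 / real D) < (\<Sum>t<D. level_mean ch t (\<lambda>G. gain n r (ch G) G) F)"
      using assms(5) by (intro sum_strict_mono) auto
    then show False using le1 assms(5) by simp
  qed
  then show thesis using that by blast
qed

lemma mean_restr:
  assumes "i < n"
  shows "mean n F = (mean n (restr F i (-1)) + mean n (restr F i 1)) / 2"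
  unfolding restr_def by (rule mean_split[OF assms])

lemma dist_fun_restr:
  assumes "i < n" "pm n F" "pm n H"
  shows "dist_fun n F H = (dist_fun n (restr F i (-1)) (restr H i (-1)) + dist_fun n (restr F i 1) (restr H i 1)) / 2"
proof -
  have p: "pm n (restr F i (-1))" "pm n (restr F i 1)" "pm n (restr H i (-1))" "pm n (restr H i 1)"
    using assms by (simp_all add: pm_restr)
  show ?thesis
    unfolding dist_fun_ex[OF assms(2,3)] dist_fun_ex[OF p(1,3)] dist_fun_ex[OF p(2,4)]
    by (subst mean_split[OF assms(1)]) (simp add: restr_def field_simps)
qed

lemma restr_dt_eval: "restr (dt_eval T) i b = dt_eval (dt_restr i b T)"
  unfolding restr_def by (rule ext) (simp only: dt_eval_restr)

text \<open>By the triangle inequality \<open>imbalance\<close> is concave in the mean, and a split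
  replaces the mean by two values with this average.\<close>

lemma level_mean_imbalance_antimono:
  assumes "\<And>G. ch G < n" "t \<le> t'"
  shows "level_mean ch t' (imbalance n) F \<le> level_mean ch t (imbalance n) F"
proof -
  have "level_mean ch (Suc t) (imbalance n) F \<le> level_mean ch t (imbalance n) F" for t
  proof (induction t arbitrary: F)
    case 0
    show ?case
      unfolding level_mean.simps imbalance_def mean_restr[OF assms(1)[of F], of F] by argo
  next
    case (Suc t)
    from Suc[of "restr F (ch F) (-1)"] Suc[of "restr F (ch F) 1"] show ?case
      unfolding level_mean.simps(2)[of ch "Suc t"] level_mean.simps(2)[of ch t _ F] by argo
  qed
  then have "antimono (\<lambda>t. level_mean ch t (imbalance n) F)"
    by (intro decseq_SucI)
  with assms(2) show ?thesis by (auto dest: antimonoD)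
qed

text \<open>The distance to \<open>T\<close> is the average of the distances after restricting both
  functions, and restricting \<open>T\<close> does not enlarge it. So the bound at single nodes can
  be averaged over a level, with a different restricted tree at each node.\<close>

lemma level_mean_imbalance_le:
  assumes ch: "\<And>G. ch G < n"
    and node: "\<And>G T. pm n G \<Longrightarrow> decision_tree n T \<Longrightarrow> dt_size T \<le> s \<Longrightarrow>
      imbalance n G \<le> dist_fun n G (dt_eval T) + U G"
    and F: "pm n F" "decision_tree n T" "dt_size T \<le> s"
  shows "level_mean ch t (imbalance n) F \<le> dist_fun n F (dt_eval T) + level_mean ch t U F"
  using F
proof (induction t arbitrary: F T)
  case 0
  then show ?case using node by simp
next
  case (Suc t)
  let ?i = "ch F"
  have IH: "level_mean ch t (imbalance n) (restr F ?i b) \<le>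
      dist_fun n (restr F ?i b) (restr (dt_eval T) ?i b) + level_mean ch t U (restr F ?i b)"
    if "b = -1 \<or> b = 1" for b
    unfolding restr_dt_eval using Suc.prems that ch
    by (intro Suc.IH pm_restr decision_tree_restr order_trans[OF dt_size_restr])
  from IH[of "-1"] IH[of 1] show ?case
    unfolding dist_fun_restr[OF ch[of F] Suc.prems(1) pm_dt[OF Suc.prems(2)]] level_mean.simps(2)
    by argo
qed

lemma dist_fun_build:
  assumes ch: "\<And>G. ch G < n" and lb: "\<And>G. lb G \<in> {-1, 1}" and F: "pm n F"
  shows "dist_fun n F (dt_eval (build ch lb k F)) = level_mean ch k (\<lambda>G. (1 - lb G * mean n G) / 2) F"
  using F
proof (induction k arbitrary: F)
  case 0
  have "pm n (\<lambda>x. lb F)" using lb[of F] by (auto simp: pm_def)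
  then have "dist_fun n F (\<lambda>x. lb F) = (1 - mean n (\<lambda>x. real_of_int (F x) * real_of_int (lb F))) / 2"
    by (rule dist_fun_ex[OF 0])
  also have "mean n (\<lambda>x. real_of_int (F x) * real_of_int (lb F)) = lb F * mean n F"
    unfolding mean_cmult[symmetric] by (simp only: mult.commute)
  finally show ?case by simp
next
  case (Suc k)
  let ?i = "ch F"
  let ?T = "build ch lb (Suc k) F"
  have T: "pm n (dt_eval ?T)" by (intro pm_dt decision_tree_build ch lb)
  have "restr (dt_eval ?T) ?i b = dt_eval (build ch lb k (restr F ?i b))" if "b = -1 \<or> b = 1" for b
  proof
    fix x
    have "dt_eval (build ch lb k (restr F ?i b)) (x(?i := b)) = dt_eval (build ch lb k (restr F ?i b)) x"
      by (rule build_indep) (simp add: restr_def)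
    then show "restr (dt_eval ?T) ?i b x = dt_eval (build ch lb k (restr F ?i b)) x"
      using that by (auto simp: restr_def[of "dt_eval _"])
  qed
  then show ?case
    unfolding dist_fun_restr[OF ch[of F] Suc.prems T] by (simp add: Suc pm_restr ch)
qed

text \<open>The average potential cannot grow at every level by more than the inverse depth, so that at some
  level the chosen coordinates have small gain; the further splits do not harm.\<close>

lemma build_error:
  fixes D :: nat
  assumes ch: "\<And>G. ch G < n" and lb: "\<And>G. lb G \<in> {-1, 1}" and f: "pm n f"
    and T: "decision_tree n T" "dt_size T \<le> s" and r: "0 < r" "r \<le> 1" and a: "0 < a"
    and best: "\<And>\<pi> t i. t < D \<Longrightarrow> \<pi> \<in> paths n t \<Longrightarrow> i < n \<Longrightarrow>
      gain n r i (restrs \<pi> f) \<le> gain n r (ch (restrs \<pi> f)) (restrs \<pi> f) + \<eta>"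
    and label: "\<And>\<pi>. \<pi> \<in> paths n D \<Longrightarrow>
      1 - lb (restrs \<pi> f) * mean n (restrs \<pi> f) \<le> 4 * (1 - \<bar>mean n (restrs \<pi> f)\<bar>)"
    and D0: "D = 0 \<Longrightarrow> s = 1" and D: "0 < D \<Longrightarrow> 1 / D + \<eta> \<le> \<beta>"
  shows "dist_fun n f (dt_eval (build ch lb D f))
    \<le> 4 * (dist_fun n f (dt_eval T) + r * log 2 s / 2 + log 2 s / 2 * ((\<beta> / (r * a) + a) / 2))"
proof -
  define l where "l = log 2 (real s)"
  have s: "1 \<le> s" using T(2) dt_size_pos[of T] by linarith
  then have l: "0 \<le> l" by (simp add: l_def)
  have n: "0 < n" using ch[of f] by simp
  \<comment> \<open>\<open>imbalance_le\<close> needs a bound on the gains of all coordinates, while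
    the pigeonhole argument controls only the chosen one. The maximal gain mediates: by
    \<open>best\<close> it exceeds the chosen gain by at most \<eta>.\<close>
  define mg where "mg G = Max ((\<lambda>i. gain n r i G) ` {..<n})" for G
  have mg_ge: "gain n r i G \<le> mg G" if "i < n" for i G
    using that by (auto simp: mg_def)
  have gain0: "0 \<le> gain n r i G" if "i < n" for i G
  proof -
    obtain q where q: "(1 - q)\<^sup>2 = 1 - r" using noise_root[of r] r by auto
    have "0 \<le> r * mean n (\<lambda>x. (noise q [0..<n] G x - avg i (noise q [0..<n] G) x)\<^sup>2)"
      using r mean_mono[of n "\<lambda>_. 0"] by (intro mult_nonneg_nonneg) auto
    also have "\<dots> \<le> gain n r i G" using gain_influence[OF that _ r(2) q] r by simp
    finally show ?thesis .
  qed
  have mg0: "0 \<le> mg G" for G using mg_ge[OF n] gain0[OF n] by (rule order_trans[rotated])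
  \<comment> \<open>Affine in \<open>mg\<close>, with coefficients independent of the node, so that
    \<open>level_mean\<close> passes through it.\<close>
  define U where "U G = (r * l / 2 + l / 2 * (a / 2)) + (l / 2 / (2 * r * a)) * mg G" for G
  have node: "imbalance n G \<le> dist_fun n G (dt_eval T) + U G"
    if "pm n G" "decision_tree n T" "dt_size T \<le> s" for G T
  proof -
    have "U G = r * l / 2 + l / 2 * ((mg G / (r * a) + a) / 2)"
      unfolding U_def using r a by (simp add: field_simps)
    then show ?thesis using imbalance_le[OF that r a mg_ge mg0] unfolding l_def by linarith
  qed
  have U: "level_mean ch t U F = (r * l / 2 + l / 2 * (a / 2)) + (l / 2 / (2 * r * a)) * level_mean ch t mg F" for t F
    unfolding U_def level_mean_add level_mean_const level_mean_cmult ..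
  have main: "level_mean ch D (imbalance n) f
      \<le> dist_fun n f (dt_eval T) + r * l / 2 + l / 2 * ((\<beta> / (r * a) + a) / 2)"
  proof (cases "D = 0")
    case True
    \<comment> \<open>A tree without levels occurs only for s = 1. Then every error term carries the
      factor \<open>l\<close> = 0 and the root alone gives the bound.\<close>
    then have "l = 0" using D0 by (simp add: l_def)
    then show ?thesis using node[OF f T] True by (simp add: U_def)
  next
    case False
    then have "0 < D" by simp
    obtain t where t: "t < D" "level_mean ch t (\<lambda>G. gain n r (ch G) G) f \<le> 1 / D"
      by (rule level_mean_small_gain[of ch, OF ch f less_imp_le[OF r(1)] r(2) \<open>0 < D\<close>])
    have "level_mean ch t mg f \<le> level_mean ch t (\<lambda>G. gain n r (ch G) G + \<eta>) f"
    proof (rule level_mean_mono[OF ch])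
      fix \<pi> assume "\<pi> \<in> paths n t"
      from best[OF t(1) this] n
      show "mg (restrs \<pi> f) \<le> gain n r (ch (restrs \<pi> f)) (restrs \<pi> f) + \<eta>"
        unfolding mg_def by (subst Max_le_iff) auto
    qed
    then have "level_mean ch t mg f \<le> \<beta>"
      using t(2) D False unfolding level_mean_add level_mean_const by simp
    then have "(l / 2 / (2 * r * a)) * level_mean ch t mg f \<le> (l / 2 / (2 * r * a)) * \<beta>"
      using l r a by (intro mult_left_mono) auto
    moreover have "level_mean ch D (imbalance n) f \<le> level_mean ch t (imbalance n) f"
      using level_mean_imbalance_antimono[OF ch] t(1) by simp
    moreover have "level_mean ch t (imbalance n) f \<le> dist_fun n f (dt_eval T) + level_mean ch t U f"
      by (rule level_mean_imbalance_le[OF ch node f T])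
    moreover have "r * l / 2 + l / 2 * (a / 2) + (l / 2 / (2 * r * a)) * \<beta>
        = r * l / 2 + l / 2 * ((\<beta> / (r * a) + a) / 2)"
      using r a by (simp add: field_simps)
    ultimately show ?thesis unfolding U by linarith
  qed
  have "dist_fun n f (dt_eval (build ch lb D f)) = level_mean ch D (\<lambda>G. (1 - lb G * mean n G) / 2) f"
    by (rule dist_fun_build[OF ch lb f])
  also have "\<dots> \<le> level_mean ch D (\<lambda>G. 4 * imbalance n G) f"
  proof (rule level_mean_mono[OF ch])
    fix \<pi> assume "\<pi> \<in> paths n D"
    from label[OF this]
    show "(1 - lb (restrs \<pi> f) * mean n (restrs \<pi> f)) / 2 \<le> 4 * imbalance n (restrs \<pi> f)"
      unfolding imbalance_def by argo
  qed
  also have "\<dots> = 4 * level_mean ch D (imbalance n) f" by (rule level_mean_cmult)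
  also have "\<dots> \<le> 4 * (dist_fun n f (dt_eval T) + r * l / 2 + l / 2 * ((\<beta> / (r * a) + a) / 2))"
    by (rule mult_left_mono[OF main]) simp
  finally show ?thesis unfolding l_def .
qed

section \<open>Sampling\<close>

text \<open>Values decoded from disjoint blocks of independent coins are independent. This is
  applied at two scales, to the cells of a row and to the rows; \<open>e\<close> is the default that
  \<open>Pi_pmf\<close> prescribes outside \<open>J\<close>.\<close>

lemma Pi_pmf_blocks:
  assumes "finite J" "\<And>j. j \<in> J \<Longrightarrow> finite (I j)" "disjoint_family_on I J"
    and "\<And>j \<omega> \<omega>'. j \<in> J \<Longrightarrow> (\<And>k. k \<in> I j \<Longrightarrow> \<omega> k = \<omega>' k) \<Longrightarrow> dec j \<omega> = dec j \<omega>'"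
  shows "map_pmf (\<lambda>\<omega> j. if j \<in> J then dec j \<omega> else e) (Pi_pmf (\<Union>j\<in>J. I j) d p)
    = Pi_pmf J e (\<lambda>j. map_pmf (dec j) (Pi_pmf (I j) d p))"
  using assms(1) assms(2-)
proof (induction J rule: finite_induct)
  case empty
  then show ?case by simp
next
  case (insert a J)
  let ?U = "\<Union>j\<in>J. I j"
  have disj: "I a \<inter> I j = {}" if "j \<in> J" for j
    by (rule disjoint_family_onD[OF insert.prems(2)]) (use that insert.hyps(2) in auto)
  have IH: "map_pmf (\<lambda>\<omega> j. if j \<in> J then dec j \<omega> else e) (Pi_pmf ?U d p)
    = Pi_pmf J e (\<lambda>j. map_pmf (dec j) (Pi_pmf (I j) d p))"
  proof (rule insert.IH)
    show "disjoint_family_on I J"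
      using insert.prems(2) by (rule disjoint_family_on_mono[rotated]) auto
    show "dec j \<omega> = dec j \<omega>'" if "j \<in> J" "\<And>k. k \<in> I j \<Longrightarrow> \<omega> k = \<omega>' k" for j \<omega> \<omega>'
      by (rule insert.prems(3)) (use that in auto)
  qed (use insert.prems(1) in auto)
  have "Pi_pmf (\<Union>j\<in>insert a J. I j) d p =
      map_pmf (\<lambda>(f, g) x. if x \<in> I a then f x else g x) (pair_pmf (Pi_pmf (I a) d p) (Pi_pmf ?U d p))"
    unfolding UN_insert using insert.hyps insert.prems(1) disj by (intro Pi_pmf_union) auto
  then have "map_pmf (\<lambda>\<omega> j. if j \<in> insert a J then dec j \<omega> else e) (Pi_pmf (\<Union>j\<in>insert a J. I j) d p)
    = map_pmf (\<lambda>(f, g) j. if j \<in> insert a J then dec j (\<lambda>x. if x \<in> I a then f x else g x) else e)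
       (pair_pmf (Pi_pmf (I a) d p) (Pi_pmf ?U d p))"
    by (simp add: map_pmf_comp case_prod_beta')
  also have "\<dots> = map_pmf (\<lambda>(f, g). (\<lambda>j. if j \<in> J then dec j g else e)(a := dec a f))
       (pair_pmf (Pi_pmf (I a) d p) (Pi_pmf ?U d p))"
  proof (intro map_pmf_cong refl, clarify, rule ext)
    fix f g j
    show "(if j \<in> insert a J then dec j (\<lambda>x. if x \<in> I a then f x else g x) else e)
        = ((\<lambda>j. if j \<in> J then dec j g else e)(a := dec a f)) j"
    proof (cases "j = a")
      case True
      have "dec a (\<lambda>x. if x \<in> I a then f x else g x) = dec a f"
        by (rule insert.prems(3)) auto
      with True show ?thesis by simp
    next
      case False
      have "dec j (\<lambda>x. if x \<in> I a then f x else g x) = dec j g" if "j \<in> J"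
        by (rule insert.prems(3)) (use disj[OF that] that in auto)
      with False show ?thesis by simp
    qed
  qed
  also have "\<dots> = map_pmf (\<lambda>(y, f). f(a := y)) (pair_pmf (map_pmf (dec a) (Pi_pmf (I a) d p))
      (map_pmf (\<lambda>\<omega> j. if j \<in> J then dec j \<omega> else e) (Pi_pmf ?U d p)))"
    unfolding pair_map_pmf1 pair_map_pmf2 by (simp add: map_pmf_comp case_prod_beta')
  also have "\<dots> = Pi_pmf (insert a J) e (\<lambda>j. map_pmf (dec j) (Pi_pmf (I j) d p))"
    unfolding IH by (rule Pi_pmf_insert[symmetric]) (use insert.hyps in auto)
  finally show ?case .
qed

section \<open>Reduction of the infinite coin sequence to finite prefixes\<close>

abbreviation fair_coins :: "nat \<Rightarrow> (nat \<Rightarrow> bool) pmf" where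
  "fair_coins N \<equiv> Pi_pmf {..<N} False (\<lambda>_. bernoulli_pmf (1 / 2))"

lemma pmf_fair_coins: "\<forall>k\<ge>N. \<not> g k \<Longrightarrow> pmf (fair_coins N) g = (1 / 2) ^ N"
  by (subst pmf_Pi') (auto simp: bernoulli_pmf_half_conv_pmf_of_set)

text \<open>An event decided by the first \<open>N\<close> coins is a finite disjoint union of
  cylinders, one per prefix and each of measure 2^-N. This moves the computation from a product
  measure on sequences to a pmf and settles measurability on the way.\<close>

lemma prob_coins:
  assumes "\<And>\<omega> \<omega>'. (\<And>k. k < N \<Longrightarrow> \<omega> k = \<omega>' k) \<Longrightarrow> Q \<omega> \<Longrightarrow> Q \<omega>'"
  shows "\<P>(\<omega> in coins. Q \<omega>) = measure_pmf.prob (fair_coins N) {\<omega>. Q \<omega>}"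
proof -
  interpret P: product_prob_space "\<lambda>_. measure_pmf (bernoulli_pmf (1 / 2))" "UNIV :: nat set"
    by unfold_locales
  interpret C: prob_space coins unfolding coins_def by unfold_locales
  \<comment> \<open>Prefixes are represented by sequences padded with \<open>False\<close>, the
    default value of \<open>fair_coins N\<close>, so that each prefix has exactly one
    representative.\<close>
  define S where "S = {g. (\<forall>k\<ge>N. \<not> g k) \<and> Q g}"
  have fin: "finite S"
  proof (rule finite_subset)
    show "S \<subseteq> PiE_dflt {..<N} False (\<lambda>_. UNIV)"
      unfolding S_def PiE_dflt_def by (simp add: Collect_mono_iff not_less)
  qed (rule finite_PiE_dflt, simp_all)
  define B where "B g = prod_emb UNIV (\<lambda>_. measure_pmf (bernoulli_pmf (1 / 2))) {..<N} (PiE {..<N} (\<lambda>k. {g k :: bool}))" for g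
  have B_iff: "\<omega> \<in> B g \<longleftrightarrow> (\<forall>k<N. \<omega> k = g k)" for \<omega> g
    by (auto simp: B_def prod_emb_def PiE_iff extensional_def space_PiM)
  have B_sets: "B g \<in> sets coins" for g
    unfolding B_def coins_def by (intro sets_PiM_I) auto
  have B_prob: "measure coins (B g) = (1 / 2) ^ N" for g
  proof -
    have "measure coins (B g) = (\<Prod>k<N. measure (measure_pmf (bernoulli_pmf (1 / 2))) {g k})"
      unfolding B_def coins_def by (rule P.measure_PiM_emb) auto
    also have "\<dots> = (\<Prod>k<N. 1 / 2)"
      by (intro prod.cong refl) (simp add: measure_pmf_single bernoulli_pmf_half_conv_pmf_of_set)
    finally show ?thesis by simp
  qed
  have disj: "disjoint_family_on B S"
  proof -
    have "g = h" if "g \<in> S" "h \<in> S" "\<omega> \<in> B g" "\<omega> \<in> B h" for g h \<omega>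
    proof
      fix k
      show "g k = h k" using that by (cases "k < N") (auto simp: S_def B_iff not_less)
    qed
    then show ?thesis unfolding disjoint_family_on_def by blast
  qed
  have "{\<omega> \<in> space coins. Q \<omega>} = (\<Union>g\<in>S. B g)"
  proof (intro set_eqI iffI)
    fix \<omega> assume "\<omega> \<in> {\<omega> \<in> space coins. Q \<omega>}"
    then have "Q (\<lambda>k. k < N \<and> \<omega> k)" using assms[of \<omega> "\<lambda>k. k < N \<and> \<omega> k"] by simp
    then show "\<omega> \<in> (\<Union>g\<in>S. B g)"
      by (intro UN_I[of "\<lambda>k. k < N \<and> \<omega> k"]) (auto simp: S_def B_iff)
  next
    fix \<omega> assume "\<omega> \<in> (\<Union>g\<in>S. B g)"
    then obtain g where "Q g" "\<forall>k<N. \<omega> k = g k" by (auto simp: S_def B_iff)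
    then show "\<omega> \<in> {\<omega> \<in> space coins. Q \<omega>}"
      using assms[of g \<omega>] by (auto simp: coins_def space_PiM)
  qed
  then have "\<P>(\<omega> in coins. Q \<omega>) = measure coins (\<Union>g\<in>S. B g)" by simp
  also have "\<dots> = (\<Sum>g\<in>S. measure coins (B g))"
    using fin disj B_sets by (intro C.finite_measure_finite_Union) auto
  also have "\<dots> = (\<Sum>g\<in>S. pmf (fair_coins N) g)"
    by (intro sum.cong refl) (subst pmf_fair_coins, auto simp: B_prob S_def)
  also have "\<dots> = measure_pmf.prob (fair_coins N) S"
    by (rule measure_measure_pmf_finite[OF fin, symmetric])
  also have "\<dots> = measure_pmf.prob (fair_coins N) {\<omega>. Q \<omega>}"
  proof (rule measure_prob_cong_0)
    fix g assume "g \<in> {\<omega>. Q \<omega>} - S"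
    then show "pmf (fair_coins N) g = 0"
      by (intro pmf_Pi_outside) (auto simp: S_def not_less)
  qed (auto simp: S_def)
  finally show ?thesis .
qed


text \<open>Cell \<open>k\<close> owns u + 1 consecutive coins. The first is the bit of x; the
  conjunction of the other \<open>u\<close> tells whether y differs, and the inequality of booleans
  is exclusive or. A flip of probability 2^-u amounts to rerandomization at rate 2^(1-u).\<close>

definition cell :: "nat \<Rightarrow> (nat \<Rightarrow> bool) \<Rightarrow> nat \<Rightarrow> bool \<times> bool" where
  "cell u \<omega> k = (\<omega> (k * (u + 1)), \<omega> (k * (u + 1)) \<noteq> (\<forall>l<u. \<omega> (k * (u + 1) + 1 + l)))"

definition pairp :: "nat \<Rightarrow> (bool \<times> bool) pmf" where
  "pairp u = map_pmf (\<lambda>(y, c). (y, y \<noteq> c)) (pair_pmf (bernoulli_pmf (1 / 2)) (bernoulli_pmf ((1 / 2) ^ u)))"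

lemma pmf_pairp: "pmf (pairp u) (a, b) = (1 / 2) * (if a = b then 1 - (1 / 2) ^ u else (1 / 2) ^ u)"
proof -
  have inj: "inj (\<lambda>(y :: bool, c :: bool). (y, y \<noteq> c))" by (auto intro!: injI)
  have "pmf (pairp u) ((\<lambda>(y, c). (y, y \<noteq> c)) (a, a \<noteq> b))
      = pmf (pair_pmf (bernoulli_pmf (1 / 2)) (bernoulli_pmf ((1 / 2) ^ u))) (a, a \<noteq> b)"
    unfolding pairp_def by (rule pmf_map_inj'[OF inj])
  moreover have "(\<lambda>(y, c). (y, y \<noteq> c)) (a, a \<noteq> b) = (a, b)" by auto
  moreover have "(1 / 2 :: real) ^ u \<le> 1" by (simp add: power_le_one)
  ultimately show ?thesis by (cases a; cases b) (simp_all add: pmf_pair)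
qed

lemma all_coins: "finite A \<Longrightarrow>
  map_pmf (\<lambda>\<omega>. \<forall>k\<in>A. \<omega> k) (Pi_pmf A False (\<lambda>_. bernoulli_pmf (1 / 2))) = bernoulli_pmf ((1 / 2) ^ card A)"
proof (rule pmf_eqI)
  fix b :: bool
  assume A: "finite A"
  let ?p = "Pi_pmf A False (\<lambda>_. bernoulli_pmf (1 / 2))"
  have "measure_pmf.prob ?p (Pi A (\<lambda>_. {True})) = (\<Prod>k\<in>A. measure_pmf.prob (bernoulli_pmf (1 / 2)) {True})"
    by (rule measure_Pi_pmf_Pi[OF A])
  then have *: "measure_pmf.prob ?p {\<omega>. \<forall>k\<in>A. \<omega> k} = (1 / 2) ^ card A"
    by (simp add: Pi_def measure_pmf_single Ball_def)
  have T: "pmf (map_pmf (\<lambda>\<omega>. \<forall>k\<in>A. \<omega> k) ?p) True = (1 / 2) ^ card A"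
    unfolding *[symmetric] by (simp add: pmf_map vimage_def)
  have "(1 / 2 :: real) ^ card A \<le> 1" by (simp add: power_le_one)
  with T show "pmf (map_pmf (\<lambda>\<omega>. \<forall>k\<in>A. \<omega> k) ?p) b = pmf (bernoulli_pmf ((1 / 2) ^ card A)) b"
    by (cases b) (simp_all add: pmf_False_conv_True)
qed

lemma cell_law:
  "map_pmf (\<lambda>\<omega>. cell u \<omega> k) (Pi_pmf {k * (u + 1)..<(k + 1) * (u + 1)} False (\<lambda>_. bernoulli_pmf (1 / 2))) = pairp u"
proof -
  let ?k = "k * (u + 1)"
  let ?A = "{?k + 1..<?k + 1 + u}"
  let ?p = "Pi_pmf ?A False (\<lambda>_. bernoulli_pmf (1 / 2))"
  have ins: "{?k..<(k + 1) * (u + 1)} = insert ?k ?A" by auto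
  have all: "(\<forall>l<u. \<omega> (?k + 1 + l)) \<longleftrightarrow> (\<forall>k\<in>?A. \<omega> k)" for \<omega> :: "nat \<Rightarrow> bool"
  proof
    assume *: "\<forall>l<u. \<omega> (?k + 1 + l)"
    show "\<forall>k\<in>?A. \<omega> k"
    proof
      fix j assume "j \<in> ?A"
      then have "j = ?k + 1 + (j - (?k + 1))" "j - (?k + 1) < u" by auto
      then show "\<omega> j" using * by metis
    qed
  qed auto
  have "map_pmf (\<lambda>\<omega>. cell u \<omega> k) (Pi_pmf (insert ?k ?A) False (\<lambda>_. bernoulli_pmf (1 / 2)))
    = map_pmf (\<lambda>(y, f). cell u (f(?k := y)) k) (pair_pmf (bernoulli_pmf (1 / 2)) ?p)"
    by (subst Pi_pmf_insert) (simp_all add: map_pmf_comp case_prod_beta')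
  also have "\<dots> = map_pmf (\<lambda>(y, f). (y, y \<noteq> (\<forall>k\<in>?A. f k))) (pair_pmf (bernoulli_pmf (1 / 2)) ?p)"
  proof (intro map_pmf_cong refl, clarify)
    fix y f
    have "(\<forall>j\<in>?A. (f(?k := y)) j) = (\<forall>j\<in>?A. f j)" by auto
    then show "cell u (f(?k := y)) k = (y, y \<noteq> (\<forall>k\<in>?A. f k))"
      unfolding cell_def all by simp
  qed
  also have "\<dots> = map_pmf (\<lambda>(y, c). (y, y \<noteq> c)) (pair_pmf (bernoulli_pmf (1 / 2)) (map_pmf (\<lambda>f. \<forall>k\<in>?A. f k) ?p))"
    unfolding pair_map_pmf2 by (simp add: map_pmf_comp case_prod_beta')
  also have "\<dots> = pairp u"
    by (subst all_coins) (simp_all add: pairp_def)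
  finally show ?thesis unfolding ins .
qed

lemma UN_blocks: "(\<Union>i<n. {(a + i) * b..<(a + i + 1) * b}) = {a * b..<(a + n) * (b :: nat)}"
proof (induction n)
  case (Suc n)
  have "{a * b..<(a + n) * b} \<union> {(a + n) * b..<(a + n + 1) * b} = {a * b..<(a + Suc n) * b}"
    by (subst ivl_disj_un_two(3)) auto
  then show ?case using Suc by (simp add: lessThan_Suc Un_commute)
qed simp

lemma disjoint_blocks: "disjoint_family_on (\<lambda>i. {(a + i) * b..<(a + i + 1) * (b :: nat)}) S"
proof -
  have "i = j" if "(a + i) * b \<le> x" "x < (a + i + 1) * b" "(a + j) * b \<le> x" "x < (a + j + 1) * b" for i j x
  proof -
    have "(a + i) * b < (a + j + 1) * b" "(a + j) * b < (a + i + 1) * b" using that by linarith+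
    then have "a + i < a + j + 1" "a + j < a + i + 1" by (metis mult_less_cancel2)+
    then show ?thesis by linarith
  qed
  then show ?thesis unfolding disjoint_family_on_def by fastforce
qed

lemma cell_cong:
  assumes "\<And>l. l \<in> {k * (u + 1)..<(k + 1) * (u + 1)} \<Longrightarrow> \<omega> l = \<omega>' l"
  shows "cell u \<omega> k = cell u \<omega>' k"
proof -
  have "\<omega> (k * (u + 1)) = \<omega>' (k * (u + 1))" by (rule assms) simp
  moreover have "\<omega> (k * (u + 1) + 1 + l) = \<omega>' (k * (u + 1) + 1 + l)" if "l < u" for l
    by (rule assms) (use that in simp)
  ultimately show ?thesis unfolding cell_def by simp
qed

text \<open>Padded beyond \<open>n\<close> so as to match the default of \<open>Pi_pmf\<close>. The
  program sees the unpadded version, \<open>samples\<close>.\<close>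

definition row :: "nat \<Rightarrow> nat \<Rightarrow> (nat \<Rightarrow> bool) \<Rightarrow> nat \<Rightarrow> nat \<Rightarrow> bool \<times> bool" where
  "row u n \<omega> j = (\<lambda>i. if i \<in> {..<n} then cell u \<omega> (j * n + i) else (False, False))"

definition row_law :: "nat \<Rightarrow> nat \<Rightarrow> (nat \<Rightarrow> bool \<times> bool) pmf" where
  "row_law u n = Pi_pmf {..<n} (False, False) (\<lambda>_. pairp u)"

lemma rows_law:
  "map_pmf (\<lambda>\<omega> j. if j \<in> {..<m} then row u n \<omega> j else e) (fair_coins (m * n * (u + 1)))
    = Pi_pmf {..<m} e (\<lambda>_. row_law u n)"
proof -
  let ?b = "n * (u + 1)"
  let ?p = "\<lambda>I. Pi_pmf I False (\<lambda>_. bernoulli_pmf (1 / 2))"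
  have un: "(\<Union>j<m. {(0 + j) * ?b..<(0 + j + 1) * ?b}) = {..<m * n * (u + 1)}"
    unfolding UN_blocks by (auto simp: algebra_simps)
  have un': "(\<Union>i<n. {(j * n + i) * (u + 1)..<(j * n + i + 1) * (u + 1)}) = {(0 + j) * ?b..<(0 + j + 1) * ?b}" for j
    unfolding UN_blocks by (simp add: algebra_simps)
  have row: "map_pmf (\<lambda>\<omega>. row u n \<omega> j) (?p {(0 + j) * ?b..<(0 + j + 1) * ?b}) = row_law u n" for j
  proof -
    have "map_pmf (\<lambda>\<omega> i. if i \<in> {..<n} then cell u \<omega> (j * n + i) else (False, False))
        (?p (\<Union>i<n. {(j * n + i) * (u + 1)..<(j * n + i + 1) * (u + 1)}))
      = Pi_pmf {..<n} (False, False) (\<lambda>i. map_pmf (\<lambda>\<omega>. cell u \<omega> (j * n + i))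
          (?p {(j * n + i) * (u + 1)..<(j * n + i + 1) * (u + 1)}))"
      by (rule Pi_pmf_blocks, simp, simp, rule disjoint_blocks, rule cell_cong, blast)
    then show ?thesis unfolding cell_law un' row_def row_law_def .
  qed
  have "map_pmf (\<lambda>\<omega> j. if j \<in> {..<m} then row u n \<omega> j else e) (?p (\<Union>j<m. {(0 + j) * ?b..<(0 + j + 1) * ?b}))
    = Pi_pmf {..<m} e (\<lambda>j. map_pmf (\<lambda>\<omega>. row u n \<omega> j) (?p {(0 + j) * ?b..<(0 + j + 1) * ?b}))"
  proof (rule Pi_pmf_blocks)
    fix j \<omega> \<omega>'
    assume *: "\<And>k. k \<in> {(0 + j) * ?b..<(0 + j + 1) * ?b} \<Longrightarrow> \<omega> k = (\<omega>' k :: bool)"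
    show "row u n \<omega> j = row u n \<omega>' j"
      unfolding row_def
    proof (rule ext, rule if_cong)
      fix i assume "i \<in> {..<n}"
      then have "{(j * n + i) * (u + 1)..<(j * n + i + 1) * (u + 1)} \<subseteq> {(0 + j) * ?b..<(0 + j + 1) * ?b}"
        unfolding un'[symmetric] by blast
      then show "cell u \<omega> (j * n + i) = cell u \<omega>' (j * n + i)"
        by (intro cell_cong *) blast
    qed simp_all
  qed (simp_all only: finite_lessThan finite_atLeastLessThan disjoint_blocks)
  then show ?thesis unfolding un row .
qed

section \<open>Noisy pairs of points and their correlations\<close>

definition px :: "nat \<Rightarrow> (nat \<Rightarrow> bool) \<Rightarrow> nat \<Rightarrow> int" where
  "px n b = (\<lambda>i\<in>{..<n}. if b i then 1 else -1)"

lemma px_cube [simp]: "px n b \<in> cube n"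
  by (simp add: px_def cube_def)

lemma px_upd: "px (Suc n) (b(n := c)) = (px n b)(n := if c then 1 else -1)"
  by (auto simp: px_def fun_eq_iff)

lemma ex_Suc: "mean (Suc n) F = (mean n (\<lambda>x. F (x(n := -1))) + mean n (\<lambda>x. F (x(n := 1)))) / 2"
proof -
  have "cube (Suc n) = (\<lambda>(y, g). g(n := y)) ` ({-1, 1} \<times> cube n)"
    unfolding cube_def lessThan_Suc by (rule PiE_insert_eq)
  moreover have "inj_on (\<lambda>(y, g). g(n := y)) ({-1, 1} \<times> cube n)"
    unfolding cube_def by (rule inj_combinator) simp
  ultimately have "(\<Sum>x\<in>cube (Suc n). F x) = (\<Sum>(y, g)\<in>{-1, 1} \<times> cube n. F (g(n := y)))"
    by (simp add: sum.reindex case_prod_beta')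
  also have "\<dots> = (\<Sum>x\<in>cube n. F (x(n := -1))) + (\<Sum>x\<in>cube n. F (x(n := 1)))"
    by (simp add: sum.cartesian_product[symmetric])
  finally show ?thesis by (simp add: mean_def field_simps)
qed

lemma noise_linear: "noise r js (\<lambda>x. k * F x + l * G x) = (\<lambda>x. k * noise r js F x + l * noise r js G x)"
proof (induction js)
  case (Cons j js)
  show ?case unfolding nzs_Cons Cons blur_def avg_linear by (rule ext) (simp add: algebra_simps)
qed simp

lemma finite_row_law: "finite (set_pmf (row_law u n))"
  unfolding row_law_def by (rule finite_subset[OF set_Pi_pmf_subset']) (auto intro!: finite_PiE_dflt)

text \<open>Induction on the dimension, conditioning on the last pair of bits. These differ with
  probability (1/2)^u, which is noise at twice that rate, since a rerandomized bit changes only half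
  of the time.\<close>

lemma row_expectation:
  "measure_pmf.expectation (row_law u n) (\<lambda>v. F (px n (\<lambda>i. fst (v i))) * G (px n (\<lambda>i. snd (v i))))
    = mean n (\<lambda>x. F x * noise (2 * (1 / 2) ^ u) [0..<n] G x)"
proof (induction n arbitrary: F G)
  case 0
  have "cube 0 = {px 0 (\<lambda>_. False)}" by (auto simp: cube_def px_def)
  then show ?case by (simp add: row_law_def mean_def px_def restrict_def)
next
  case (Suc n)
  let ?q = "(1 / 2 :: real) ^ u" and ?s = "\<lambda>c :: bool. if c then 1 else -1 :: int"
  let ?N = "noise (2 * ?q) [0..<n]"
  let ?E = "\<lambda>a b. mean n (\<lambda>x. F (x(n := ?s a)) * ?N (\<lambda>x. G (x(n := ?s b))) x)"
  have law: "row_law u (Suc n) = pairp u \<bind> (\<lambda>y. map_pmf (\<lambda>f. f(n := y)) (row_law u n))"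
    unfolding row_law_def lessThan_Suc map_pmf_def by (rule Pi_pmf_insert') auto
  have "measure_pmf.expectation (row_law u (Suc n))
      (\<lambda>v. F (px (Suc n) (\<lambda>i. fst (v i))) * G (px (Suc n) (\<lambda>i. snd (v i))))
    = (\<Sum>y\<in>UNIV. pmf (pairp u) y *\<^sub>R measure_pmf.expectation (map_pmf (\<lambda>f. f(n := y)) (row_law u n))
        (\<lambda>v. F (px (Suc n) (\<lambda>i. fst (v i))) * G (px (Suc n) (\<lambda>i. snd (v i)))))"
    unfolding law by (rule pmf_expectation_bind) (auto simp: finite_row_law)
  also have "\<dots> = (\<Sum>y\<in>UNIV. pmf (pairp u) y * ?E (fst y) (snd y))"
  proof (rule sum.cong[OF refl])
    fix y :: "bool \<times> bool"
    have "px (Suc n) (\<lambda>i. fst ((v(n := y)) i)) = (px n (\<lambda>i. fst (v i)))(n := ?s (fst y))" for v :: "nat \<Rightarrow> bool \<times> bool"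
      unfolding px_upd[symmetric] by (rule arg_cong[where f = "px (Suc n)"]) auto
    moreover have "px (Suc n) (\<lambda>i. snd ((v(n := y)) i)) = (px n (\<lambda>i. snd (v i)))(n := ?s (snd y))" for v :: "nat \<Rightarrow> bool \<times> bool"
      unfolding px_upd[symmetric] by (rule arg_cong[where f = "px (Suc n)"]) auto
    ultimately show "pmf (pairp u) y *\<^sub>R measure_pmf.expectation (map_pmf (\<lambda>f. f(n := y)) (row_law u n))
        (\<lambda>v. F (px (Suc n) (\<lambda>i. fst (v i))) * G (px (Suc n) (\<lambda>i. snd (v i))))
      = pmf (pairp u) y * ?E (fst y) (snd y)"
      unfolding integral_map_pmf using Suc[of "\<lambda>x. F (x(n := ?s (fst y)))" "\<lambda>x. G (x(n := ?s (snd y)))"]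
      by (simp only: real_scaleR_def)
  qed
  also have "\<dots> = (1 / 2) * (((1 - ?q) * ?E True True + ?q * ?E True False) + ((1 - ?q) * ?E False False + ?q * ?E False True))"
  proof -
    have U: "(UNIV :: (bool \<times> bool) set) = {(True, True), (True, False), (False, False), (False, True)}" by auto
    show ?thesis unfolding U by (simp add: pmf_pairp algebra_simps)
  qed
  also have "\<dots> = mean (Suc n) (\<lambda>x. F x * noise (2 * ?q) [0..<Suc n] G x)"
  proof -
    have N: "noise (2 * ?q) [0..<Suc n] G (x(n := b)) = ?N (\<lambda>x. blur (2 * ?q) n G (x(n := b))) x" for x b
    proof -
      have "noise (2 * ?q) [0..<Suc n] G = ?N (blur (2 * ?q) n G)" by (simp add: noise_def)
      then show ?thesis by (simp only:) (rule noise_upd, simp)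
    qed
    have nz1: "(\<lambda>x. blur (2 * ?q) n G (x(n := 1))) = (\<lambda>x. (1 - ?q) * G (x(n := 1)) + ?q * G (x(n := -1)))"
      unfolding blur_def avg_def fun_upd_upd by (rule ext) argo
    have nz2: "(\<lambda>x. blur (2 * ?q) n G (x(n := -1))) = (\<lambda>x. (1 - ?q) * G (x(n := -1)) + ?q * G (x(n := 1)))"
      unfolding blur_def avg_def fun_upd_upd by (rule ext) argo
    have lin: "mean n (\<lambda>x. A x * (k * B x + l * C x)) = k * mean n (\<lambda>x. A x * B x) + l * mean n (\<lambda>x. A x * C x)" for A B C k l
      by (simp only: mean_cmult[symmetric] mean_add[symmetric]) (simp only: algebra_simps)
    show ?thesis unfolding ex_Suc N nz1 nz2 noise_linear lin if_True if_False by argo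
  qed
  finally show ?case .
qed

section \<open>Concentration of the sampled counts\<close>

lemma sample_concentration:
  fixes p :: "'b pmf" and m :: nat
  assumes m: "0 < m" and \<eta>: "0 \<le> \<eta>"
  shows "measure_pmf.prob (Pi_pmf {..<m} e (\<lambda>_. p))
      {V. \<eta> \<le> \<bar>real (card {j. j < m \<and> \<phi> (V j)}) / m - measure_pmf.prob p {v. \<phi> v}\<bar>}
    \<le> 2 * exp (- 2 * real m * \<eta>\<^sup>2)"
proof -
  let ?M = "Pi_pmf {..<m} e (\<lambda>_. p)"
  define g where "g v = (if \<phi> v then 1 else 0 :: real)" for v
  define X where "X j V = g (V j)" for j :: nat and V :: "nat \<Rightarrow> 'b"
  let ?\<mu> = "\<Sum>j<m. measure_pmf.expectation ?M (X j)"
  interpret Hoeffding_ineq "measure_pmf ?M" "{..<m}" X "\<lambda>_. 0" "\<lambda>_. 1" ?\<mu>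
  proof unfold_locales
    have "prob_space.indep_vars (measure_pmf ?M) (\<lambda>_. borel) (\<lambda>j. g \<circ> (\<lambda>V. V j)) {..<m}"
      by (rule prob_space.indep_vars_compose[OF measure_pmf.prob_space_axioms indep_vars_Pi_pmf]) auto
    then show "prob_space.indep_vars (measure_pmf ?M) (\<lambda>_. borel) X {..<m}"
      unfolding X_def comp_def .
  qed (auto simp: X_def g_def)
  have exp: "measure_pmf.expectation ?M (X j) = measure_pmf.prob p {v. \<phi> v}" if "j < m" for j
  proof -
    have "measure_pmf.expectation (map_pmf (\<lambda>V. V j) ?M) g = measure_pmf.expectation ?M (X j)"
      unfolding integral_map_pmf X_def ..
    moreover have "map_pmf (\<lambda>V. V j) ?M = p"
      using Pi_pmf_component[of "{..<m}" j e "\<lambda>_. p"] that by simp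
    moreover have "g = indicat_real {v. \<phi> v}" by (auto simp: g_def indicator_def)
    then have "measure_pmf.expectation p g = measure_pmf.prob p {v. \<phi> v}" by simp
    ultimately show ?thesis by simp
  qed
  have \<mu>: "?\<mu> = real m * measure_pmf.prob p {v. \<phi> v}" by (simp add: exp)
  have X: "(\<Sum>j<m. X j V) = card {j. j < m \<and> \<phi> (V j)}" for V
  proof -
    have "{..<m} \<inter> {j. \<phi> (V j)} = {j. j < m \<and> \<phi> (V j)}" by auto
    then show ?thesis unfolding X_def g_def by (simp add: sum.If_cases)
  qed
  have iff: "\<eta> \<le> \<bar>real k / m - q\<bar> \<longleftrightarrow> real m * \<eta> \<le> \<bar>real k - real m * q\<bar>" for k q
  proof -
    have "real k / m - q = (real k - real m * q) / m" using m by (simp add: field_simps)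
    then have "\<bar>real k / m - q\<bar> = \<bar>real k - real m * q\<bar> / m" by (simp only: abs_divide abs_of_nat)
    then show ?thesis using m by (simp add: field_simps)
  qed
  have "measure_pmf.prob ?M {V \<in> space ?M. real m * \<eta> \<le> \<bar>(\<Sum>j<m. X j V) - ?\<mu>\<bar>}
      \<le> 2 * exp (- 2 * (real m * \<eta>)\<^sup>2 / (\<Sum>j<m. (1 - 0)\<^sup>2))"
    by (rule Hoeffding_ineq_abs_ge) (use m \<eta> in auto)
  also have "- 2 * (real m * \<eta>)\<^sup>2 / (\<Sum>j<m. (1 - 0)\<^sup>2) = - 2 * real m * \<eta>\<^sup>2"
    using m by (simp add: power2_eq_square)
  finally show ?thesis unfolding iff X \<mu> by simp
qed

text \<open>For signs, equality of the two comparisons means that the product of G(x), G(y), x_i and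
  y_i is 1. In this form the statistic can be counted with bits.\<close>

definition score :: "nat \<Rightarrow> nat \<Rightarrow> (nat \<Rightarrow> nat \<Rightarrow> bool \<times> bool) \<Rightarrow> (point \<Rightarrow> int) \<Rightarrow> nat \<Rightarrow> nat" where
  "score n m V G i = card {j. j < m \<and>
     ((G (px n (\<lambda>i. fst (V j i))) = G (px n (\<lambda>i. snd (V j i)))) = (fst (V j i) = snd (V j i)))}"

definition ones :: "nat \<Rightarrow> nat \<Rightarrow> (nat \<Rightarrow> nat \<Rightarrow> bool \<times> bool) \<Rightarrow> (point \<Rightarrow> int) \<Rightarrow> nat" where
  "ones n m V G = card {j. j < m \<and> G (px n (\<lambda>i. fst (V j i))) = 1}"

definition score_ex :: "nat \<Rightarrow> real \<Rightarrow> (point \<Rightarrow> int) \<Rightarrow> nat \<Rightarrow> real" where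
  "score_ex n r G i = (1 - r) * stability n r G + (2 - r) * gain n r i G"

text \<open>A sign with mean v equals 1 with probability (1 + v) / 2, and these probabilities are
  what the counts estimate.\<close>

definition accurate :: "nat \<Rightarrow> nat \<Rightarrow> nat \<Rightarrow> real \<Rightarrow> (point \<Rightarrow> int) \<Rightarrow> (nat \<Rightarrow> nat \<Rightarrow> bool \<times> bool) \<Rightarrow> bool" where
  "accurate n u m \<eta> G V \<longleftrightarrow>
     (\<forall>i<n. \<bar>real (score n m V G i) / m - (1 + score_ex n (2 * (1 / 2) ^ u) G i) / 2\<bar> < \<eta>) \<and>
     \<bar>real (ones n m V G) / m - (1 + mean n G) / 2\<bar> < \<eta>"

lemma prob_expectation:
  assumes "finite (set_pmf p)" "\<And>v. (if P v then 1 else 0) = (1 + h v) / (2 :: real)"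
  shows "measure_pmf.prob p {v. P v} = (1 + measure_pmf.expectation p h) / 2"
proof -
  have "indicat_real {v. P v} = (\<lambda>v. (1 + h v) / 2)"
  proof
    fix v
    show "indicat_real {v. P v} v = (1 + h v) / 2"
      using assms(2)[of v] by (cases "P v") simp_all
  qed
  moreover have "measure_pmf.expectation p (indicat_real {v. P v}) = measure_pmf.prob p {v. P v}" by simp
  ultimately have "measure_pmf.prob p {v. P v} = measure_pmf.expectation p (\<lambda>v. (1 + h v) / 2)" by simp
  then show ?thesis
    by (simp add: integrable_measure_pmf_finite[OF assms(1)])
qed

lemma prob_score:
  assumes G: "pm n G" and i: "i < n"
  shows "measure_pmf.prob (row_law u n)
      {v. (G (px n (\<lambda>i. fst (v i))) = G (px n (\<lambda>i. snd (v i)))) = (fst (v i) = snd (v i))}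
    = (1 + score_ex n (2 * (1 / 2) ^ u) G i) / 2"
proof -
  let ?H = "\<lambda>x. real_of_int (G x * x i)"
  have "measure_pmf.prob (row_law u n)
      {v. (G (px n (\<lambda>i. fst (v i))) = G (px n (\<lambda>i. snd (v i)))) = (fst (v i) = snd (v i))}
    = (1 + measure_pmf.expectation (row_law u n) (\<lambda>v. ?H (px n (\<lambda>i. fst (v i))) * ?H (px n (\<lambda>i. snd (v i))))) / 2"
  proof (rule prob_expectation[OF finite_row_law])
    fix v :: "nat \<Rightarrow> bool \<times> bool"
    have *: "px n b i = (if b i then 1 else -1)" for b using i by (simp add: px_def)
    from pm_D[OF G px_cube[of n "\<lambda>i. fst (v i)"]] pm_D[OF G px_cube[of n "\<lambda>i. snd (v i)"]]
    show "(if (G (px n (\<lambda>i. fst (v i))) = G (px n (\<lambda>i. snd (v i)))) = (fst (v i) = snd (v i)) then 1 else 0)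
      = (1 + ?H (px n (\<lambda>i. fst (v i))) * ?H (px n (\<lambda>i. snd (v i)))) / 2"
      unfolding * by (elim disjE) (simp_all split: if_splits)
  qed
  then show ?thesis
    unfolding score_ex_def score_mean[OF i, symmetric] row_expectation[where F = ?H and G = ?H] .
qed

lemma noise_one: "noise r js (\<lambda>_. 1) = (\<lambda>_. 1)"
  by (induction js) (simp_all add: blur_indep)

lemma prob_ones:
  assumes G: "pm n G"
  shows "measure_pmf.prob (row_law u n) {v. G (px n (\<lambda>i. fst (v i))) = 1} = (1 + mean n G) / 2"
proof -
  have "measure_pmf.prob (row_law u n) {v. G (px n (\<lambda>i. fst (v i))) = 1}
    = (1 + measure_pmf.expectation (row_law u n) (\<lambda>v. real_of_int (G (px n (\<lambda>i. fst (v i)))))) / 2"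
  proof (rule prob_expectation[OF finite_row_law])
    fix v :: "nat \<Rightarrow> bool \<times> bool"
    from pm_D[OF G px_cube[of n "\<lambda>i. fst (v i)"]]
    show "(if G (px n (\<lambda>i. fst (v i))) = 1 then 1 else 0) = (1 + real_of_int (G (px n (\<lambda>i. fst (v i))))) / 2"
      by (elim disjE) simp_all
  qed
  then show ?thesis
    using row_expectation[where F = "\<lambda>x. real_of_int (G x)" and G = "\<lambda>_. 1" and u = u and n = n]
    by (simp add: noise_one)
qed

lemma prob_inaccurate:
  assumes G: "pm n G" and m: "0 < m" and \<eta>: "0 \<le> \<eta>"
  shows "measure_pmf.prob (Pi_pmf {..<m} e (\<lambda>_. row_law u n)) {V. \<not> accurate n u m \<eta> G V}
    \<le> real (n + 1) * (2 * exp (- 2 * real m * \<eta>\<^sup>2))"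
proof -
  let ?M = "Pi_pmf {..<m} e (\<lambda>_. row_law u n)"
  let ?\<delta> = "2 * exp (- 2 * real m * \<eta>\<^sup>2)"
  define B where "B i = {V. \<eta> \<le> \<bar>real (score n m V G i) / m - (1 + score_ex n (2 * (1 / 2) ^ u) G i) / 2\<bar>}" for i
  define B' where "B' = {V. \<eta> \<le> \<bar>real (ones n m V G) / m - (1 + mean n G) / 2\<bar>}"
  have B: "measure_pmf.prob ?M (B i) \<le> ?\<delta>" if "i < n" for i
    unfolding B_def score_def prob_score[OF G that, symmetric] by (rule sample_concentration[OF m \<eta>])
  have B': "measure_pmf.prob ?M B' \<le> ?\<delta>"
    unfolding B'_def ones_def prob_ones[OF G, of u, symmetric] by (rule sample_concentration[OF m \<eta>])
  have "{V. \<not> accurate n u m \<eta> G V} = (\<Union>i<n. B i) \<union> B'"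
    unfolding accurate_def B_def B'_def by (auto simp: not_less)
  then have "measure_pmf.prob ?M {V. \<not> accurate n u m \<eta> G V} \<le> measure_pmf.prob ?M (\<Union>i<n. B i) + measure_pmf.prob ?M B'"
    by (simp add: measure_Un_le)
  also have "measure_pmf.prob ?M (\<Union>i<n. B i) \<le> (\<Sum>i<n. measure_pmf.prob ?M (B i))"
    by (rule measure_UNION_le) auto
  also have "\<dots> \<le> (\<Sum>i<n. ?\<delta>)"
    by (rule sum_mono) (simp only: B lessThan_iff)
  finally show ?thesis using B' by (simp add: algebra_simps)
qed

section \<open>Union bound over all restrictions\<close>

lemma card_paths: "finite (paths n k)" "card (paths n k) = (2 * n) ^ k"
proof -
  have *: "paths n k = {\<pi>. set \<pi> \<subseteq> {..<n} \<times> {-1, 1} \<and> length \<pi> = k}" by (auto simp: paths_def)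
  show "finite (paths n k)" unfolding * by (rule finite_lists_length_eq) auto
  show "card (paths n k) = (2 * n) ^ k"
    unfolding * by (subst card_lists_length_eq) (auto simp: card_cartesian_product numeral_2_eq_2 mult.commute)
qed

lemma card_paths_le:
  "finite (\<Union>k\<le>D. paths n k)" "card (\<Union>k\<le>D. paths n k) \<le> (2 * n + 1) ^ D"
proof -
  show "finite (\<Union>k\<le>D. paths n k)" using card_paths(1) by simp
  have "card (\<Union>k\<le>D. paths n k) \<le> (\<Sum>k\<le>D. card (paths n k))"
    by (rule card_UN_le) simp
  also have "\<dots> \<le> (2 * n + 1) ^ D"
  proof (induction D)
    case (Suc D)
    have "(2 * n) ^ Suc D \<le> 2 * n * (2 * n + 1) ^ D" unfolding power_Suc
      by (intro mult_le_mono2 power_mono) auto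
    moreover have "(2 * n + 1) ^ Suc D = 2 * n * (2 * n + 1) ^ D + (2 * n + 1) ^ D"
      by (simp only: power_Suc distrib_right mult_1)
    ultimately show ?case using Suc unfolding sum.atMost_Suc card_paths(2) by linarith
  qed (simp add: card_paths)
  finally show "card (\<Union>k\<le>D. paths n k) \<le> (2 * n + 1) ^ D" .
qed

lemma prob_some_inaccurate:
  assumes f: "pm n f" and m: "0 < m" and \<eta>: "0 \<le> \<eta>"
  shows "measure_pmf.prob (Pi_pmf {..<m} e (\<lambda>_. row_law u n))
      {V. \<exists>\<pi>\<in>(\<Union>k\<le>D. paths n k). \<not> accurate n u m \<eta> (restrs \<pi> f) V}
    \<le> real ((2 * n + 1) ^ D) * (real (n + 1) * (2 * exp (- 2 * real m * \<eta>\<^sup>2)))"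
proof -
  let ?M = "Pi_pmf {..<m} e (\<lambda>_. row_law u n)" and ?S = "\<Union>k\<le>D. paths n k"
  let ?\<delta> = "real (n + 1) * (2 * exp (- 2 * real m * \<eta>\<^sup>2))"
  define B where "B \<pi> = {V. \<not> accurate n u m \<eta> (restrs \<pi> f) V}" for \<pi>
  have eq: "{V. \<exists>\<pi>\<in>?S. \<not> accurate n u m \<eta> (restrs \<pi> f) V} = (\<Union>\<pi>\<in>?S. B \<pi>)"
    unfolding B_def by auto
  have "measure_pmf.prob ?M (\<Union>\<pi>\<in>?S. B \<pi>) \<le> (\<Sum>\<pi>\<in>?S. measure_pmf.prob ?M (B \<pi>))"
    by (rule measure_UNION_le[OF card_paths_le(1)]) auto
  also have "\<dots> \<le> (\<Sum>\<pi>\<in>?S. ?\<delta>)"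
  proof (rule sum_mono)
    fix \<pi> assume "\<pi> \<in> ?S"
    then obtain k where "\<pi> \<in> paths n k" by blast
    then show "measure_pmf.prob ?M (B \<pi>) \<le> ?\<delta>"
      unfolding B_def by (intro prob_inaccurate[OF _ m \<eta>] pm_restrs[OF f])
  qed
  also have "\<dots> = real (card ?S) * ?\<delta>" by (rule sum_constant)
  also have "\<dots> \<le> real ((2 * n + 1) ^ D) * ?\<delta>"
  proof (rule mult_right_mono)
    show "real (card ?S) \<le> real ((2 * n + 1) ^ D)"
      using card_paths_le(2)[of n D] by (simp only: of_nat_le_iff)
  qed simp
  finally show ?thesis unfolding eq .
qed

definition samples :: "nat \<Rightarrow> nat \<Rightarrow> (nat \<Rightarrow> bool) \<Rightarrow> nat \<Rightarrow> nat \<Rightarrow> bool \<times> bool" where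
  "samples u n \<omega> j = (\<lambda>i. cell u \<omega> (j * n + i))"

lemma px_cong: "(\<And>i. i < n \<Longrightarrow> b i = b' i) \<Longrightarrow> px n b = px n b'"
  unfolding px_def by (rule restrict_ext) simp

lemma score_cong:
  assumes "\<And>j i. j < m \<Longrightarrow> i < n \<Longrightarrow> V j i = V' j i" "i < n"
  shows "score n m V G i = score n m V' G i"
proof -
  have *: "px n (\<lambda>i. fst (V j i)) = px n (\<lambda>i. fst (V' j i))" "px n (\<lambda>i. snd (V j i)) = px n (\<lambda>i. snd (V' j i))"
    "V j i = V' j i" if "j < m" for j
    using assms that by (auto intro!: px_cong)
  show ?thesis unfolding score_def by (rule arg_cong[where f = card]) (use * in auto)
qed

lemma ones_cong:
  assumes "\<And>j i. j < m \<Longrightarrow> i < n \<Longrightarrow> V j i = V' j i"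
  shows "ones n m V G = ones n m V' G"
proof -
  have *: "px n (\<lambda>i. fst (V j i)) = px n (\<lambda>i. fst (V' j i))" if "j < m" for j
    using assms that by (auto intro!: px_cong)
  show ?thesis unfolding ones_def by (rule arg_cong[where f = card]) (use * in auto)
qed

lemma accurate_cong:
  assumes "\<And>j i. j < m \<Longrightarrow> i < n \<Longrightarrow> V j i = V' j i"
  shows "accurate n u m \<eta> G V = accurate n u m \<eta> G V'"
  unfolding accurate_def using score_cong[OF assms] ones_cong[OF assms] by simp

text \<open>The event must be decided by the coins actually drawn for \<open>prob_coins\<close> to
  apply. Accuracy looks only at the first \<open>m\<close> rows and \<open>n\<close> columns, so it
  is the same for the raw \<open>samples\<close> and for the padded rows \<open>R\<close>, whose law
  is a product.\<close>

lemma prob_accurate: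
  assumes f: "pm n f" and m: "0 < m" and \<eta>: "0 \<le> \<eta>"
    and Q: "\<And>\<omega> \<omega>'. (\<And>k. k < m * n * (u + 1) \<Longrightarrow> \<omega> k = \<omega>' k) \<Longrightarrow> Q \<omega> \<Longrightarrow> Q \<omega>'"
    and acc: "\<And>\<omega>. (\<And>\<pi> k. k \<le> D \<Longrightarrow> \<pi> \<in> paths n k \<Longrightarrow> accurate n u m \<eta> (restrs \<pi> f) (samples u n \<omega>)) \<Longrightarrow> Q \<omega>"
  shows "\<P>(\<omega> in coins. Q \<omega>) \<ge> 1 - real ((2 * n + 1) ^ D) * (real (n + 1) * (2 * exp (- 2 * real m * \<eta>\<^sup>2)))"
proof -
  let ?F = "fair_coins (m * n * (u + 1))"
  define e where "e = (\<lambda>_ :: nat. (False, False))"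
  define R where "R \<omega> j = (if j \<in> {..<m} then row u n \<omega> j else e)" for \<omega> j
  let ?bad = "{V. \<exists>\<pi>\<in>(\<Union>k\<le>D. paths n k). \<not> accurate n u m \<eta> (restrs \<pi> f) V}"
  have "- {\<omega>. Q \<omega>} \<subseteq> {\<omega>. R \<omega> \<in> ?bad}"
  proof (rule subsetI, rule ccontr)
    fix \<omega> assume *: "\<omega> \<in> - {\<omega>. Q \<omega>}" "\<omega> \<notin> {\<omega>. R \<omega> \<in> ?bad}"
    have "Q \<omega>"
    proof (rule acc)
      fix \<pi> k assume "k \<le> D" "\<pi> \<in> paths n k"
      with *(2) have "accurate n u m \<eta> (restrs \<pi> f) (R \<omega>)" by auto
      then show "accurate n u m \<eta> (restrs \<pi> f) (samples u n \<omega>)"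
        by (subst accurate_cong[of m n _ "R \<omega>"]) (simp_all add: samples_def R_def row_def)
    qed
    with *(1) show False by simp
  qed
  then have "measure_pmf.prob ?F (- {\<omega>. Q \<omega>}) \<le> measure_pmf.prob ?F {\<omega>. R \<omega> \<in> ?bad}"
    by (intro measure_pmf.finite_measure_mono) auto
  also have "\<dots> = measure_pmf.prob (map_pmf R ?F) ?bad"
    by (simp add: vimage_def)
  also have "map_pmf R ?F = Pi_pmf {..<m} e (\<lambda>_. row_law u n)"
    unfolding R_def by (rule rows_law)
  also note prob_some_inaccurate[OF f m \<eta>]
  finally have "measure_pmf.prob ?F (- {\<omega>. Q \<omega>}) \<le> real ((2 * n + 1) ^ D) * (real (n + 1) * (2 * exp (- 2 * real m * \<eta>\<^sup>2)))" .
  moreover have "measure_pmf.prob ?F (- {\<omega>. Q \<omega>}) = 1 - measure_pmf.prob ?F {\<omega>. Q \<omega>}"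
    by (subst measure_pmf.prob_compl[symmetric]) (auto simp: Compl_eq_Diff_UNIV)
  moreover have "\<P>(\<omega> in coins. Q \<omega>) = measure_pmf.prob ?F {\<omega>. Q \<omega>}"
  proof (rule prob_coins)
    fix \<omega> \<omega>'
    assume 1: "\<And>k. k < m * n * (u + 1) \<Longrightarrow> \<omega> k = \<omega>' k" and 2: "Q \<omega>"
    show "Q \<omega>'" by (rule Q[OF 1 2])
  qed
  ultimately show ?thesis by linarith
qed

text \<open>Follows the loop of \<open>find_best\<close> round by round, with the same start (0, 0)
  and the same strict comparison.\<close>

primrec first_max :: "(nat \<Rightarrow> nat) \<Rightarrow> nat \<Rightarrow> nat \<times> nat" where
  "first_max S 0 = (0, 0)"
| "first_max S (Suc i) = (if snd (first_max S i) < S i then (i, S i) else first_max S i)"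

lemma first_max_max:
  "j < i \<Longrightarrow> S j \<le> snd (first_max S i)"
  "0 < i \<Longrightarrow> fst (first_max S i) < i \<and> snd (first_max S i) = S (fst (first_max S i))"
proof -
  have "(\<forall>j<i. S j \<le> snd (first_max S i)) \<and> (0 < i \<longrightarrow> fst (first_max S i) < i \<and> snd (first_max S i) = S (fst (first_max S i)))"
  proof (induction i)
    case (Suc i)
    show ?case
    proof (cases "snd (first_max S i) < S i")
      case True
      with Suc show ?thesis by (auto simp: less_Suc_eq intro: order_trans less_imp_le)
    next
      case False
      \<comment> \<open>In round 0 the comparison with the initial 0 fails only if
        \<open>S 0\<close> is 0, and then the initial pair (0, 0) is a genuine maximum.\<close>
      with Suc show ?thesis by (cases i) (auto simp: less_Suc_eq)
    qed
  qed simp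
  then show "j < i \<Longrightarrow> S j \<le> snd (first_max S i)"
    "0 < i \<Longrightarrow> fst (first_max S i) < i \<and> snd (first_max S i) = S (fst (first_max S i))" by auto
qed

lemma first_max_cong: "(\<And>j. j < i \<Longrightarrow> S j = S' j) \<Longrightarrow> first_max S i = first_max S' i"
  by (induction i) auto

definition choice :: "nat \<Rightarrow> nat \<Rightarrow> (nat \<Rightarrow> nat \<Rightarrow> bool \<times> bool) \<Rightarrow> (point \<Rightarrow> int) \<Rightarrow> nat" where
  "choice n m V G = fst (first_max (score n m V G) n)"

definition vote :: "nat \<Rightarrow> nat \<Rightarrow> (nat \<Rightarrow> nat \<Rightarrow> bool \<times> bool) \<Rightarrow> (point \<Rightarrow> int) \<Rightarrow> int" where
  "vote n m V G = (if 2 * ones n m V G < m then -1 else 1)"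

lemma choice_less: "0 < n \<Longrightarrow> choice n m V G < n"
  using first_max_max(2) by (simp add: choice_def)

text \<open>Two frequencies, each off by at most \<eta>, allow an error of 2 \<eta>, and the map (1
  + v) / 2 doubles it. The stability term is common to all coordinates and cancels, and 2 - r \<ge>
  1 carries the bound over from scores to gains.\<close>

lemma choice_gain:
  assumes acc: "accurate n u m \<eta> G V" and i: "i < n" and m: "0 < m" and r: "2 * (1 / 2) ^ u \<le> (1 :: real)"
    and \<eta>: "0 \<le> \<eta>"
  shows "gain n (2 * (1 / 2) ^ u) i G \<le> gain n (2 * (1 / 2) ^ u) (choice n m V G) G + 4 * \<eta>"
proof -
  let ?r = "2 * (1 / 2 :: real) ^ u" and ?c = "choice n m V G"
  have c: "?c < n" using i by (intro choice_less) simp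
  have "score n m V G i \<le> score n m V G ?c"
    using first_max_max(1)[OF i, of "score n m V G"] first_max_max(2)[of n "score n m V G"] i by (simp add: choice_def)
  then have le: "real (score n m V G i) / m \<le> real (score n m V G ?c) / m"
    by (intro divide_right_mono) auto
  have "\<bar>real (score n m V G i) / m - (1 + score_ex n ?r G i) / 2\<bar> < \<eta>"
    "\<bar>real (score n m V G ?c) / m - (1 + score_ex n ?r G ?c) / 2\<bar> < \<eta>"
    using acc i c unfolding accurate_def by blast+
  then have "score_ex n ?r G i - score_ex n ?r G ?c \<le> 4 * \<eta>"
    using le by argo
  then have d: "(2 - ?r) * (gain n ?r i G - gain n ?r ?c G) \<le> 4 * \<eta>"
    unfolding score_ex_def by (simp add: algebra_simps)
  have "gain n ?r i G - gain n ?r ?c G \<le> 4 * \<eta>"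
  proof (cases "0 \<le> gain n ?r i G - gain n ?r ?c G")
    case True
    then have "1 * (gain n ?r i G - gain n ?r ?c G) \<le> (2 - ?r) * (gain n ?r i G - gain n ?r ?c G)"
      using r by (intro mult_right_mono) auto
    from order_trans[OF this d] show ?thesis unfolding mult_1 .
  qed (use \<eta> in linarith)
  then show ?thesis by linarith
qed

text \<open>For the right label the left side is 1 - |mean|. A wrong label requires |mean| < 2
  \<eta> \<le> 1/4, and then the left side is below 5/4 while the right side exceeds 3. The factor 4
  of the final error bound originates here.\<close>

lemma vote_error:
  assumes acc: "accurate n u m \<eta> G V" and G: "pm n G" and m: "0 < m" and \<eta>: "\<eta> \<le> 1 / 8"
  shows "1 - vote n m V G * mean n G \<le> 4 * (1 - \<bar>mean n G\<bar>)"
proof -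
  have "\<bar>mean n G\<bar> \<le> 1"
    using mean_mult_le_1[of n "\<lambda>_. 1" G] pm_abs[OF G] by simp
  moreover have a: "\<bar>real (ones n m V G) / m - (1 + mean n G) / 2\<bar> < \<eta>"
    using acc unfolding accurate_def by blast
  moreover have "2 * ones n m V G < m \<longleftrightarrow> real (ones n m V G) / m < 1 / 2"
  proof -
    have "2 * ones n m V G < m \<longleftrightarrow> 2 * real (ones n m V G) < real m" by linarith
    then show ?thesis using m by (simp add: field_simps)
  qed
  ultimately show ?thesis
    using \<eta> unfolding vote_def by (cases "2 * ones n m V G < m") (simp_all only: if_True if_False of_int_minus of_int_1, argo+)
qed

section \<open>The program\<close>

text \<open>Total correctness: a terminating execution must exist. Since the counters are part of
  the final state, \<open>Q\<close> can bound time and queries as well.\<close>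

definition wp :: "nat \<Rightarrow> nat \<Rightarrow> (point \<Rightarrow> int) \<Rightarrow> (nat \<Rightarrow> bool) \<Rightarrow> com \<Rightarrow> (config \<Rightarrow> bool) \<Rightarrow> config \<Rightarrow> bool" where
  "wp n w f \<omega> c Q st \<longleftrightarrow> (\<exists>st'. exec n w f \<omega> c st st' \<and> Q st')"

lemma wp_Skip: "Q (st\<lparr>time := time st + 1\<rparr>) \<Longrightarrow> wp n w f \<omega> Skip Q st"
  unfolding wp_def by (blast intro: exec.Skip)

lemma wp_Assign:
  "Q (st\<lparr>regs := (regs st)(r := exp_val w st e), time := time st + exp_cost e + 1\<rparr>) \<Longrightarrow> wp n w f \<omega> (Assign r e) Q st"
  unfolding wp_def by (blast intro: exec.Assign)

lemma wp_Store:
  "Q (st\<lparr>mem := (mem st)(exp_val w st d := exp_val w st e), time := time st + exp_cost d + exp_cost e + 1\<rparr>) \<Longrightarrow>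
    wp n w f \<omega> (Store d e) Q st"
  unfolding wp_def by (blast intro: exec.Store)

lemma wp_Flip:
  "Q (st\<lparr>regs := (regs st)(r := of_bool (\<omega> (flips st))), flips := flips st + 1, time := time st + 1\<rparr>) \<Longrightarrow>
    wp n w f \<omega> (Flip r) Q st"
  unfolding wp_def of_bool_def by (blast intro: exec.Flip)

lemma wp_Query:
  "Q (st\<lparr>regs := (regs st)(r := encode_bit (f (point_at n (mem st) (exp_val w st e)))),
     queries := queries st + 1, time := time st + exp_cost e + n + 1\<rparr>) \<Longrightarrow> wp n w f \<omega> (Query r e) Q st"
  unfolding wp_def by (blast intro: exec.Query)

lemma wp_Seq: "wp n w f \<omega> c (wp n w f \<omega> d Q) st \<Longrightarrow> wp n w f \<omega> (Seq c d) Q st"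
  unfolding wp_def by (blast intro: exec.Seq)

lemma wp_Seq_eq: "wp n w f \<omega> (Seq c d) Q = wp n w f \<omega> c (wp n w f \<omega> d Q)"
  unfolding wp_def by (blast intro: exec.Seq elim: exec_cases(6))

lemma wp_Cond:
  "(exp_val w st e \<noteq> 0 \<Longrightarrow> wp n w f \<omega> c Q (st\<lparr>time := time st + exp_cost e + 1\<rparr>)) \<Longrightarrow>
   (exp_val w st e = 0 \<Longrightarrow> wp n w f \<omega> d Q (st\<lparr>time := time st + exp_cost e + 1\<rparr>)) \<Longrightarrow>
   wp n w f \<omega> (Cond e c d) Q st"
  unfolding wp_def by (cases "exp_val w st e = 0") (blast intro: exec.CondTrue exec.CondFalse)+

text \<open>The invariant is indexed by the number of completed rounds, and the number of rounds is
  known in advance. Induction on the remaining rounds then also gives termination.\<close>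

lemma wp_While:
  assumes I: "I 0 st"
    and step: "\<And>k st. k < N \<Longrightarrow> I k st \<Longrightarrow> exp_val w st e \<noteq> 0 \<and>
      wp n w f \<omega> c (I (Suc k)) (st\<lparr>time := time st + exp_cost e + 1\<rparr>)"
    and stop: "\<And>st. I N st \<Longrightarrow> exp_val w st e = 0 \<and> Q (st\<lparr>time := time st + exp_cost e + 1\<rparr>)"
  shows "wp n w f \<omega> (While e c) Q st"
proof -
  have "I (N - d) st \<Longrightarrow> d \<le> N \<Longrightarrow> wp n w f \<omega> (While e c) Q st" for d st
  proof (induction d arbitrary: st)
    case 0
    then show ?case using stop[of st] unfolding wp_def by (auto intro: exec.WhileFalse)
  next
    case (Suc d)
    then have lt: "N - Suc d < N" and eq: "Suc (N - Suc d) = N - d" by auto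
    from step[OF lt Suc.prems(1)] obtain st' where
      *: "exp_val w st e \<noteq> 0" "exec n w f \<omega> c (st\<lparr>time := time st + exp_cost e + 1\<rparr>) st'" "I (N - d) st'"
      unfolding wp_def eq by blast
    from Suc.IH[OF *(3)] Suc.prems(2) obtain st'' where "exec n w f \<omega> (While e c) st' st''" "Q st''"
      unfolding wp_def by auto
    with exec.WhileTrue[OF *(1,2)] show ?case unfolding wp_def by blast
  qed
  from this[of N st] I show ?thesis by simp
qed

text \<open>As long as nothing overflows, word arithmetic is arithmetic on naturals. The proofs
  below rewrite with these rules and remove the defining equations, which would introduce
  \<open>mod\<close>.\<close>

lemma val_Plus: "exp_val w st a + exp_val w st b < 2 ^ w \<Longrightarrow>
    exp_val w st (Op Plus a b) = exp_val w st a + exp_val w st b"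
  by simp

lemma val_Minus: "exp_val w st a < 2 ^ w \<Longrightarrow>
    exp_val w st (Op Minus a b) = exp_val w st a - exp_val w st b"
  by simp

lemma val_Times: "exp_val w st a * exp_val w st b < 2 ^ w \<Longrightarrow>
    exp_val w st (Op Times a b) = exp_val w st a * exp_val w st b"
  by simp

lemma val_Less: "0 < w \<Longrightarrow> exp_val w st (Op Less a b) = of_bool (exp_val w st a < exp_val w st b)"
  by simp

lemma val_Equal: "0 < w \<Longrightarrow> exp_val w st (Op Equal a b) = of_bool (exp_val w st a = exp_val w st b)"
  by simp

lemma val_Const: "k < 2 ^ w \<Longrightarrow> exp_val w st (Const k) = k"
  by simp

lemmas val = exp_val.simps(2,3) val_Plus val_Minus val_Times val_Less val_Equal val_Const

lemma card_less_Suc: "card {j. j < Suc k \<and> P j} = card {j. j < k \<and> P j} + of_bool (P k)"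
proof (cases "P k")
  case True
  then have "{j. j < Suc k \<and> P j} = insert k {j. j < k \<and> P j}" by (auto simp: less_Suc_eq)
  with True show ?thesis by simp
next
  case False
  then have "{j. j < Suc k \<and> P j} = {j. j < k \<and> P j}" by (auto simp: less_Suc_eq)
  with False show ?thesis by simp
qed

text \<open>
  Memory layout: the request \<open>z\<close> at \<open>0\<close>, flags of the coordinates queried so far at \<open>n\<close>, a buffer for queries
  at \<open>2 n\<close>, the points \<open>x\<close> and \<open>y\<close> of the \<open>m\<close> pairs at \<open>3 n\<close> and \<open>3 n + m n\<close>, and at \<open>3 n + 2 m n\<close>
  whether \<open>f\<close> agrees on the two points of a pair.  Registers 7 to 11 hold \<open>u\<close>, \<open>D\<close>, \<open>m\<close>, \<open>m n\<close> and the number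
  of remaining levels (\<open>2\<^sup>-\<^sup>u\<close> is the probability of a flip), 20 to 23 hold the addresses, 12 to 19 are scratch.
\<close>

definition fill :: "nat \<Rightarrow> com" where
  "fill p = Seq (Assign 13 (Const 0)) (While (Op Less (Reg 13) (Reg 0))
     (Seq (Cond (Load (Op Plus (Reg 0) (Reg 13)))
        (Store (Op Plus (Reg 23) (Reg 13)) (Load (Reg 13)))
        (Store (Op Plus (Reg 23) (Reg 13)) (Load (Op Plus (Reg p) (Reg 13)))))
      (Assign 13 (Op Plus (Reg 13) (Const 1)))))"

definition eval_samples :: com where
  "eval_samples = Seq (Assign 12 (Const 0)) (Seq (Assign 16 (Reg 20)) (Seq (Assign 17 (Reg 21))
     (While (Op Less (Reg 12) (Reg 9))
       (Seq (fill 16) (Seq (Query 14 (Reg 23)) (Seq (fill 17) (Seq (Query 15 (Reg 23))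
         (Seq (Store (Op Plus (Reg 22) (Reg 12)) (Op Equal (Reg 14) (Reg 15)))
         (Seq (Assign 16 (Op Plus (Reg 16) (Reg 0))) (Seq (Assign 17 (Op Plus (Reg 17) (Reg 0)))
           (Assign 12 (Op Plus (Reg 12) (Const 1)))))))))))))"

text \<open>No queries are made: the agreement bits left by \<open>eval_samples\<close> serve all
  \<open>n\<close> coordinates, which keeps the query count free of a factor \<open>n\<close>.
  Registers 16 and 17 walk down one column of the two sample tables.\<close>

definition count_score :: com where
  "count_score = Seq (Assign 13 (Const 0)) (Seq (Assign 14 (Const 0))
     (Seq (Assign 16 (Op Plus (Reg 20) (Reg 12))) (Seq (Assign 17 (Op Plus (Reg 21) (Reg 12)))
     (While (Op Less (Reg 13) (Reg 9))
       (Seq (Assign 14 (Op Plus (Reg 14) (Op Equal (Load (Op Plus (Reg 22) (Reg 13)))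
           (Op Equal (Load (Reg 16)) (Load (Reg 17))))))
       (Seq (Assign 16 (Op Plus (Reg 16) (Reg 0))) (Seq (Assign 17 (Op Plus (Reg 17) (Reg 0)))
         (Assign 13 (Op Plus (Reg 13) (Const 1))))))))))"

definition find_best :: com where
  "find_best = Seq (Assign 12 (Const 0)) (Seq (Assign 18 (Const 0)) (Seq (Assign 19 (Const 0))
     (While (Op Less (Reg 12) (Reg 0))
       (Seq count_score
       (Seq (Cond (Op Less (Reg 19) (Reg 14)) (Seq (Assign 19 (Reg 14)) (Assign 18 (Reg 12))) Skip)
         (Assign 12 (Op Plus (Reg 12) (Const 1))))))))"

definition descend :: com where
  "descend = While (Reg 11) (Seq eval_samples (Seq find_best
     (Seq (Store (Op Plus (Reg 0) (Reg 18)) (Const 1)) (Assign 11 (Op Minus (Reg 11) (Const 1))))))"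

text \<open>Only the points x of the pairs are queried. The last assignment gives 0 exactly when
  twice the count is below \<open>m\<close>, which is the tie rule of \<open>vote\<close>.\<close>

definition take_vote :: com where
  "take_vote = Seq (Assign 12 (Const 0)) (Seq (Assign 14 (Const 0)) (Seq (Assign 16 (Reg 20))
     (Seq (While (Op Less (Reg 12) (Reg 9))
       (Seq (fill 16) (Seq (Query 15 (Reg 23)) (Seq (Assign 14 (Op Plus (Reg 14) (Reg 15)))
       (Seq (Assign 16 (Op Plus (Reg 16) (Reg 0))) (Assign 12 (Op Plus (Reg 12) (Const 1))))))))
     (Assign 0 (Op Minus (Const 1) (Op Less (Op Plus (Reg 14) (Reg 14)) (Reg 9)))))))"

text \<open>\<open>fits\<close> dominates every address and counter of the program, including the
  doubled count in \<open>take_vote\<close>, so that no operation wraps around.\<close>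

locale run =
  fixes n w :: nat and f :: "point \<Rightarrow> int" and \<omega> :: "nat \<Rightarrow> bool" and z :: point and m u D :: nat
  assumes n: "0 < n" and f: "pm n f" and z: "z \<in> cube n"
    and fits: "4 * n + 2 * (m * n) + 2 * m + u + D + 4 < 2 ^ w"
begin

abbreviation WP :: "com \<Rightarrow> (config \<Rightarrow> bool) \<Rightarrow> config \<Rightarrow> bool" where
  "WP \<equiv> wp n w f \<omega>"

lemma w: "0 < w"
  using fits by (cases w) auto

abbreviation V :: "nat \<Rightarrow> nat \<Rightarrow> bool \<times> bool" where
  "V \<equiv> samples u n \<omega>"

text \<open>The branch taken by \<open>z\<close> is recorded as a set of coordinates: the values
  come from \<open>z\<close>, and neither order nor repetition of queries affects the
  restriction.\<close>

definition fixed :: "nat set \<Rightarrow> point \<Rightarrow> int" where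
  "fixed Q = (\<lambda>x. f (\<lambda>i. if i \<in> Q then z i else x i))"

text \<open>The invariant between stages of the descent. Registers 12 to 19, the query buffer and
  the agreement bits are left open, as they are overwritten at every level.\<close>

definition ready :: "nat set \<Rightarrow> nat \<Rightarrow> config \<Rightarrow> bool" where
  "ready Q d st \<longleftrightarrow> regs st 0 = n \<and> regs st 9 = m \<and> regs st 11 = d \<and>
     regs st 20 = 3 * n \<and> regs st 21 = 3 * n + m * n \<and> regs st 22 = 3 * n + 2 * (m * n) \<and> regs st 23 = 2 * n \<and>
     Q \<subseteq> {..<n} \<and>
     (\<forall>i<n. mem st i = encode_bit (z i)) \<and> (\<forall>i<n. mem st (n + i) = of_bool (i \<in> Q)) \<and>
     (\<forall>j<m. \<forall>i<n. mem st (3 * n + (j * n + i)) = of_bool (fst (V j i))) \<and>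
     (\<forall>j<m. \<forall>i<n. mem st (3 * n + m * n + (j * n + i)) = of_bool (snd (V j i)))"

lemma cell_le: "j < m \<Longrightarrow> i < n \<Longrightarrow> j * n + i < m * n"
proof -
  assume "j < m" "i < n"
  then have "j * n + i < (j + 1) * n" "(j + 1) * n \<le> m * n" by (simp, intro mult_le_mono1) simp
  then show ?thesis by linarith
qed

lemma ready_cong:
  assumes "ready Q d st" "\<And>r. r < 12 \<or> 20 \<le> r \<Longrightarrow> regs st' r = regs st r"
    "\<And>a. a < 2 * n \<or> 3 * n \<le> a \<and> a < 3 * n + 2 * (m * n) \<Longrightarrow> mem st' a = mem st a"
  shows "ready Q d st'"
proof -
  have 1: "mem st' (3 * n + (j * n + i)) = mem st (3 * n + (j * n + i))"
    "mem st' (3 * n + m * n + (j * n + i)) = mem st (3 * n + m * n + (j * n + i))" if "j < m" "i < n" for j i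
    using cell_le[OF that] by (intro assms(3); linarith)+
  have 2: "mem st' i = mem st i" "mem st' (n + i) = mem st (n + i)" if "i < n" for i
    using that by (intro assms(3); linarith)+
  show ?thesis
    using assms(1) unfolding ready_def by (simp add: 1 2 assms(2))
qed

definition keeps :: "config \<Rightarrow> config \<Rightarrow> bool" where
  "keeps st st' \<longleftrightarrow> (\<forall>a. a < 2 * n \<or> 3 * n \<le> a \<longrightarrow> mem st' a = mem st a)"

text \<open>Continuation form, as in the rules for the larger program parts below: the postcondition
  \<open>R\<close> is arbitrary and must follow from what the code guarantees. Such rules chain
  directly under nested \<open>wp\<close>.\<close>

lemma wp_fill:
  assumes rdy: "ready Q d st" and p: "p = 16 \<or> p = 17" "regs st p = a" "3 * n \<le> a" "a + n \<le> 3 * n + 2 * (m * n)"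
    and b: "\<And>i. i < n \<Longrightarrow> mem st (a + i) = of_bool (b i)"
    and Q: "\<And>st'. ready Q d st' \<Longrightarrow> keeps st st' \<Longrightarrow> (\<And>r. r \<noteq> 13 \<Longrightarrow> regs st' r = regs st r) \<Longrightarrow>
      f (point_at n (mem st') (2 * n)) = fixed Q (px n b) \<Longrightarrow> queries st' = queries st \<Longrightarrow>
      time st' \<le> time st + 30 * n + 10 \<Longrightarrow> R st'"
  shows "WP (fill p) R st"
proof -
  define I where "I k st' \<longleftrightarrow> k \<le> n \<and> regs st' 13 = k \<and> (\<forall>r. r \<noteq> 13 \<longrightarrow> regs st' r = regs st r) \<and> keeps st st' \<and>
    (\<forall>i<k. mem st' (2 * n + i) = (if i \<in> Q then encode_bit (z i) else of_bool (b i))) \<and>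
    queries st' = queries st \<and> time st' \<le> time st + 2 + 30 * k" for k st'
  have rdy': "ready Q d st'" if "I k st'" for k st'
    using rdy by (rule ready_cong) (use that in \<open>auto simp: I_def keeps_def\<close>)
  have reg0: "regs st 0 = n" "regs st 23 = 2 * n" and Qn: "Q \<subseteq> {..<n}"
    using rdy by (auto simp: ready_def)
  have memQ: "mem st i = encode_bit (z i)" "mem st (n + i) = of_bool (i \<in> Q)" if "i < n" for i
    using rdy that by (auto simp: ready_def)
  show ?thesis
    unfolding fill_def
  proof (intro wp_Seq wp_Assign, rule wp_While[where I = I and N = n])
    show "I 0 (st\<lparr>regs := (regs st)(13 := exp_val w st (Const 0)), time := time st + exp_cost (Const 0) + 1\<rparr>)"
      by (simp add: I_def keeps_def)
  next
    fix k st' assume k: "k < n" and I: "I k st'"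
    have r: "regs st' 13 = k" "regs st' 0 = n" "regs st' 23 = 2 * n" "regs st' p = a"
      using I p(1,2) reg0 by (auto simp: I_def)
    have mm: "mem st' k = encode_bit (z k)" "mem st' (n + k) = of_bool (k \<in> Q)" "mem st' (a + k) = of_bool (b k)"
      using I k p(3) memQ[OF k] b[OF k] by (auto simp: I_def keeps_def)
    have lt: "k < 2 ^ w" "n + k < 2 ^ w" "2 * n + k < 2 ^ w" "a + k < 2 ^ w" "k + 1 < 2 ^ w" "(1 :: nat) < 2 ^ w"
      using fits k p(4) by linarith+
    have tm: "time st' \<le> time st + 2 + 30 * k" using I by (simp add: I_def)
    have step: "I (Suc k) st''" if "regs st'' = (regs st')(13 := k + 1)"
      "mem st'' = (mem st')(2 * n + k := (if k \<in> Q then encode_bit (z k) else of_bool (b k)))"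
      "queries st'' = queries st'" "time st'' \<le> time st' + 30" for st''
      using that I k by (auto simp: I_def keeps_def less_Suc_eq)
    show "exp_val w st' (Op Less (Reg 13) (Reg 0)) \<noteq> 0 \<and> WP
        (Seq (Cond (Load (Op Plus (Reg 0) (Reg 13)))
          (Store (Op Plus (Reg 23) (Reg 13)) (Load (Reg 13)))
          (Store (Op Plus (Reg 23) (Reg 13)) (Load (Op Plus (Reg p) (Reg 13)))))
        (Assign 13 (Op Plus (Reg 13) (Const 1)))) (I (Suc k))
        (st'\<lparr>time := time st' + exp_cost (Op Less (Reg 13) (Reg 0)) + 1\<rparr>)"
    proof (intro conjI wp_Seq wp_Cond wp_Store wp_Assign)
      show "exp_val w st' (Op Less (Reg 13) (Reg 0)) \<noteq> 0"
        using k r w by (simp add: val del: exp_val.simps(1,4))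
    qed (rule step; use mm lt in \<open>simp add: val r del: exp_val.simps(1,4)\<close>)+
  next
    fix st' assume I: "I n st'"
    let ?st = "st'\<lparr>time := time st' + exp_cost (Op Less (Reg 13) (Reg 0)) + 1\<rparr>"
    have "point_at n (mem st') (2 * n) = (\<lambda>i. if i \<in> Q then z i else px n b i)"
    proof
      fix i
      show "point_at n (mem st') (2 * n) i = (if i \<in> Q then z i else px n b i)"
      proof (cases "i < n")
        case True
        then show ?thesis using I cube_val[OF z True]
          by (auto simp: I_def point_at_def px_def decode_bit_def encode_bit_def)
      next
        case False
        then show ?thesis using Qn by (auto simp: point_at_def px_def)
      qed
    qed
    then have "f (point_at n (mem st') (2 * n)) = fixed Q (px n b)"
      by (simp add: fixed_def)
    moreover have "ready Q d ?st" using rdy'[OF I] by (rule ready_cong) auto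
    ultimately have "R ?st"
      using I by (intro Q) (auto simp: I_def keeps_def)
    then show "exp_val w st' (Op Less (Reg 13) (Reg 0)) = 0 \<and> R ?st"
      using I w reg0 by (simp add: I_def)
  qed
qed


lemma pm_fixed: "Q \<subseteq> {..<n} \<Longrightarrow> pm n (fixed Q)"
proof -
  assume Q: "Q \<subseteq> {..<n}"
  have "(\<lambda>i. if i \<in> Q then z i else x i) \<in> cube n" if "x \<in> cube n" for x
    using z that Q unfolding cube_def PiE_iff extensional_def by auto
  then show ?thesis using f by (simp add: pm_def fixed_def)
qed

lemma encode_bit_inj: "a = -1 \<or> a = 1 \<Longrightarrow> b = -1 \<or> b = 1 \<Longrightarrow> encode_bit a = encode_bit b \<longleftrightarrow> a = b"
  by (auto simp: encode_bit_def)

lemma row_bounds: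
  assumes "k < m"
  shows "k * n + n \<le> m * n" "(k + 1) * n = k * n + n"
proof -
  have "(k + 1) * n \<le> m * n" using assms by (intro mult_le_mono1) simp
  then show "k * n + n \<le> m * n" by simp
qed simp

definition agree :: "nat set \<Rightarrow> nat \<Rightarrow> bool" where
  "agree Q j \<longleftrightarrow> fixed Q (px n (\<lambda>i. fst (V j i))) = fixed Q (px n (\<lambda>i. snd (V j i)))"

lemma wp_eval_samples:
  assumes rdy: "ready Q d st"
    and R: "\<And>st'. ready Q d st' \<Longrightarrow> (\<And>j. j < m \<Longrightarrow> mem st' (3 * n + 2 * (m * n) + j) = of_bool (agree Q j)) \<Longrightarrow>
      queries st' = queries st + 2 * m \<Longrightarrow> time st' \<le> time st + 10 + m * (62 * n + 100) \<Longrightarrow> R st'"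
  shows "WP eval_samples R st"
proof -
  define I where "I k st' \<longleftrightarrow> k \<le> m \<and> ready Q d st' \<and> regs st' 12 = k \<and> regs st' 16 = 3 * n + k * n \<and>
    regs st' 17 = 3 * n + m * n + k * n \<and>
    (\<forall>j<k. mem st' (3 * n + 2 * (m * n) + j) = of_bool (agree Q j)) \<and>
    queries st' = queries st + 2 * k \<and> time st' \<le> time st + 6 + k * (62 * n + 100)" for k st'
  have Qn: "Q \<subseteq> {..<n}" using rdy by (simp add: ready_def)
  have regs: "regs st 20 = 3 * n" "regs st 21 = 3 * n + m * n" using rdy by (auto simp: ready_def)
  have z0: "exp_val w \<tau> (Const 0) = 0" for \<tau> by simp
  show ?thesis
    unfolding eval_samples_def
  proof (intro wp_Seq wp_Assign, rule wp_While[where I = I and N = m], goal_cases)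
    case 1
    have "ready Q d (st\<lparr>regs := ((regs st)(12 := 0, 16 := 3 * n, 17 := 3 * n + m * n)), time := t\<rparr>)" for t
      using rdy by (rule ready_cong) auto
    then show ?case by (simp add: I_def regs)
  next
    case (2 k st')
    from 2(2) have rdy': "ready Q d st'" and r: "regs st' 12 = k" "regs st' 16 = 3 * n + k * n"
        "regs st' 17 = 3 * n + m * n + k * n"
      and q: "queries st' = queries st + 2 * k" and t: "time st' \<le> time st + 6 + k * (62 * n + 100)"
      and old: "\<And>j. j < k \<Longrightarrow> mem st' (3 * n + 2 * (m * n) + j) = of_bool (agree Q j)"
      by (auto simp: I_def)
    note k = 2(1)
    have cst: "regs st' 0 = n" "regs st' 9 = m" "regs st' 22 = 3 * n + 2 * (m * n)" "regs st' 23 = 2 * n"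
      using rdy' by (auto simp: ready_def)
    have samp: "mem st' (3 * n + (k * n + i)) = of_bool (fst (V k i))"
        "mem st' (3 * n + m * n + (k * n + i)) = of_bool (snd (V k i))" if "i < n" for i
      using rdy' k that by (auto simp: ready_def)
    show ?case
      unfolding wp_Seq_eq
    proof (intro conjI)
      show "exp_val w st' (Op Less (Reg 12) (Reg 9)) \<noteq> 0"
        using r k cst w by (simp add: val del: exp_val.simps(1,4))
      let ?st0 = "st'\<lparr>time := time st' + exp_cost (Op Less (Reg 12) (Reg 9)) + 1\<rparr>"
      have rdy0: "ready Q d ?st0" using rdy' by (rule ready_cong) auto
      show "WP (fill 16) (WP (Query 14 (Reg 23)) (WP (fill 17)
          (WP (Query 15 (Reg 23)) (WP (Store (Op Plus (Reg 22) (Reg 12)) (Op Equal (Reg 14) (Reg 15)))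
          (WP (Assign 16 (Op Plus (Reg 16) (Reg 0))) (WP (Assign 17 (Op Plus (Reg 17) (Reg 0)))
            (WP (Assign 12 (Op Plus (Reg 12) (Const 1))) (I (Suc k))))))))) ?st0"
      proof (rule wp_fill[OF rdy0, where a = "3 * n + k * n" and b = "\<lambda>i. fst (V k i)"])
        fix st1
        assume 1: "ready Q d st1" "keeps ?st0 st1" "\<And>r. r \<noteq> 13 \<Longrightarrow> regs st1 r = regs ?st0 r"
          "f (point_at n (mem st1) (2 * n)) = fixed Q (px n (\<lambda>i. fst (V k i)))"
          "queries st1 = queries ?st0" "time st1 \<le> time ?st0 + 30 * n + 10"
        define st2 where "st2 = st1\<lparr>regs := (regs st1)(14 := encode_bit (f (point_at n (mem st1) (exp_val w st1 (Reg 23))))),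
          queries := queries st1 + 1, time := time st1 + exp_cost (Reg 23) + n + 1\<rparr>"
        have rdy2: "ready Q d st2" using 1(1) by (rule ready_cong) (auto simp: st2_def)
        have r2: "regs st2 17 = 3 * n + m * n + k * n" using 1(3) r by (simp add: st2_def)
        show "WP (Query 14 (Reg 23)) (WP (fill 17)
          (WP (Query 15 (Reg 23)) (WP (Store (Op Plus (Reg 22) (Reg 12)) (Op Equal (Reg 14) (Reg 15)))
          (WP (Assign 16 (Op Plus (Reg 16) (Reg 0))) (WP (Assign 17 (Op Plus (Reg 17) (Reg 0)))
            (WP (Assign 12 (Op Plus (Reg 12) (Const 1))) (I (Suc k)))))))) st1"
        proof (rule wp_Query, fold st2_def, rule wp_fill[OF rdy2, where a = "3 * n + m * n + k * n" and b = "\<lambda>i. snd (V k i)"])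
          fix st3
          assume 3: "ready Q d st3" "keeps st2 st3" "\<And>r. r \<noteq> 13 \<Longrightarrow> regs st3 r = regs st2 r"
            "f (point_at n (mem st3) (2 * n)) = fixed Q (px n (\<lambda>i. snd (V k i)))"
            "queries st3 = queries st2" "time st3 \<le> time st2 + 30 * n + 10"
          have r3: "regs st3 0 = n" "regs st3 22 = 3 * n + 2 * (m * n)" "regs st3 23 = 2 * n" "regs st3 12 = k"
            "regs st3 16 = 3 * n + k * n" "regs st3 17 = 3 * n + m * n + k * n"
            "regs st3 14 = encode_bit (fixed Q (px n (\<lambda>i. fst (V k i))))"
            using 1(3,4) 3(3) r cst by (simp_all add: st2_def)
          have mem3: "mem st3 (3 * n + 2 * (m * n) + j) = of_bool (agree Q j)" if "j < k" for j
            using old[OF that] 1(2) 3(2) by (simp add: keeps_def st2_def)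
          \<comment> \<open>Comparing encoded values is faithful only for signs, since
            \<open>encode_bit\<close> sends everything except 1 to 0.\<close>
          have pm: "fixed Q (px n b) = -1 \<or> fixed Q (px n b) = 1" for b
            using pm_D[OF pm_fixed[OF Qn] px_cube] .
          have eq: "encode_bit (fixed Q (px n (\<lambda>i. fst (V k i)))) = encode_bit (fixed Q (px n (\<lambda>i. snd (V k i)))) \<longleftrightarrow> agree Q k"
            unfolding agree_def by (rule encode_bit_inj[OF pm pm])
          have lt: "3 * n + 2 * (m * n) + k < 2 ^ w" "3 * n + k * n + n < 2 ^ w" "3 * n + m * n + k * n + n < 2 ^ w"
            "k + 1 < 2 ^ w" "(1 :: nat) < 2 ^ w"
            using fits k row_bounds[OF k] by linarith+
          have fin: "I (Suc k) st4" if f4: "regs st4 = (regs st3)(15 := v, 16 := 3 * n + k * n + n, 17 := 3 * n + m * n + k * n + n, 12 := k + 1)"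
            "mem st4 = (mem st3)(3 * n + 2 * (m * n) + k := of_bool (agree Q k))"
            "queries st4 = queries st3 + 1" "time st4 \<le> time st3 + n + 60" for st4 v
          proof -
            have "ready Q d st4" using 3(1) by (rule ready_cong) (use that in auto)
            moreover have "queries st4 = queries st + 2 * Suc k"
              using that(3) 3(5) 1(5) q by (simp add: st2_def)
            moreover have "time st4 \<le> time st + 6 + Suc k * (62 * n + 100)"
              using that(4) 3(6) 1(6) t by (simp add: st2_def)
            moreover have "mem st4 (3 * n + 2 * (m * n) + j) = of_bool (agree Q j)" if "j < Suc k" for j
              using mem3 \<open>mem st4 = _\<close> that by (cases "j = k") auto
            ultimately show ?thesis using that(1) k by (simp add: I_def)
          qed
          show "WP (Query 15 (Reg 23)) (WP (Store (Op Plus (Reg 22) (Reg 12)) (Op Equal (Reg 14) (Reg 15)))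
          (WP (Assign 16 (Op Plus (Reg 16) (Reg 0))) (WP (Assign 17 (Op Plus (Reg 17) (Reg 0)))
            (WP (Assign 12 (Op Plus (Reg 12) (Const 1))) (I (Suc k)))))) st3"
            by (intro wp_Query wp_Store wp_Assign, rule fin)
              (use lt w eq 3(4) in \<open>simp_all add: val r3 del: exp_val.simps(1,4)\<close>)
        qed (use r2 samp k row_bounds[OF k] 1(2) in \<open>simp_all add: st2_def keeps_def add.assoc\<close>)
      qed (use r samp k row_bounds[OF k] in \<open>simp_all add: add.assoc\<close>)
    qed
  next
    case (3 st')
    let ?st = "st'\<lparr>time := time st' + exp_cost (Op Less (Reg 12) (Reg 9)) + 1\<rparr>"
    have I: "I m st'" by (rule 3)
    then have rdy': "ready Q d st'" by (simp add: I_def)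
    then have "ready Q d ?st" by (rule ready_cong) auto
    then have "R ?st" using I by (intro R) (auto simp: I_def)
    moreover have "regs st' 9 = m" using rdy' by (simp add: ready_def)
    ultimately show ?case using I w by (simp add: I_def)
  qed
qed


lemma ready_regs:
  assumes "ready Q d st"
  shows "regs st 0 = n" "regs st 9 = m" "regs st 11 = d" "regs st 20 = 3 * n" "regs st 21 = 3 * n + m * n"
    "regs st 22 = 3 * n + 2 * (m * n)" "regs st 23 = 2 * n" "Q \<subseteq> {..<n}"
  using assms by (auto simp: ready_def)

lemma ready_samples:
  assumes "ready Q d st" "j < m" "i < n"
  shows "mem st (3 * n + (j * n + i)) = of_bool (fst (V j i))"
    "mem st (3 * n + m * n + (j * n + i)) = of_bool (snd (V j i))"
  using assms by (auto simp: ready_def)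

lemma wp_count_score:
  assumes rdy: "ready Q d st" and i: "i < n" "regs st 12 = i"
    and agree: "\<And>j. j < m \<Longrightarrow> mem st (3 * n + 2 * (m * n) + j) = of_bool (agree Q j)"
    and R: "\<And>st'. ready Q d st' \<Longrightarrow> (\<And>r. r \<notin> {13, 14, 16, 17} \<Longrightarrow> regs st' r = regs st r) \<Longrightarrow> mem st' = mem st \<Longrightarrow>
      regs st' 14 = score n m V (fixed Q) i \<Longrightarrow> queries st' = queries st \<Longrightarrow>
      time st' \<le> time st + 20 + m * 50 \<Longrightarrow> R st'"
  shows "WP count_score R st"
proof -
  define P where "P j \<longleftrightarrow> agree Q j = (fst (V j i) = snd (V j i))" for j
  have score: "score n m V (fixed Q) i = card {j. j < m \<and> P j}"
    unfolding score_def P_def agree_def ..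
  have card_le: "card {j. j < k \<and> P j} \<le> k" for k
    using card_mono[of "{..<k}" "{j. j < k \<and> P j}"] by auto
  define I where "I k st' \<longleftrightarrow> k \<le> m \<and> ready Q d st' \<and> regs st' 13 = k \<and> regs st' 14 = card {j. j < k \<and> P j} \<and>
    regs st' 16 = 3 * n + i + k * n \<and> regs st' 17 = 3 * n + m * n + i + k * n \<and>
    (\<forall>r. r \<notin> {13, 14, 16, 17} \<longrightarrow> regs st' r = regs st r) \<and> mem st' = mem st \<and>
    queries st' = queries st \<and> time st' \<le> time st + 12 + k * 50" for k st'
  note regs = ready_regs[OF rdy]
  have lt0: "3 * n + i < 2 ^ w" "3 * n + m * n + i < 2 ^ w" using fits i by linarith+
  show ?thesis
    unfolding count_score_def
  proof (intro wp_Seq wp_Assign, rule wp_While[where I = I and N = m], goal_cases)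
    case 1
    have "ready Q d (st\<lparr>regs := (regs st)(13 := 0, 14 := 0, 16 := a, 17 := b), time := t\<rparr>)" for a b t
      using rdy by (rule ready_cong) auto
    then show ?case using lt0 i regs by (simp add: I_def val del: exp_val.simps(4))
  next
    case (2 k st')
    note k = 2(1) and I = 2(2)
    have rdy': "ready Q d st'" using I by (simp add: I_def)
    note regs' = ready_regs[OF rdy']
    have r: "regs st' 13 = k" "regs st' 14 = card {j. j < k \<and> P j}"
      "regs st' 16 = 3 * n + i + k * n" "regs st' 17 = 3 * n + m * n + i + k * n"
      using I by (simp_all add: I_def)
    have eq: "3 * n + i + k * n = 3 * n + (k * n + i)" "3 * n + m * n + i + k * n = 3 * n + m * n + (k * n + i)"
      by simp_all
    have mm: "mem st' (3 * n + i + k * n) = of_bool (fst (V k i))" "mem st' (3 * n + m * n + i + k * n) = of_bool (snd (V k i))"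
      "mem st' (3 * n + 2 * (m * n) + k) = of_bool (agree Q k)"
      unfolding eq using ready_samples[OF rdy' k i(1)] agree[OF k] I by (simp_all add: I_def)
    have lt: "3 * n + 2 * (m * n) + k < 2 ^ w" "3 * n + i + k * n + n < 2 ^ w" "3 * n + m * n + i + k * n + n < 2 ^ w"
      "k + 1 < 2 ^ w" "(1 :: nat) < 2 ^ w" "card {j. j < k \<and> P j} + 1 < 2 ^ w"
      using fits k row_bounds[OF k] i card_le[of k] by linarith+
    then have lt': "card {j. j < k \<and> P j} + of_bool (P k) < 2 ^ w" by (cases "P k") auto
    have step: "I (Suc k) st''" if s: "regs st'' = (regs st')(14 := card {j. j < k \<and> P j} + of_bool (P k),
        16 := 3 * n + i + k * n + n, 17 := 3 * n + m * n + i + k * n + n, 13 := k + 1)"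
      "mem st'' = mem st'" "queries st'' = queries st'" "time st'' \<le> time st' + 50" for st''
    proof -
      have "ready Q d st''" using rdy' by (rule ready_cong) (use s in auto)
      then show ?thesis using I k s by (simp add: I_def card_less_Suc)
    qed
    show ?case
    proof (intro conjI wp_Seq wp_Assign)
      show "exp_val w st' (Op Less (Reg 13) (Reg 9)) \<noteq> 0"
        using k r regs' w by (simp add: val del: exp_val.simps(1,4))
    qed (rule step; use mm lt lt' w in \<open>simp add: val r regs' P_def del: exp_val.simps(1,4)\<close>)
  next
    case (3 st')
    let ?st = "st'\<lparr>time := time st' + exp_cost (Op Less (Reg 13) (Reg 9)) + 1\<rparr>"
    have rdy': "ready Q d st'" using 3 by (simp add: I_def)
    then have "ready Q d ?st" by (rule ready_cong) auto
    then have "R ?st" using 3 by (intro R) (auto simp: I_def score)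
    then show ?case using 3 w ready_regs[OF rdy'] by (simp add: I_def)
  qed
qed

lemma wp_find_best:
  assumes rdy: "ready Q d st"
    and agree: "\<And>j. j < m \<Longrightarrow> mem st (3 * n + 2 * (m * n) + j) = of_bool (agree Q j)"
    and R: "\<And>st'. ready Q d st' \<Longrightarrow> regs st' 18 = choice n m V (fixed Q) \<Longrightarrow> queries st' = queries st \<Longrightarrow>
      time st' \<le> time st + 20 + n * (50 + m * 50) \<Longrightarrow> R st'"
  shows "WP find_best R st"
proof -
  let ?S = "score n m V (fixed Q)"
  define I where "I k st' \<longleftrightarrow> k \<le> n \<and> ready Q d st' \<and> regs st' 12 = k \<and> regs st' 18 = fst (first_max ?S k) \<and>
    regs st' 19 = snd (first_max ?S k) \<and>
    (\<forall>j<m. mem st' (3 * n + 2 * (m * n) + j) = of_bool (agree Q j)) \<and>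
    queries st' = queries st \<and> time st' \<le> time st + 10 + k * (50 + m * 50)" for k st'
  show ?thesis
    unfolding find_best_def
  proof (intro wp_Seq wp_Assign, rule wp_While[where I = I and N = n], goal_cases)
    case 1
    have "ready Q d (st\<lparr>regs := (regs st)(12 := 0, 18 := 0, 19 := 0), time := t\<rparr>)" for t
      using rdy by (rule ready_cong) auto
    then show ?case using agree by (simp add: I_def)
  next
    case (2 k st')
    note k = 2(1) and I = 2(2)
    have rdy': "ready Q d st'" using I by (simp add: I_def)
    note regs' = ready_regs[OF rdy']
    have r: "regs st' 12 = k" using I by (simp add: I_def)
    have lt: "k + 1 < 2 ^ w" "(1 :: nat) < 2 ^ w"
      using fits k by linarith+
    let ?st0 = "st'\<lparr>time := time st' + exp_cost (Op Less (Reg 12) (Reg 0)) + 1\<rparr>"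
    have rdy0: "ready Q d ?st0" using rdy' by (rule ready_cong) auto
    show ?case
    proof (intro conjI wp_Seq)
      show "exp_val w st' (Op Less (Reg 12) (Reg 0)) \<noteq> 0"
        using k r regs' w by (simp add: val del: exp_val.simps(1,4))
    next
      show "WP count_score (WP (Seq (Cond (Op Less (Reg 19) (Reg 14))
          (Seq (Assign 19 (Reg 14)) (Assign 18 (Reg 12))) Skip)
          (Assign 12 (Op Plus (Reg 12) (Const 1)))) (I (Suc k))) ?st0"
      proof (rule wp_count_score[OF rdy0 k])
        fix st1
        assume 1: "ready Q d st1" "\<And>r. r \<notin> {13, 14, 16, 17} \<Longrightarrow> regs st1 r = regs ?st0 r" "mem st1 = mem ?st0"
          "regs st1 14 = ?S k" "queries st1 = queries ?st0" "time st1 \<le> time ?st0 + 20 + m * 50"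
        have r1: "regs st1 12 = k" "regs st1 18 = fst (first_max ?S k)" "regs st1 19 = snd (first_max ?S k)"
          using 1(2) I by (simp_all add: I_def)
        have step: "I (Suc k) st2" if s: "regs st2 12 = k + 1" "regs st2 18 = fst (first_max ?S (Suc k))" "regs st2 19 = snd (first_max ?S (Suc k))"
          "\<And>r. r < 12 \<or> 20 \<le> r \<Longrightarrow> regs st2 r = regs st1 r"
          "mem st2 = mem st1" "queries st2 = queries st1" "time st2 \<le> time st1 + 20" for st2
        proof -
          have "ready Q d st2" using 1(1) by (rule ready_cong) (use s in auto)
          moreover have "time st2 \<le> time st + 10 + Suc k * (50 + m * 50)"
            using s(7) 1(6) I by (simp add: I_def)
          moreover have "\<forall>j<m. mem st2 (3 * n + 2 * (m * n) + j) = of_bool (agree Q j)"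
            using s(5) 1(3) I by (simp add: I_def)
          moreover have "queries st2 = queries st"
            using s(6) 1(5) I by (simp add: I_def)
          ultimately show ?thesis using k s(1-3) unfolding I_def by (simp del: first_max.simps)
        qed
        show "WP (Seq (Cond (Op Less (Reg 19) (Reg 14))
          (Seq (Assign 19 (Reg 14)) (Assign 18 (Reg 12))) Skip)
          (Assign 12 (Op Plus (Reg 12) (Const 1)))) (I (Suc k)) st1"
          by (intro wp_Seq wp_Cond wp_Assign wp_Skip; rule step;
              use 1(4) r1 lt w in \<open>auto simp add: val simp del: exp_val.simps(1,4) split: if_splits\<close>)
      qed (use r I in \<open>simp_all add: I_def\<close>)
    qed
  next
    case (3 st')
    let ?st = "st'\<lparr>time := time st' + exp_cost (Op Less (Reg 12) (Reg 0)) + 1\<rparr>"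
    have rdy': "ready Q d st'" using 3 by (simp add: I_def)
    then have "ready Q d ?st" by (rule ready_cong) auto
    then have "R ?st" using 3 by (intro R) (auto simp: I_def choice_def)
    then show ?case using 3 w ready_regs[OF rdy'] by (simp add: I_def)
  qed
qed

definition level_time :: nat where
  "level_time = 100 + m * (62 * n + 100) + n * (50 + m * 50)"

abbreviation T :: "nat \<Rightarrow> (point \<Rightarrow> int) \<Rightarrow> dtree" where
  "T \<equiv> build (choice n m V) (vote n m V)"

text \<open>One step of the walk along the branch of \<open>z\<close>. It also covers
  \<open>i \<in> Q\<close>, a repeated query.\<close>

lemma restr_fixed: "restr (fixed Q) i (z i) = fixed (insert i Q)"
  unfolding restr_def fixed_def by (rule ext, rule arg_cong[where f = f], rule ext) simp

lemma fixed_empty: "fixed {} = f"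
  by (simp add: fixed_def)

text \<open>The tree is never stored. The invariant says that the tree still to be grown from
  \<open>fixed Q\<close> has at \<open>z\<close> the value of the whole tree; at level 0 this is the
  vote.\<close>

lemma wp_descend:
  assumes rdy: "ready {} D st"
    and R: "\<And>st' Q. ready Q 0 st' \<Longrightarrow> vote n m V (fixed Q) = dt_eval (T D f) z \<Longrightarrow>
      queries st' = queries st + D * (2 * m) \<Longrightarrow> time st' \<le> time st + 10 + D * level_time \<Longrightarrow> R st'"
  shows "WP descend R st"
proof -
  define I where "I t st' \<longleftrightarrow> t \<le> D \<and> (\<exists>Q. ready Q (D - t) st' \<and> dt_eval (T (D - t) (fixed Q)) z = dt_eval (T D f) z) \<and>
    queries st' = queries st + t * (2 * m) \<and> time st' \<le> time st + t * level_time" for t st'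
  show ?thesis
    unfolding descend_def
  proof (rule wp_While[where I = I and N = D], goal_cases)
    case 1
    show ?case using rdy unfolding I_def by (intro conjI exI[of _ "{}"]) (auto simp: fixed_empty)
  next
    case (2 t st')
    note t = 2(1) and I = 2(2)
    from I obtain Q where rdy': "ready Q (D - t) st'" and ev: "dt_eval (T (D - t) (fixed Q)) z = dt_eval (T D f) z"
      and qs: "queries st' = queries st + t * (2 * m)" and tm: "time st' \<le> time st + t * level_time"
      by (auto simp: I_def)
    let ?c = "choice n m V (fixed Q)"
    have c: "?c < n" using n by (rule choice_less)
    let ?st0 = "st'\<lparr>time := time st' + exp_cost (Reg 11) + 1\<rparr>"
    have rdy0: "ready Q (D - t) ?st0" using rdy' by (rule ready_cong) auto
    show ?case
      unfolding wp_Seq_eq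
    proof (intro conjI)
      show "exp_val w st' (Reg 11) \<noteq> 0" using ready_regs[OF rdy'] t by simp
      show "WP eval_samples (WP find_best (WP (Store (Op Plus (Reg 0) (Reg 18)) (Const 1))
          (WP (Assign 11 (Op Minus (Reg 11) (Const 1))) (I (Suc t))))) ?st0"
      proof (rule wp_eval_samples[OF rdy0], rule wp_find_best, assumption)
        fix st1 st2
        assume 1: "queries st1 = queries ?st0 + 2 * m" "time st1 \<le> time ?st0 + 10 + m * (62 * n + 100)"
          and 2: "ready Q (D - t) st2" "regs st2 18 = ?c" "queries st2 = queries st1"
            "time st2 \<le> time st1 + 20 + n * (50 + m * 50)"
        note regs2 = ready_regs[OF 2(1)]
        have lt: "n + ?c < 2 ^ w" "D - t < 2 ^ w" "(1 :: nat) < 2 ^ w" using fits c by linarith+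
        have fin: "I (Suc t) st3" if s: "regs st3 = (regs st2)(11 := D - t - 1)" "mem st3 = (mem st2)(n + ?c := 1)"
          "queries st3 = queries st2" "time st3 \<le> time st2 + 20" for st3
        proof -
          \<comment> \<open>The flag being set lies outside the request and outside both sample
            tables.\<close>
          have ne: "3 * n + x \<noteq> n + ?c" "x < n \<Longrightarrow> x \<noteq> n + ?c" for x using c by linarith+
          have "ready (insert ?c Q) (D - Suc t) st3"
            using 2(1) c ne(1)[of "m * n + _"] unfolding ready_def s(1,2) by (auto simp: ne add.assoc)
          moreover have "dt_eval (T (D - Suc t) (fixed (insert ?c Q))) z = dt_eval (T D f) z"
          proof -
            have "D - t = Suc (D - Suc t)" using t by simp
            then have "dt_eval (T (Suc (D - Suc t)) (fixed Q)) z = dt_eval (T D f) z" using ev by simp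
            moreover have "z ?c = -1 \<or> z ?c = 1" by (rule cube_val[OF z c])
            ultimately show ?thesis unfolding restr_fixed[symmetric] by auto
          qed
          moreover have "queries st3 = queries st + Suc t * (2 * m)"
            using s(3) 2(3) 1(1) qs by simp
          moreover have "time st3 \<le> time st + Suc t * level_time"
            using s(4) 2(4) 1(2) tm by (simp add: level_time_def)
          ultimately show ?thesis using t unfolding I_def by auto
        qed
        show "WP (Store (Op Plus (Reg 0) (Reg 18)) (Const 1))
          (WP (Assign 11 (Op Minus (Reg 11) (Const 1))) (I (Suc t))) st2"
          by (intro wp_Store wp_Assign, rule fin)
            (use lt w 2(2) in \<open>simp_all add: val regs2 del: exp_val.simps(1,4)\<close>)
      qed
    qed
  next
    case (3 st')
    let ?st = "st'\<lparr>time := time st' + exp_cost (Reg 11) + 1\<rparr>"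
    from 3 obtain Q where rdy': "ready Q 0 st'" and ev: "dt_eval (T 0 (fixed Q)) z = dt_eval (T D f) z"
      by (auto simp: I_def)
    have "ready Q 0 ?st" using rdy' by (rule ready_cong) auto
    then have "R ?st" using 3 ev by (intro R) (auto simp: I_def)
    then show ?case using ready_regs[OF rdy'] by simp
  qed
qed

lemma wp_take_vote:
  assumes rdy: "ready Q d st"
    and R: "\<And>st'. decode_bit (regs st' 0) = vote n m V (fixed Q) \<Longrightarrow>
      queries st' = queries st + m \<Longrightarrow> time st' \<le> time st + 30 + m * (31 * n + 50) \<Longrightarrow> R st'"
  shows "WP take_vote R st"
proof -
  let ?F = "fixed Q"
  define P where "P j \<longleftrightarrow> ?F (px n (\<lambda>i. fst (V j i))) = 1" for j
  have ones: "ones n m V ?F = card {j. j < m \<and> P j}"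
    unfolding ones_def P_def ..
  have card_le: "card {j. j < k \<and> P j} \<le> k" for k
    using card_mono[of "{..<k}" "{j. j < k \<and> P j}"] by auto
  define I where "I k st' \<longleftrightarrow> k \<le> m \<and> ready Q d st' \<and> regs st' 12 = k \<and> regs st' 14 = card {j. j < k \<and> P j} \<and>
    regs st' 16 = 3 * n + k * n \<and>
    queries st' = queries st + k \<and> time st' \<le> time st + 8 + k * (31 * n + 50)" for k st'
  note regs = ready_regs[OF rdy]
  show ?thesis
    unfolding take_vote_def
  proof (intro wp_Seq wp_Assign, rule wp_While[where I = I and N = m], goal_cases)
    case 1
    have "ready Q d (st\<lparr>regs := (regs st)(12 := 0, 14 := 0, 16 := a), time := t\<rparr>)" for a t
      using rdy by (rule ready_cong) auto
    then show ?case using regs by (simp add: I_def)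
  next
    case (2 k st')
    note k = 2(1) and I = 2(2)
    have rdy': "ready Q d st'" using I by (simp add: I_def)
    note regs' = ready_regs[OF rdy']
    have r: "regs st' 12 = k" "regs st' 16 = 3 * n + k * n" using I by (simp_all add: I_def)
    let ?st0 = "st'\<lparr>time := time st' + exp_cost (Op Less (Reg 12) (Reg 9)) + 1\<rparr>"
    have rdy0: "ready Q d ?st0" using rdy' by (rule ready_cong) auto
    show ?case
      unfolding wp_Seq_eq
    proof (intro conjI)
      show "exp_val w st' (Op Less (Reg 12) (Reg 9)) \<noteq> 0"
        using k r regs' w by (simp add: val del: exp_val.simps(1,4))
      show "WP (fill 16) (WP (Query 15 (Reg 23)) (WP (Assign 14 (Op Plus (Reg 14) (Reg 15)))
          (WP (Assign 16 (Op Plus (Reg 16) (Reg 0)))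
            (WP (Assign 12 (Op Plus (Reg 12) (Const 1))) (I (Suc k)))))) ?st0"
      proof (rule wp_fill[OF rdy0, where a = "3 * n + k * n" and b = "\<lambda>i. fst (V k i)"])
        fix st1
        assume 1: "ready Q d st1" "keeps ?st0 st1" "\<And>r. r \<noteq> 13 \<Longrightarrow> regs st1 r = regs ?st0 r"
          "f (point_at n (mem st1) (2 * n)) = ?F (px n (\<lambda>i. fst (V k i)))"
          "queries st1 = queries ?st0" "time st1 \<le> time ?st0 + 30 * n + 10"
        note regs1 = ready_regs[OF 1(1)]
        have r1: "regs st1 12 = k" "regs st1 14 = card {j. j < k \<and> P j}" "regs st1 16 = 3 * n + k * n"
          using 1(3) I by (simp_all add: I_def)
        have enc: "encode_bit (?F (px n (\<lambda>i. fst (V k i)))) = of_bool (P k)"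
          by (simp add: P_def encode_bit_def)
        have lt: "3 * n + k * n + n < 2 ^ w" "k + 1 < 2 ^ w" "(1 :: nat) < 2 ^ w" "card {j. j < k \<and> P j} + 1 < 2 ^ w"
          using fits k row_bounds[OF k] card_le[of k] by linarith+
        then have lt': "card {j. j < k \<and> P j} + of_bool (P k) < 2 ^ w" by (cases "P k") auto
        have fin: "I (Suc k) st2" if s: "regs st2 = (regs st1)(15 := v, 14 := card {j. j < k \<and> P j} + of_bool (P k),
            16 := 3 * n + k * n + n, 12 := k + 1)" "mem st2 = mem st1"
          "queries st2 = queries st1 + 1" "time st2 \<le> time st1 + n + 30" for st2 v
        proof -
          have "ready Q d st2" using 1(1) by (rule ready_cong) (use s in auto)
          moreover have "queries st2 = queries st + Suc k" using s(3) 1(5) I by (simp add: I_def)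
          moreover have "time st2 \<le> time st + 8 + Suc k * (31 * n + 50)"
            using s(4) 1(6) I by (simp add: I_def)
          ultimately show ?thesis using k s(1) by (simp add: I_def card_less_Suc)
        qed
        show "WP (Query 15 (Reg 23)) (WP (Assign 14 (Op Plus (Reg 14) (Reg 15)))
          (WP (Assign 16 (Op Plus (Reg 16) (Reg 0)))
            (WP (Assign 12 (Op Plus (Reg 12) (Const 1))) (I (Suc k))))) st1"
          by (intro wp_Query wp_Assign, rule fin)
            (use lt lt' w 1(4) in \<open>simp_all add: val regs1 r1 enc del: exp_val.simps(1,4)\<close>)
      qed (use r ready_samples[OF rdy' k] k row_bounds[OF k] in \<open>simp_all add: add.assoc\<close>)
    qed
  next
    case (3 st')
    have rdy': "ready Q d st'" using 3 by (simp add: I_def)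
    have r: "regs st' 14 = card {j. j < m \<and> P j}" "regs st' 12 = m" using 3 by (simp_all add: I_def)
    have lt: "card {j. j < m \<and> P j} + card {j. j < m \<and> P j} < 2 ^ w" "(1 :: nat) < 2 ^ w"
      using fits card_le[of m] by linarith+
    show ?case
    proof (intro conjI wp_Assign R)
      show "exp_val w st' (Op Less (Reg 12) (Reg 9)) = 0" using r w ready_regs[OF rdy'] by simp
    qed (use 3 lt w in \<open>simp_all add: I_def val ready_regs[OF rdy'] vote_def ones decode_bit_def mult_2 del: exp_val.simps(1,4)\<close>)
  qed
qed

end

text \<open>The binary logarithm rounded up, in the form that repeated doubling computes. It is 0 at
  1, so that s = 1 leads to a tree of depth 0.\<close>

definition lg2 :: "nat \<Rightarrow> nat" where
  "lg2 b = (LEAST k. b \<le> 2 ^ k)"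

lemma lg2_ge: "b \<le> 2 ^ lg2 b"
  unfolding lg2_def by (rule LeastI[of _ b]) (simp add: less_imp_le)

lemma lg2_less: "k < lg2 b \<Longrightarrow> 2 ^ k < b"
  unfolding lg2_def by (auto dest: not_less_Least)

lemma lg2_le: "lg2 b \<le> b"
  unfolding lg2_def by (rule Least_le) (simp add: less_imp_le)

definition log_loop :: "nat \<Rightarrow> nat \<Rightarrow> com" where
  "log_loop d b = Seq (Assign 4 (Const 1)) (While (Op Less (Reg 4) (Reg b))
     (Seq (Assign 4 (Op Plus (Reg 4) (Reg 4))) (Assign d (Op Plus (Reg d) (Const 1)))))"

lemma wp_log_loop:
  assumes d: "d \<noteq> 4" "b \<noteq> 4" "b \<noteq> d" "regs st d = 0" "regs st b = B" and lt: "2 * B < 2 ^ w" "1 < w"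
    and R: "\<And>st'. (\<And>r. r \<noteq> 4 \<Longrightarrow> r \<noteq> d \<Longrightarrow> regs st' r = regs st r) \<Longrightarrow> regs st' d = lg2 B \<Longrightarrow> mem st' = mem st \<Longrightarrow>
      flips st' = flips st \<Longrightarrow> queries st' = queries st \<Longrightarrow> time st' \<le> time st + 10 + lg2 B * 20 \<Longrightarrow> R st'"
  shows "wp n w f \<omega> (log_loop d b) R st"
proof -
  define I where "I k st' \<longleftrightarrow> k \<le> lg2 B \<and> regs st' 4 = 2 ^ k \<and> regs st' d = k \<and>
    (\<forall>r. r \<noteq> 4 \<longrightarrow> r \<noteq> d \<longrightarrow> regs st' r = regs st r) \<and> mem st' = mem st \<and> flips st' = flips st \<and>
    queries st' = queries st \<and> time st' \<le> time st + 2 + k * 20" for k and st' :: config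
  have one: "(1 :: nat) < 2 ^ w" using lt(2) by (intro one_less_power) auto
  have w: "0 < w" using lt(2) by simp
  show ?thesis
    unfolding log_loop_def
  proof (intro wp_Seq wp_Assign, rule wp_While[where I = I and N = "lg2 B"], goal_cases)
    case 1
    show ?case using d one by (simp add: I_def val del: exp_val.simps(1,4))
  next
    case (2 k st')
    note k = 2(1) and I = 2(2)
    have r: "regs st' 4 = 2 ^ k" "regs st' d = k" "regs st' b = B"
      using I d by (auto simp: I_def)
    have less: "2 ^ k < B" by (rule lg2_less[OF k])
    have lt': "(2 :: nat) ^ k + 2 ^ k < 2 ^ w" "k + 1 < 2 ^ w"
      using less lt(1) k lg2_le[of B] by linarith+
    have step: "I (Suc k) st''" if "regs st'' = (regs st')(4 := 2 ^ k + 2 ^ k, d := k + 1)" "mem st'' = mem st'"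
      "flips st'' = flips st'" "queries st'' = queries st'" "time st'' \<le> time st' + 20" for st''
      using that I k d by (auto simp: I_def)
    show ?case
    proof (intro conjI wp_Seq wp_Assign)
      show "exp_val w st' (Op Less (Reg 4) (Reg b)) \<noteq> 0"
        using less r w by (simp add: val del: exp_val.simps(1,4))
    qed (rule step; use lt' one d in \<open>simp add: val r del: exp_val.simps(1,4)\<close>)
  next
    case (3 st')
    let ?st = "st'\<lparr>time := time st' + exp_cost (Op Less (Reg 4) (Reg b)) + 1\<rparr>"
    have "R ?st" using 3 by (intro R) (auto simp: I_def)
    moreover have "regs st' 4 = 2 ^ lg2 B" "regs st' b = B" using 3 d by (auto simp: I_def)
    ultimately show ?case using lg2_ge[of B] by simp
  qed
qed

text \<open>The product in register 14 is the conjunction of \<open>u\<close> coins. Comparing an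
  equality with 0 negates it, so the second stored bit is an exclusive or. Coins are consumed in the
  order that \<open>cell\<close> prescribes.\<close>

definition draw :: com where
  "draw = Seq (Assign 11 (Const 0)) (While (Op Less (Reg 11) (Reg 10))
     (Seq (Flip 12) (Seq (Store (Op Plus (Reg 20) (Reg 11)) (Reg 12))
     (Seq (Assign 13 (Const 0)) (Seq (Assign 14 (Const 1))
     (Seq (While (Op Less (Reg 13) (Reg 7))
        (Seq (Flip 15) (Seq (Assign 14 (Op Times (Reg 14) (Reg 15))) (Assign 13 (Op Plus (Reg 13) (Const 1))))))
     (Seq (Store (Op Plus (Reg 21) (Reg 11)) (Op Equal (Op Equal (Reg 12) (Reg 14)) (Const 0)))
       (Assign 11 (Op Plus (Reg 11) (Const 1))))))))))"

context run
begin

definition started :: "config \<Rightarrow> bool" where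
  "started st \<longleftrightarrow> regs st 0 = n \<and> regs st 7 = u \<and> regs st 8 = D \<and> regs st 9 = m \<and> regs st 10 = m * n \<and>
     regs st 20 = 3 * n \<and> regs st 21 = 3 * n + m * n \<and> regs st 22 = 3 * n + 2 * (m * n) \<and> regs st 23 = 2 * n \<and>
     (\<forall>i<n. mem st i = encode_bit (z i)) \<and> (\<forall>i<n. mem st (n + i) = 0)"

lemma started_cong:
  assumes "started st" "\<And>r. r < 11 \<or> 20 \<le> r \<Longrightarrow> regs st' r = regs st r"
    "\<And>a. a < 2 * n \<Longrightarrow> mem st' a = mem st a"
  shows "started st'"
proof -
  have "mem st' i = mem st i" "mem st' (n + i) = mem st (n + i)" if "i < n" for i
    using that by (intro assms(3); linarith)+
  then show ?thesis
    using assms(1) unfolding started_def by (simp add: assms(2))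
qed

lemma wp_flips:
  assumes s: "started st" "regs st 13 = 0" "regs st 14 = 1"
    and R: "\<And>st'. started st' \<Longrightarrow> regs st' 11 = regs st 11 \<Longrightarrow> regs st' 12 = regs st 12 \<Longrightarrow> mem st' = mem st \<Longrightarrow>
      regs st' 14 = of_bool (\<forall>l<u. \<omega> (flips st + l)) \<Longrightarrow> flips st' = flips st + u \<Longrightarrow> queries st' = queries st \<Longrightarrow>
      time st' \<le> time st + 10 + u * 20 \<Longrightarrow> R st'"
  shows "WP (While (Op Less (Reg 13) (Reg 7))
        (Seq (Flip 15) (Seq (Assign 14 (Op Times (Reg 14) (Reg 15))) (Assign 13 (Op Plus (Reg 13) (Const 1)))))) R st"
proof -
  define I where "I k st' \<longleftrightarrow> k \<le> u \<and> started st' \<and> regs st' 13 = k \<and> regs st' 11 = regs st 11 \<and> regs st' 12 = regs st 12 \<and>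
    mem st' = mem st \<and> regs st' 14 = of_bool (\<forall>l<k. \<omega> (flips st + l)) \<and> flips st' = flips st + k \<and> queries st' = queries st \<and>
    time st' \<le> time st + k * 20" for k st'
  show ?thesis
  proof (rule wp_While[where I = I and N = u], goal_cases)
    case 1
    show ?case using s by (simp add: I_def)
  next
    case (2 k st')
    note k = 2(1) and I = 2(2)
    have s': "started st'" and r: "regs st' 13 = k" "regs st' 14 = of_bool (\<forall>l<k. \<omega> (flips st + l))"
      "flips st' = flips st + k" using I by (auto simp: I_def)
    have r7: "regs st' 7 = u" using s' by (simp add: started_def)
    have lt: "k + 1 < 2 ^ w" "(1 :: nat) < 2 ^ w" using fits k by linarith+
    have lt': "of_bool a * of_bool b < (2 :: nat) ^ w" for a b using lt(2) by (cases a; cases b) auto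
    have all: "of_bool (\<forall>l<k. \<omega> (flips st + l)) * of_bool (\<omega> (flips st + k)) = (of_bool (\<forall>l<Suc k. \<omega> (flips st + l)) :: nat)"
      by (auto simp: less_Suc_eq)
    have step: "I (Suc k) st''" if t: "regs st'' = (regs st')(15 := v, 14 := of_bool (\<forall>l<Suc k. \<omega> (flips st + l)), 13 := k + 1)"
      "mem st'' = mem st'" "flips st'' = flips st' + 1" "queries st'' = queries st'" "time st'' \<le> time st' + 20" for st'' v
    proof -
      have "started st''" using s' by (rule started_cong) (use t in auto)
      then show ?thesis using t I k by (auto simp: I_def)
    qed
    show ?case
    proof (intro conjI wp_Seq wp_Flip wp_Assign)
      show "exp_val w st' (Op Less (Reg 13) (Reg 7)) \<noteq> 0"
        using k r r7 w by (simp add: val del: exp_val.simps(1,4))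
    qed (rule step; use lt lt' w in \<open>simp add: val r all[simplified] all del: exp_val.simps(1,4) of_bool_conj\<close>)
  next
    case (3 st')
    let ?st = "st'\<lparr>time := time st' + exp_cost (Op Less (Reg 13) (Reg 7)) + 1\<rparr>"
    have s': "started st'" using 3 by (simp add: I_def)
    then have "started ?st" by (rule started_cong) auto
    then have "R ?st" using 3 by (intro R) (auto simp: I_def)
    then show ?case using 3 s' w by (simp add: I_def started_def)
  qed
qed

text \<open>The coin counter belongs to the invariant: after \<open>k\<close> cells it is k (u + 1),
  which identifies the coins read next with those of cell \<open>k\<close>. This is why the counter
  must start at 0.\<close>

lemma wp_draw:
  assumes s: "started st" "flips st = 0"
    and R: "\<And>st'. started st' \<Longrightarrow>
      (\<And>k. k < m * n \<Longrightarrow> mem st' (3 * n + k) = of_bool (fst (cell u \<omega> k))) \<Longrightarrow>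
      (\<And>k. k < m * n \<Longrightarrow> mem st' (3 * n + m * n + k) = of_bool (snd (cell u \<omega> k))) \<Longrightarrow>
      queries st' = queries st \<Longrightarrow> time st' \<le> time st + 10 + m * n * (u * 20 + 60) \<Longrightarrow> R st'"
  shows "WP draw R st"
proof -
  define I where "I k st' \<longleftrightarrow> k \<le> m * n \<and> started st' \<and> regs st' 11 = k \<and>
    (\<forall>j<k. mem st' (3 * n + j) = of_bool (fst (cell u \<omega> j))) \<and>
    (\<forall>j<k. mem st' (3 * n + m * n + j) = of_bool (snd (cell u \<omega> j))) \<and>
    flips st' = k * (u + 1) \<and> queries st' = queries st \<and> time st' \<le> time st + 2 + k * (u * 20 + 60)" for k st'
  show ?thesis
    unfolding draw_def
  proof (intro wp_Seq wp_Assign, rule wp_While[where I = I and N = "m * n"], goal_cases)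
    case 1
    have "started (st\<lparr>regs := (regs st)(11 := 0), time := t\<rparr>)" for t
      using s(1) by (rule started_cong) auto
    then show ?case using s(2) by (simp add: I_def)
  next
    case (2 k st')
    note k = 2(1) and I = 2(2)
    have s': "started st'" and r: "regs st' 11 = k" "flips st' = k * (u + 1)" using I by (auto simp: I_def)
    have c: "regs st' 20 = 3 * n" "regs st' 10 = m * n" "regs st' 21 = 3 * n + m * n"
      using s' by (auto simp: started_def)
    have lt: "3 * n + k < 2 ^ w" "3 * n + m * n + k < 2 ^ w" "k + 1 < 2 ^ w" "(1 :: nat) < 2 ^ w" "(0 :: nat) < 2 ^ w"
      using fits k by linarith+
    let ?st0 = "st'\<lparr>time := time st' + exp_cost (Op Less (Reg 11) (Reg 10)) + 1\<rparr>"
    let ?x = "\<omega> (k * (u + 1))"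
    let ?rest = "WP (Store (Op Plus (Reg 21) (Reg 11)) (Op Equal (Op Equal (Reg 12) (Reg 14)) (Const 0)))
       (WP (Assign 11 (Op Plus (Reg 11) (Const 1))) (I (Suc k)))"
    have main: "WP (While (Op Less (Reg 13) (Reg 7))
        (Seq (Flip 15) (Seq (Assign 14 (Op Times (Reg 14) (Reg 15))) (Assign 13 (Op Plus (Reg 13) (Const 1))))))
        ?rest st1"
      if 1: "regs st1 = (regs st')(12 := of_bool ?x, 13 := 0, 14 := 1)" "mem st1 = (mem st')(3 * n + k := of_bool ?x)"
        "flips st1 = k * (u + 1) + 1" "queries st1 = queries st'" "time st1 \<le> time st' + 20" for st1
    proof (rule wp_flips)
      show "started st1" using s' by (rule started_cong) (use 1 in auto)
      fix st2
      assume 2: "started st2" "regs st2 11 = regs st1 11" "regs st2 12 = regs st1 12" "mem st2 = mem st1"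
        "regs st2 14 = of_bool (\<forall>l<u. \<omega> (flips st1 + l))" "flips st2 = flips st1 + u" "queries st2 = queries st1"
        "time st2 \<le> time st1 + 10 + u * 20"
      have r2: "regs st2 11 = k" "regs st2 12 = of_bool ?x" "regs st2 21 = 3 * n + m * n"
        using 1 2 r by (simp_all add: started_def)
      have snd: "of_bool (of_bool (of_bool ?x = (regs st2 14)) = (0 :: nat)) = (of_bool (snd (cell u \<omega> k)) :: nat)"
        unfolding 2(5) 1(3) cell_def by auto
      have step: "I (Suc k) st3" if 3: "regs st3 = (regs st2)(11 := k + 1)"
        "mem st3 = (mem st2)(3 * n + m * n + k := of_bool (snd (cell u \<omega> k)))"
        "flips st3 = flips st2" "queries st3 = queries st2" "time st3 \<le> time st2 + 20" for st3
      proof -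
        have "started st3" using 2(1) by (rule started_cong) (use 3 in auto)
        moreover have "mem st3 (3 * n + j) = of_bool (fst (cell u \<omega> j))" if "j < Suc k" for j
        proof -
          have "3 * n + j \<noteq> 3 * n + m * n + k" using that k by linarith
          then have "mem st3 (3 * n + j) = (if j = k then of_bool ?x else mem st' (3 * n + j))"
            unfolding 3(2) 2(4) 1(2) by simp
          moreover have "fst (cell u \<omega> k) = ?x" by (simp add: cell_def)
          ultimately show ?thesis using I that by (cases "j = k") (auto simp: I_def less_Suc_eq)
        qed
        moreover have "mem st3 (3 * n + m * n + j) = of_bool (snd (cell u \<omega> j))" if "j < Suc k" for j
          using 3(2) 2(4) 1(2) I k that by (auto simp: I_def less_Suc_eq)
        moreover have "flips st3 = Suc k * (u + 1)" using 3(3) 2(6) 1(3) by simp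
        moreover have "queries st3 = queries st" using 3(4) 2(7) 1(4) I by (simp add: I_def)
        moreover have "time st3 \<le> time st + 2 + Suc k * (u * 20 + 60)"
          using 3(5) 2(8) 1(5) I by (simp add: I_def)
        ultimately show ?thesis using 3(1) k unfolding I_def by simp
      qed
      have addr: "exp_val w st2 (Op Plus (Reg 21) (Reg 11)) = 3 * n + m * n + k"
        using lt by (simp add: val r2 del: exp_val.simps(1,4))
      have "exp_val w st2 (Op Equal (Op Equal (Reg 12) (Reg 14)) (Const 0)) = of_bool (of_bool (regs st2 12 = regs st2 14) = (0 :: nat))"
        unfolding val_Equal[OF w] exp_val.simps(2) val_Const[OF lt(5)] ..
      then have ev: "exp_val w st2 (Op Equal (Op Equal (Reg 12) (Reg 14)) (Const 0)) = of_bool (snd (cell u \<omega> k))"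
        unfolding r2(2) snd .
      show "?rest st2"
        by (intro wp_Store wp_Assign, rule step)
          (use lt in \<open>simp_all add: addr ev val_Plus val_Const r2 del: exp_val.simps(1,4)\<close>)
    qed (use 1 in simp_all)
    show ?case
      unfolding wp_Seq_eq
    proof (intro conjI)
      show "exp_val w st' (Op Less (Reg 11) (Reg 10)) \<noteq> 0"
        using k r c w by (simp add: val del: exp_val.simps(1,4))
      show "WP (Flip 12) (WP (Store (Op Plus (Reg 20) (Reg 11)) (Reg 12))
         (WP (Assign 13 (Const 0)) (WP (Assign 14 (Const 1))
         (WP (While (Op Less (Reg 13) (Reg 7))
            (Seq (Flip 15) (Seq (Assign 14 (Op Times (Reg 14) (Reg 15))) (Assign 13 (Op Plus (Reg 13) (Const 1))))))
         ?rest)))) ?st0"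
        by (intro wp_Flip wp_Store wp_Assign, rule main)
          (use lt w in \<open>simp_all add: val r c del: exp_val.simps(1,4)\<close>)
    qed
  next
    case (3 st')
    let ?st = "st'\<lparr>time := time st' + exp_cost (Op Less (Reg 11) (Reg 10)) + 1\<rparr>"
    have s': "started st'" using 3 by (simp add: I_def)
    then have "started ?st" by (rule started_cong) auto
    then have "R ?st" using 3 by (intro R) (auto simp: I_def)
    then show ?case using 3 s' w by (simp add: I_def started_def)
  qed
qed

definition total_time :: nat where
  "total_time = 100 + m * n * (u * 20 + 60) + D * level_time + m * (31 * n + 50)"

lemma wp_run:
  assumes s: "started st" "flips st = 0"
    and R: "\<And>st'. decode_bit (regs st' 0) = dt_eval (T D f) z \<Longrightarrow>
      queries st' = queries st + D * (2 * m) + m \<Longrightarrow> time st' \<le> time st + total_time \<Longrightarrow> R st'"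
  shows "WP (Seq draw (Seq (Assign 11 (Reg 8)) (Seq descend take_vote))) R st"
  unfolding wp_Seq_eq
proof (rule wp_draw[OF s], rule wp_Assign)
  fix st1
  assume 1: "started st1"
    "\<And>k. k < m * n \<Longrightarrow> mem st1 (3 * n + k) = of_bool (fst (cell u \<omega> k))"
    "\<And>k. k < m * n \<Longrightarrow> mem st1 (3 * n + m * n + k) = of_bool (snd (cell u \<omega> k))"
    "queries st1 = queries st" "time st1 \<le> time st + 10 + m * n * (u * 20 + 60)"
  let ?st = "st1\<lparr>regs := (regs st1)(11 := exp_val w st1 (Reg 8)), time := time st1 + exp_cost (Reg 8) + 1\<rparr>"
  have "ready {} D ?st"
    using 1(1) unfolding ready_def started_def by (simp add: 1(2,3) cell_le samples_def)
  then show "WP descend (WP take_vote R) ?st"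
  proof (rule wp_descend)
    fix st2 Q
    assume 2: "ready Q 0 st2" "vote n m V (fixed Q) = dt_eval (T D f) z"
      "queries st2 = queries ?st + D * (2 * m)" "time st2 \<le> time ?st + 10 + D * level_time"
    show "WP take_vote R st2"
    proof (rule wp_take_vote[OF 2(1)])
      fix st3 :: config
      assume 3: "decode_bit (regs st3 0) = vote n m V (fixed Q)"
        "queries st3 = queries st2 + m" "time st3 \<le> time st2 + 30 + m * (31 * n + 50)"
      show "R st3"
        using 3 2(2-4) 1(4,5) by (intro R) (simp_all add: total_time_def)
    qed
  qed
qed

end

definition params :: "nat \<Rightarrow> com" where
  "params C = Seq (log_loop 3 1)
     (Seq (Assign 5 (Op Plus (Reg 0) (Const 1))) (Seq (log_loop 6 5)
     (Seq (Assign 12 (Op Times (Reg 3) (Reg 2)))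
     (Seq (Assign 5 (Op Plus (Op Times (Const 8) (Reg 12)) (Const 4))) (Seq (log_loop 7 5)
     (Seq (Assign 8 (Op Times (Const 384) (Op Times (Reg 12) (Op Times (Reg 12) (Reg 12)))))
     (Seq (Assign 13 (Op Plus (Reg 12) (Const 1)))
     (Seq (Assign 14 (Op Times (Reg 13) (Op Times (Reg 13) (Reg 13))))
     (Seq (Assign 9 (Op Times (Const C) (Op Times (Reg 14) (Op Times (Reg 14) (Op Times (Reg 14) (Reg 6))))))
     (Seq (Assign 10 (Op Times (Reg 9) (Reg 0)))
     (Seq (Assign 20 (Op Times (Const 3) (Reg 0)))
     (Seq (Assign 21 (Op Plus (Reg 20) (Reg 10)))
     (Seq (Assign 22 (Op Plus (Reg 21) (Reg 10)))
       (Assign 23 (Op Plus (Reg 0) (Reg 0))))))))))))))))"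

text \<open>Makes the noise rate at most 1 / (4 P) for positive \<open>P\<close>, but no smaller
  than 1 / (8 P + 4). The summand 4 keeps the rate at most 1/2 when \<open>P\<close> is 0.\<close>

definition noise_bits :: "nat \<Rightarrow> nat" where
  "noise_bits P = lg2 (8 * P + 4)"

text \<open>The inverse depth uses half of the gain budget 1 / (192 P^3) in
  \<open>total_error\<close>; the other half is left for the sampling error 4 \<eta>.\<close>

definition depth :: "nat \<Rightarrow> nat" where
  "depth P = 384 * (P * (P * P))"

definition Suc_cubed :: "nat \<Rightarrow> nat" where
  "Suc_cubed P = (P + 1) * ((P + 1) * (P + 1))"

text \<open>Two of the cubes stem from the accuracy 1 / \<eta>^2, the third from the depth in the
  union bound. With P + 1 in place of \<open>P\<close> the number stays positive for s = 1.\<close>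

definition num_samples :: "nat \<Rightarrow> nat \<Rightarrow> nat \<Rightarrow> nat" where
  "num_samples C n P = C * (Suc_cubed P * (Suc_cubed P * (Suc_cubed P * lg2 (n + 1))))"

text \<open>The exponent 20: P + 1 is at most (n + s + e)^2, so three cubes need 18, and
  \<open>lg2 (n + 1)\<close> and \<open>n\<close> need one each.\<close>

lemma sizes:
  fixes n s e C :: nat
  assumes pos: "1 \<le> n" "1 \<le> s" "1 \<le> e" "1 \<le> C"
  defines "E \<equiv> (n + s + e) ^ 20" and "P \<equiv> lg2 s * e"
  shows "1 \<le> E" "n \<le> E" "s \<le> E" "P + 1 \<le> E" "P * (P * P) \<le> E" "Suc_cubed P \<le> E"
    "Suc_cubed P * lg2 (n + 1) \<le> E" "Suc_cubed P * (Suc_cubed P * lg2 (n + 1)) \<le> E"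
    "Suc_cubed P * (Suc_cubed P * (Suc_cubed P * lg2 (n + 1))) \<le> E"
    "num_samples C n P \<le> C * E" "num_samples C n P * n \<le> C * E"
    "noise_bits P \<le> 12 * E" "depth P \<le> 384 * E"
proof -
  define X where "X = n + s + e"
  have X1: "1 \<le> X" using pos by (simp add: X_def)
  have pw: "a \<le> E" if "a \<le> X ^ k" "k \<le> 20" for a k
    using that power_increasing[OF that(2) X1] unfolding E_def X_def[symmetric] by linarith
  have P2: "P + 1 \<le> X ^ 2"
  proof -
    have "P \<le> s * e" unfolding P_def by (rule mult_le_mono1[OF lg2_le])
    moreover have "1 \<le> s * e" using pos by simp
    moreover have "s * e + s * e \<le> X ^ 2"
      unfolding X_def power2_eq_square by (simp add: algebra_simps)
    ultimately show ?thesis by linarith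
  qed
  have Q6: "Suc_cubed P \<le> X ^ 6"
  proof -
    have "Suc_cubed P \<le> X ^ 2 * (X ^ 2 * X ^ 2)"
      unfolding Suc_cubed_def by (intro mult_le_mono P2)
    also have "\<dots> = X ^ 6" by (simp flip: power_add)
    finally show ?thesis .
  qed
  have lgX: "lg2 (n + 1) \<le> X ^ 1"
    using lg2_le[of "n + 1"] pos by (simp add: X_def)
  have Q7: "Suc_cubed P * lg2 (n + 1) \<le> X ^ 7"
    using mult_le_mono[OF Q6 lgX] by (simp flip: power_add power_Suc2)
  have Q13: "Suc_cubed P * (Suc_cubed P * lg2 (n + 1)) \<le> X ^ 13"
    using mult_le_mono[OF Q6 Q7] by (simp flip: power_add)
  have Q19: "Suc_cubed P * (Suc_cubed P * (Suc_cubed P * lg2 (n + 1))) \<le> X ^ 19"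
    using mult_le_mono[OF Q6 Q13] by (simp flip: power_add)
  have Q20: "Suc_cubed P * (Suc_cubed P * (Suc_cubed P * lg2 (n + 1))) * n \<le> X ^ 20"
  proof -
    have "n \<le> X" by (simp add: X_def)
    from mult_le_mono[OF Q19 this] have "Suc_cubed P * (Suc_cubed P * (Suc_cubed P * lg2 (n + 1))) * n \<le> X ^ 19 * X" .
    also have "X ^ 19 * X = X ^ 20" by (simp flip: power_Suc2)
    finally show ?thesis .
  qed
  show "1 \<le> E" by (rule pw[of _ 0]) simp_all
  show "n \<le> E" "s \<le> E" by (rule pw[of _ 1]; simp add: X_def)+
  show PE: "P + 1 \<le> E" by (rule pw[OF P2]) simp
  show "Suc_cubed P \<le> E" by (rule pw[OF Q6]) simp
  moreover have "P * (P * P) \<le> Suc_cubed P"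
    unfolding Suc_cubed_def by (intro mult_le_mono) simp_all
  ultimately show PP: "P * (P * P) \<le> E" by linarith
  then show "depth P \<le> 384 * E" by (simp add: depth_def)
  show "Suc_cubed P * lg2 (n + 1) \<le> E" by (rule pw[OF Q7]) simp
  show "Suc_cubed P * (Suc_cubed P * lg2 (n + 1)) \<le> E" by (rule pw[OF Q13]) simp
  show Q: "Suc_cubed P * (Suc_cubed P * (Suc_cubed P * lg2 (n + 1))) \<le> E" by (rule pw[OF Q19]) simp
  show "num_samples C n P \<le> C * E"
    unfolding num_samples_def by (rule mult_le_mono2[OF Q])
  have "Suc_cubed P * (Suc_cubed P * (Suc_cubed P * lg2 (n + 1))) * n \<le> E"
    by (rule pw[OF Q20]) simp
  then show "num_samples C n P * n \<le> C * E"
    unfolding num_samples_def mult.assoc by (rule mult_le_mono2)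
  show "noise_bits P \<le> 12 * E"
    unfolding noise_bits_def using lg2_le[of "8 * P + 4"] PE by linarith
qed

text \<open>The new state is a variable known only through equations, so that long straight-line
  code does not pile up nested record updates.\<close>

lemma wp_Assign_val:
  assumes "exp_val w st e = v"
    and "\<And>st'. regs st' = (regs st)(r := v) \<Longrightarrow> mem st' = mem st \<Longrightarrow> flips st' = flips st \<Longrightarrow> queries st' = queries st \<Longrightarrow>
      time st' = time st + exp_cost e + 1 \<Longrightarrow> Q st'"
  shows "wp n w f \<omega> (Assign r e) Q st"
  by (rule wp_Assign, rule assms(2)) (simp_all add: assms(1))

lemma wp_arith:
  fixes n w C P :: nat
  assumes r: "regs st 0 = n" "regs st 6 = lg2 (n + 1)" "regs st 7 = noise_bits P" "regs st 12 = P"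
    and lt: "P + 1 < 2 ^ w" "P * P < 2 ^ w" "P * (P * P) < 2 ^ w" "384 * (P * (P * P)) < 2 ^ w"
      "(P + 1) * (P + 1) < 2 ^ w" "(P + 1) * ((P + 1) * (P + 1)) < 2 ^ w"
      "Suc_cubed P * lg2 (n + 1) < 2 ^ w" "Suc_cubed P * (Suc_cubed P * lg2 (n + 1)) < 2 ^ w"
      "Suc_cubed P * (Suc_cubed P * (Suc_cubed P * lg2 (n + 1))) < 2 ^ w"
      "C < 2 ^ w" "num_samples C n P < 2 ^ w" "num_samples C n P * n < 2 ^ w" "3 * n < 2 ^ w"
      "3 * n + num_samples C n P * n < 2 ^ w" "3 * n + num_samples C n P * n + num_samples C n P * n < 2 ^ w"
      "n + n < 2 ^ w" "(1 :: nat) < 2 ^ w" "(3 :: nat) < 2 ^ w" "(384 :: nat) < 2 ^ w"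
    and R: "\<And>st'. regs st' 0 = n \<Longrightarrow> regs st' 7 = noise_bits P \<Longrightarrow> regs st' 8 = depth P \<Longrightarrow>
      regs st' 9 = num_samples C n P \<Longrightarrow> regs st' 10 = num_samples C n P * n \<Longrightarrow> regs st' 20 = 3 * n \<Longrightarrow>
      regs st' 21 = 3 * n + num_samples C n P * n \<Longrightarrow> regs st' 22 = 3 * n + 2 * (num_samples C n P * n) \<Longrightarrow>
      regs st' 23 = 2 * n \<Longrightarrow> mem st' = mem st \<Longrightarrow> flips st' = flips st \<Longrightarrow> queries st' = queries st \<Longrightarrow>
      time st' \<le> time st + 100 \<Longrightarrow> R st'"
  shows "wp n' w f \<omega> (Assign 8 (Op Times (Const 384) (Op Times (Reg 12) (Op Times (Reg 12) (Reg 12)))))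
     (wp n' w f \<omega> (Assign 13 (Op Plus (Reg 12) (Const 1)))
     (wp n' w f \<omega> (Assign 14 (Op Times (Reg 13) (Op Times (Reg 13) (Reg 13))))
     (wp n' w f \<omega> (Assign 9 (Op Times (Const C) (Op Times (Reg 14) (Op Times (Reg 14) (Op Times (Reg 14) (Reg 6))))))
     (wp n' w f \<omega> (Assign 10 (Op Times (Reg 9) (Reg 0)))
     (wp n' w f \<omega> (Assign 20 (Op Times (Const 3) (Reg 0)))
     (wp n' w f \<omega> (Assign 21 (Op Plus (Reg 20) (Reg 10)))
     (wp n' w f \<omega> (Assign 22 (Op Plus (Reg 21) (Reg 10)))
       (wp n' w f \<omega> (Assign 23 (Op Plus (Reg 0) (Reg 0))) R)))))))) st"
proof (rule wp_Assign_val[where v = "depth P"], goal_cases)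
  case 1 show ?case unfolding depth_def using r lt by (simp add: val del: exp_val.simps(1,4))
next
  case (2 s1)
  note e1 = 2
  show ?case
  proof (rule wp_Assign_val[where v = "P + 1"], goal_cases)
    case 1 show ?case using r lt e1(1) by (simp add: val del: exp_val.simps(1,4))
  next
    case (2 s2)
    note e2 = 2
    have r2: "regs s2 13 = P + 1" using e2(1) by simp
    show ?case
    proof (rule wp_Assign_val[where v = "Suc_cubed P"], goal_cases)
      case 1
      have "exp_val w s2 (Op Times (Reg 13) (Reg 13)) = (P + 1) * (P + 1)"
        by (subst val_Times) (simp_all only: exp_val.simps(2) r2 lt)
      then show ?case unfolding Suc_cubed_def
        by (subst val_Times) (simp_all only: exp_val.simps(2) r2 lt)
    next
      case (2 s3)
      note e3 = 2
      have r3: "regs s3 14 = Suc_cubed P" "regs s3 6 = lg2 (n + 1)" using e3(1) e2(1) e1(1) r by simp_all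
      show ?case
      proof (rule wp_Assign_val[where v = "num_samples C n P"], goal_cases)
        case 1
        have 1: "exp_val w s3 (Op Times (Reg 14) (Reg 6)) = Suc_cubed P * lg2 (n + 1)"
          by (subst val_Times) (simp_all only: exp_val.simps(2) r3 lt)
        have 2: "exp_val w s3 (Op Times (Reg 14) (Op Times (Reg 14) (Reg 6))) = Suc_cubed P * (Suc_cubed P * lg2 (n + 1))"
          by (subst val_Times) (simp_all only: exp_val.simps(2) r3 1 lt)
        have 3: "exp_val w s3 (Op Times (Reg 14) (Op Times (Reg 14) (Op Times (Reg 14) (Reg 6))))
          = Suc_cubed P * (Suc_cubed P * (Suc_cubed P * lg2 (n + 1)))"
          by (subst val_Times) (simp_all only: exp_val.simps(2) r3 2 lt)
        have 4: "exp_val w s3 (Const C) = C" by (rule val_Const[OF lt(10)])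
        show ?case unfolding num_samples_def
          by (subst val_Times) (simp_all only: 3 4 lt num_samples_def[symmetric])
      next
        case (2 s4)
        note e4 = 2
        have r4: "regs s4 9 = num_samples C n P" "regs s4 0 = n" using e4(1) e3(1) e2(1) e1(1) r by simp_all
        show ?case
        proof (rule wp_Assign_val[where v = "num_samples C n P * n"], goal_cases)
          case 1 show ?case by (subst val_Times) (simp_all only: exp_val.simps(2) r4 lt)
        next
          case (2 s5)
          note e5 = 2
          have r5: "regs s5 10 = num_samples C n P * n" "regs s5 0 = n" using e5(1) r4 by simp_all
          show ?case
          proof (rule wp_Assign_val[where v = "3 * n"], goal_cases)
            case 1 show ?case by (subst val_Times) (simp_all only: exp_val.simps(2) val_Const[OF lt(18)] r5 lt)
          next
            case (2 s6)
            note e6 = 2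
            have r6: "regs s6 10 = num_samples C n P * n" "regs s6 0 = n" "regs s6 20 = 3 * n" using e6(1) r5 by simp_all
            show ?case
            proof (rule wp_Assign_val[where v = "3 * n + num_samples C n P * n"], goal_cases)
              case 1 show ?case by (subst val_Plus) (simp_all only: exp_val.simps(2) r6 lt)
            next
              case (2 s7)
              note e7 = 2
              have r7: "regs s7 10 = num_samples C n P * n" "regs s7 0 = n" "regs s7 21 = 3 * n + num_samples C n P * n"
                using e7(1) r6 by simp_all
              show ?case
              proof (rule wp_Assign_val[where v = "3 * n + num_samples C n P * n + num_samples C n P * n"], goal_cases)
                case 1 show ?case by (subst val_Plus) (simp_all only: exp_val.simps(2) r7 lt)
              next
                case (2 s8)
                note e8 = 2
                have r8: "regs s8 0 = n" using e8(1) r7 by simp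
                show ?case
                proof (rule wp_Assign_val[where v = "n + n"], goal_cases)
                  case 1 show ?case by (subst val_Plus) (simp_all only: exp_val.simps(2) r8 lt)
                next
                  case (2 s9)
                  note e = 2 e8 e7 e6 e5 e4 e3 e2 e1
                  have "time s9 \<le> time st + 100" unfolding e by simp
                  moreover have "regs s9 22 = 3 * n + 2 * (num_samples C n P * n)" "regs s9 23 = 2 * n"
                    unfolding e by simp_all
                  moreover have "regs s9 0 = n" "regs s9 7 = noise_bits P" "regs s9 8 = depth P"
                    "regs s9 9 = num_samples C n P" "regs s9 10 = num_samples C n P * n" "regs s9 20 = 3 * n"
                    "regs s9 21 = 3 * n + num_samples C n P * n"
                    unfolding e using r by simp_all
                  ultimately show ?case by (intro R) (simp_all only: e)
                qed
              qed
            qed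
          qed
        qed
      qed
    qed
  qed
qed

lemma wp_params:
  fixes n s e C w :: nat
  defines "P \<equiv> lg2 s * e"
  assumes pos: "1 \<le> n" "1 \<le> s" "1 \<le> e" "1 \<le> C" and big: "(4 * C + 404) * (n + s + e) ^ 20 < 2 ^ w"
    and regs: "regs st = (\<lambda>_. 0)(0 := n, 1 := s, 2 := e)"
    and R: "\<And>st'. regs st' 0 = n \<Longrightarrow> regs st' 7 = noise_bits P \<Longrightarrow> regs st' 8 = depth P \<Longrightarrow>
      regs st' 9 = num_samples C n P \<Longrightarrow> regs st' 10 = num_samples C n P * n \<Longrightarrow> regs st' 20 = 3 * n \<Longrightarrow>
      regs st' 21 = 3 * n + num_samples C n P * n \<Longrightarrow> regs st' 22 = 3 * n + 2 * (num_samples C n P * n) \<Longrightarrow>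
      regs st' 23 = 2 * n \<Longrightarrow> mem st' = mem st \<Longrightarrow> flips st' = flips st \<Longrightarrow> queries st' = queries st \<Longrightarrow>
      time st' \<le> time st + 300 + 20 * (lg2 s + lg2 (n + 1) + noise_bits P) \<Longrightarrow> R st'"
  shows "wp n w f \<omega> (params C) R st"
proof -
  define E where "E = (n + s + e) ^ 20"
  have big': "4 * (C * E) + 404 * E < 2 ^ w" using big by (simp add: E_def algebra_simps)
  note sz = sizes[OF pos, folded E_def P_def]
  have CE: "C \<le> C * E" using sz(1) by simp
  have w1: "1 < w"
  proof (rule ccontr)
    assume "\<not> 1 < w"
    then have "w = 0 \<or> w = 1" by auto
    then have "(2 :: nat) ^ w \<le> 2" by auto
    then show False using big' sz(1) by linarith
  qed
  let ?m = "num_samples C n P"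
  have E: "404 * E < 2 ^ w" using big' by linarith
  note small = sz(1-5)
  have lt1: "2 * s < 2 ^ w" "2 * (n + 1) < 2 ^ w" "n + 1 < 2 ^ w" "3 * n < 2 ^ w" "n + n < 2 ^ w"
    using E small(1-3) by auto
  have lt2: "P < 2 ^ w" "P + 1 < 2 ^ w" "8 * P < 2 ^ w" "8 * P + 4 < 2 ^ w" "2 * (8 * P + 4) < 2 ^ w"
    using E small(1,4) by auto
  have lt3: "P * (P * P) < 2 ^ w" "384 * (P * (P * P)) < 2 ^ w"
    using E small(5) by linarith+
  have lt4: "(1 :: nat) < 2 ^ w" "(3 :: nat) < 2 ^ w" "(4 :: nat) < 2 ^ w" "(8 :: nat) < 2 ^ w" "(384 :: nat) < 2 ^ w"
    using E small(1) by linarith+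
  have lt5: "C < 2 ^ w" "?m < 2 ^ w" "?m * n < 2 ^ w" "3 * n + ?m * n < 2 ^ w" "3 * n + ?m * n + ?m * n < 2 ^ w"
    using big' CE small(2) sz(10,11) by linarith+
  have lt6: "P * P < 2 ^ w" "(P + 1) * (P + 1) < 2 ^ w" "(P + 1) * ((P + 1) * (P + 1)) < 2 ^ w"
  proof -
    have "P * P \<le> P * (P * P)" by (cases P) simp_all
    then show "P * P < 2 ^ w" using lt3(1) by linarith
    have 1: "(P + 1) * (P + 1) \<le> (P + 1) * ((P + 1) * (P + 1))" by simp
    have "(P + 1) * ((P + 1) * (P + 1)) \<le> E" using sz(6) by (simp only: Suc_cubed_def)
    then show "(P + 1) * ((P + 1) * (P + 1)) < 2 ^ w" using E small(1) by linarith
    with 1 show "(P + 1) * (P + 1) < 2 ^ w" by linarith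
  qed
  note lt = lt1 lt2 lt3 lt4 lt5 lt6
  have ltQ: "Suc_cubed P * lg2 (n + 1) < 2 ^ w" "Suc_cubed P * (Suc_cubed P * lg2 (n + 1)) < 2 ^ w"
    "Suc_cubed P * (Suc_cubed P * (Suc_cubed P * lg2 (n + 1))) < 2 ^ w"
    using big' sz by linarith+
  show ?thesis
    unfolding params_def wp_Seq_eq
  proof (rule wp_log_loop[where B = s], goal_cases)
    case (8 st1)
    define st2 where "st2 = st1\<lparr>regs := (regs st1)(5 := exp_val w st1 (Op Plus (Reg 0) (Const 1))),
      time := time st1 + exp_cost (Op Plus (Reg 0) (Const 1)) + 1\<rparr>"
    have r1: "regs st1 0 = n" "regs st1 2 = e" "regs st1 6 = 0" "regs st1 7 = 0" using 8(1) regs by simp_all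
    have r2: "regs st2 5 = n + 1" "regs st2 0 = n" "regs st2 2 = e" "regs st2 6 = 0" "regs st2 7 = 0" "regs st2 3 = lg2 s"
      using r1 8(2) lt by (simp_all add: st2_def val del: exp_val.simps(1,4))
    show ?case
    proof (rule wp_Assign, fold st2_def, rule wp_log_loop[where B = "n + 1"], goal_cases)
      case (8 st3)
      have r3: "regs st3 0 = n" "regs st3 2 = e" "regs st3 6 = lg2 (n + 1)" "regs st3 7 = 0" "regs st3 3 = lg2 s"
        using 8(1,2) r2 by simp_all
      define st4 where "st4 = st3\<lparr>regs := (regs st3)(12 := exp_val w st3 (Op Times (Reg 3) (Reg 2))),
        time := time st3 + exp_cost (Op Times (Reg 3) (Reg 2)) + 1\<rparr>"
      have r4: "regs st4 12 = P" using r3 lt by (simp add: st4_def P_def val del: exp_val.simps(1,4))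
      have r4': "regs st4 r = regs st3 r" if "r \<noteq> 12" for r using that by (simp add: st4_def)
      define st5 where "st5 = st4\<lparr>regs := (regs st4)(5 := exp_val w st4 (Op Plus (Op Times (Const 8) (Reg 12)) (Const 4))),
        time := time st4 + exp_cost (Op Plus (Op Times (Const 8) (Reg 12)) (Const 4)) + 1\<rparr>"
      have r5: "regs st5 5 = 8 * P + 4" "regs st5 12 = P"
        using r4 lt by (simp_all add: st5_def val del: exp_val.simps(1,4))
      have r5': "regs st5 r = regs st3 r" if "r \<noteq> 12" "r \<noteq> 5" for r using that r4' by (simp add: st5_def)
      note f3 = 8
      show ?case
      proof (rule wp_Assign, fold st4_def, rule wp_Assign, fold st5_def, rule wp_log_loop[where B = "8 * P + 4"], goal_cases)
        case (8 st6)
        have r6: "regs st6 0 = n" "regs st6 6 = lg2 (n + 1)" "regs st6 7 = noise_bits P" "regs st6 12 = P"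
          using 8(1,2) r5 r5' r3 by (simp_all add: noise_bits_def)
        have same: "mem st6 = mem st" "flips st6 = flips st" "queries st6 = queries st"
          using 8(3-5) f3(3-5) \<open>mem st1 = mem st\<close> \<open>flips st1 = flips st\<close> \<open>queries st1 = queries st\<close>
          by (simp_all add: st5_def st4_def st2_def)
        have t: "time st6 \<le> time st + 100 + 20 * (lg2 s + lg2 (n + 1) + noise_bits P)"
          using 8(6) f3(6) \<open>time st1 \<le> time st + 10 + lg2 s * 20\<close>
          by (simp add: st5_def st4_def st2_def noise_bits_def)
        show ?case
        proof (rule wp_arith[OF r6 lt2(2) lt6(1) lt3 lt6(2,3) ltQ lt5(1,2,3) lt1(4) lt5(4,5) lt1(5) lt4(1,2,5)], goal_cases)
          case (1 st7)
          show ?case by (rule R) (use 1 same t in simp_all)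
        qed
      qed (use r5 r5' r3 lt w1 in simp_all)
    qed (use r2 lt w1 in simp_all)
  qed (use regs lt w1 in simp_all)
qed

section \<open>Bounds on the parameters\<close>

text \<open>For the upper bound: if b \<ge> 2, rounding up adds less than 1 \<le> log2 b, and at b =
  1 both sides vanish.\<close>

lemma lg2_log:
  assumes "1 \<le> b"
  shows "log 2 (real b) \<le> real (lg2 b)" "real (lg2 b) \<le> 2 * log 2 (real b)"
proof -
  show "log 2 (real b) \<le> real (lg2 b)"
    using assms by (intro log2_of_power_le lg2_ge) auto
  show "real (lg2 b) \<le> 2 * log 2 (real b)"
  proof (cases "lg2 b")
    case (Suc k)
    then have less: "2 ^ k < b" by (intro lg2_less) simp
    then have "real k < log 2 (real b)" by (rule less_log2_of_power)
    moreover have "(1 :: nat) \<le> 2 ^ k" by simp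
    with less have "2 \<le> b" by linarith
    then have "1 \<le> log 2 (real b)" by (simp add: le_log_iff)
    ultimately show ?thesis using Suc by simp
  qed (use assms in simp)
qed

text \<open>The factor 2 in the word length makes up for rounding 1 / \<epsilon> up: with x = n + s
  + 1 / \<epsilon> \<ge> 3 the rounded sum is at most x + 1 \<le> x^2.\<close>

lemma word_length_bound:
  assumes n: "1 \<le> n" and s: "1 \<le> s" and eps: "0 < \<epsilon>" "\<epsilon> < 1"
  shows "(n + s + nat \<lceil>1 / \<epsilon>\<rceil>) ^ K \<le> 2 ^ word_length (2 * K) n s \<epsilon>"
proof -
  define x where "x = real n + real s + 1 / \<epsilon>"
  define l where "l = nat \<lceil>log 2 x\<rceil>"
  have e: "1 < 1 / \<epsilon>" using eps by simp
  then have x: "3 \<le> x" using n s by (simp add: x_def)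
  have "log 2 x \<le> real l" unfolding l_def by (rule real_nat_ceiling_ge)
  then have xl: "x \<le> 2 ^ l" using x by (simp add: log_le_iff powr_realpow)
  have "real (nat \<lceil>1 / \<epsilon>\<rceil>) \<le> 1 / \<epsilon> + 1" using e by linarith
  then have "real (n + s + nat \<lceil>1 / \<epsilon>\<rceil>) \<le> x + 1" by (simp add: x_def)
  also have "x + 1 \<le> x * x"
  proof -
    have "3 * x \<le> x * x" using x by (intro mult_right_mono) auto
    then show ?thesis using x by linarith
  qed
  also have "\<dots> \<le> 2 ^ l * 2 ^ l" using xl x by (intro mult_mono) auto
  finally have "real (n + s + nat \<lceil>1 / \<epsilon>\<rceil>) ^ K \<le> (2 ^ l * 2 ^ l) ^ K"
    by (rule power_mono) simp
  also have "(2 ^ l * 2 ^ l) ^ K = (2 :: real) ^ word_length (2 * K) n s \<epsilon>"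
  proof -
    have "word_length (2 * K) n s \<epsilon> = (l + l) * K"
      unfolding word_length_def x_def[symmetric] l_def[symmetric] by (simp add: algebra_simps)
    then show ?thesis by (simp only: power_add[symmetric] power_mult)
  qed
  finally have "real ((n + s + nat \<lceil>1 / \<epsilon>\<rceil>) ^ K) \<le> real (2 ^ word_length (2 * K) n s \<epsilon>)" by simp
  then show ?thesis by (simp only: of_nat_le_iff)
qed

text \<open>Since the base X = n + s + e is at least 2, the coefficient 4 C + 404 is below X^(4 C +
  404), which turns it into extra exponent; together with the 20 of \<open>sizes\<close> this makes
  4 C + 424.\<close>

lemma sizes_less_word:
  assumes n: "1 \<le> n" and s: "1 \<le> s" and eps: "0 < \<epsilon>" "\<epsilon> < 1"
  shows "(4 * C + 404) * (n + s + nat \<lceil>1 / \<epsilon>\<rceil>) ^ 20 < 2 ^ word_length (2 * (4 * C + 424)) n s \<epsilon>"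
proof -
  let ?X = "n + s + nat \<lceil>1 / \<epsilon>\<rceil>"
  have X: "2 \<le> ?X" using n s by linarith
  have "4 * C + 404 < 2 ^ (4 * C + 404)" by (rule less_exp)
  also have "\<dots> \<le> ?X ^ (4 * C + 404)" using X by (rule power_mono) simp
  finally have "(4 * C + 404) * ?X ^ 20 < ?X ^ (4 * C + 404) * ?X ^ 20"
    using X by (intro mult_strict_right_mono) auto
  also have "\<dots> = ?X ^ (4 * C + 404 + 20)" by (rule power_add[symmetric])
  also have "4 * C + 404 + 20 = 4 * C + 424" by simp
  also note word_length_bound[OF n s eps]
  finally show ?thesis .
qed

text \<open>As 1536^2 is twice 1179648, the exponent 2 m \<eta>^2 equals (c + 770) (P + 1)^3
  \<open>lg2 (n + 1)\<close>. With N = n + 1, the number of paths is at most N^(2 D), and n + 1 and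
  the Hoeffding factor 2 cost one N each. Now 2 D = 768 P^3, and 768 + 2 = 770 leaves N^-c.\<close>

lemma failure_probability:
  fixes n c P :: nat
  assumes n: "1 \<le> n"
  defines "m \<equiv> num_samples (1179648 * (c + 770)) n P" and "\<eta> \<equiv> 1 / (1536 * (real P + 1) ^ 3)"
  shows "real ((2 * n + 1) ^ depth P) * (real (n + 1) * (2 * exp (- 2 * real m * \<eta>\<^sup>2))) \<le> 1 / real (n + 1) ^ c"
proof -
  define N where "N = real (n + 1)"
  define Q where "Q = real P + 1"
  define D where "D = depth P"
  have N: "2 \<le> N" using n by (simp add: N_def)
  have Q: "1 \<le> Q" by (simp add: Q_def)
  have cs: "real (Suc_cubed P) = Q ^ 3"
    unfolding Suc_cubed_def Q_def power3_eq_cube mult.assoc by (simp only: of_nat_mult of_nat_add of_nat_1)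
  have m: "real m = 1179648 * (real c + 770) * (Q ^ 3 * Q ^ 3 * Q ^ 3) * lg2 (n + 1)"
    unfolding m_def num_samples_def of_nat_mult cs by simp
  have eta: "\<eta>\<^sup>2 = 1 / (2359296 * (Q ^ 3 * Q ^ 3))"
    unfolding \<eta>_def Q_def[symmetric] power2_eq_square by simp
  have exponent: "2 * real m * \<eta>\<^sup>2 = (real c + 770) * Q ^ 3 * lg2 (n + 1)"
  proof -
    obtain A where A: "A = Q ^ 3" by simp
    then have "A \<noteq> 0" using Q by simp
    then show ?thesis unfolding m eta A[symmetric] by (simp add: field_simps)
  qed
  have lnN: "0 \<le> ln N" "ln N \<le> lg2 (n + 1)"
  proof -
    show "0 \<le> ln N" using N by simp
    have "ln N * ln 2 \<le> ln N * 1" using N ln_2_less_1 by (intro mult_left_mono) auto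
    then have "ln N \<le> log 2 N" by (simp add: log_def field_simps)
    also have "\<dots> \<le> lg2 (n + 1)" unfolding N_def by (rule lg2_log(1)) simp
    finally show "ln N \<le> lg2 (n + 1)" .
  qed
  have "real (c + 2 + 2 * D) \<le> (real c + 770) * Q ^ 3"
  proof -
    have P: "real P * (real P * real P) \<le> Q * (Q * Q)"
      unfolding Q_def by (intro mult_mono) auto
    have "1 \<le> Q ^ 3" using Q by simp
    then have "(real c + 2) * 1 \<le> (real c + 2) * Q ^ 3" by (intro mult_left_mono) auto
    with P show ?thesis unfolding D_def depth_def by (simp add: algebra_simps power3_eq_cube)
  qed
  then have "real (c + 2 + 2 * D) * ln N \<le> (real c + 770) * Q ^ 3 * lg2 (n + 1)"
    using lnN Q by (intro mult_mono) auto
  then have "exp (- 2 * real m * \<eta>\<^sup>2) \<le> exp (- (real (c + 2 + 2 * D) * ln N))"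
    using exponent by simp
  also have "\<dots> = 1 / N ^ (c + 2 + 2 * D)"
    using N by (simp only: exp_minus exp_of_nat_mult) (simp add: field_simps)
  finally have e: "exp (- 2 * real m * \<eta>\<^sup>2) \<le> 1 / N ^ (c + 2 + 2 * D)" .
  have "real (2 * n + 1) \<le> N ^ 2" by (simp add: N_def power2_eq_square algebra_simps)
  then have "real (2 * n + 1) ^ D \<le> (N ^ 2) ^ D" by (rule power_mono) simp
  then have a1: "real ((2 * n + 1) ^ D) \<le> N ^ (2 * D)" by (simp only: of_nat_power power_mult)
  have a2: "real (n + 1) * (2 * exp (- 2 * real m * \<eta>\<^sup>2)) \<le> N * (N * (1 / N ^ (c + 2 + 2 * D)))"
    unfolding N_def[symmetric] using N e by (intro mult_left_mono mult_mono) auto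
  have "real ((2 * n + 1) ^ D) * (real (n + 1) * (2 * exp (- 2 * real m * \<eta>\<^sup>2)))
      \<le> N ^ (2 * D) * (N * (N * (1 / N ^ (c + 2 + 2 * D))))"
    by (rule mult_mono[OF a1 a2]) (use N in auto)
  also have "\<dots> = 1 / N ^ c"
  proof -
    have "N ^ (c + 2 + 2 * D) = N ^ c * (N * N) * N ^ (2 * D)" by (simp add: power_add power2_eq_square)
    then show ?thesis using N by simp
  qed
  finally show ?thesis unfolding N_def D_def .
qed

lemma noise_rate:
  defines "r P \<equiv> 2 * (1 / 2) ^ noise_bits P"
  shows "0 < r P" "r P \<le> 1" "r P \<le> 2 / (8 * real P + 4)" "1 / (8 * real P + 4) \<le> r P"
proof -
  let ?u = "noise_bits P"
  have r: "r P = 2 / 2 ^ ?u" by (simp add: r_def power_one_over)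
  show "0 < r P" by (simp add: r)
  have "8 * P + 4 \<le> 2 ^ ?u" unfolding noise_bits_def by (rule lg2_ge)
  then have ge: "8 * real P + 4 \<le> 2 ^ ?u"
    by (metis (mono_tags, lifting) of_nat_add of_nat_le_iff of_nat_mult of_nat_numeral of_nat_power)
  then show le: "r P \<le> 2 / (8 * real P + 4)" unfolding r by (intro divide_left_mono) auto
  have "2 / (8 * real P + 4) \<le> 1" by simp
  with le show "r P \<le> 1" by linarith
  \<comment> \<open>Minimality in \<open>lg2\<close> speaks about the predecessor of
    \<open>noise_bits P\<close>, and the factor 2 in the rate makes \<open>r P\<close> equal to 1 /
    2^k.\<close>
  obtain k where k: "?u = Suc k"
  proof (cases ?u)
    case 0
    then show ?thesis using ge by simp
  qed
  then have "2 ^ k < 8 * P + 4" by (intro lg2_less) (simp add: noise_bits_def)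
  then have "2 ^ k < 8 * real P + 4"
    by (metis (mono_tags, lifting) of_nat_add of_nat_less_iff of_nat_mult of_nat_numeral of_nat_power)
  moreover have "r P = 1 / 2 ^ k" unfolding r k by simp
  ultimately show "1 / (8 * real P + 4) \<le> r P" by (simp add: divide_left_mono)
qed

text \<open>The budget: 2 r l takes \<epsilon> / 2, and the two OSSS terms take \<epsilon> / 4 each.
  Both are at most l / (4 P): one by the choice of \<open>a\<close>, the other because 1 / r \<le>
  12 P and \<beta> / a = 1 / (48 P^2).\<close>

lemma total_error:
  fixes P :: nat
  assumes l: "0 \<le> l" "l \<le> \<epsilon> * real P" and P: "0 < P" and eps: "0 < \<epsilon>"
  defines "r \<equiv> 2 * (1 / 2 :: real) ^ noise_bits P" and "a \<equiv> 1 / (4 * real P)" and "\<beta> \<equiv> 1 / (192 * real P ^ 3)"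
  shows "4 * (d + r * l / 2 + l / 2 * ((\<beta> / (r * a) + a) / 2)) \<le> 4 * d + \<epsilon>"
proof -
  let ?P = "real P"
  have P1: "1 \<le> ?P" using P by simp
  note r = noise_rate[of P, folded r_def]
  have "r * l \<le> (2 / (8 * ?P + 4)) * (\<epsilon> * ?P)" using r l eps by (intro mult_mono) auto
  also have "\<dots> \<le> \<epsilon> / 4" using eps P1 by (simp add: field_simps)
  finally have 1: "2 * (r * l) \<le> \<epsilon> / 2" by simp
  have "l * a \<le> \<epsilon> * ?P * a" using l P1 by (intro mult_right_mono) (auto simp: a_def)
  also have "\<dots> = \<epsilon> / 4" using P1 by (simp add: a_def)
  finally have 2: "l * a \<le> \<epsilon> / 4" .
  have "1 / r \<le> 8 * ?P + 4" using r P1 by (simp add: field_simps)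
  also have "\<dots> \<le> 12 * ?P" using P1 by simp
  finally have inv: "1 / r \<le> 12 * ?P" .
  have "\<beta> / (r * a) = (1 / r) * (\<beta> / a)" by simp
  also have "\<dots> \<le> 12 * ?P * (\<beta> / a)" using inv P1 by (intro mult_right_mono) (auto simp: a_def \<beta>_def)
  also have "\<dots> = 1 / (4 * ?P)" using P1 by (simp add: a_def \<beta>_def field_simps power3_eq_cube)
  finally have ba: "\<beta> / (r * a) \<le> 1 / (4 * ?P)" .
  have "l * (\<beta> / (r * a)) \<le> l * (1 / (4 * ?P))" by (rule mult_left_mono[OF ba l(1)])
  also have "\<dots> \<le> \<epsilon> * ?P * (1 / (4 * ?P))" using l P1 by (intro mult_right_mono) auto
  also have "\<dots> = \<epsilon> / 4" using P1 by simp
  finally have 3: "l * (\<beta> / (r * a)) \<le> \<epsilon> / 4" .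
  have "4 * (d + r * l / 2 + l / 2 * ((\<beta> / (r * a) + a) / 2))
      = 4 * d + 2 * (r * l) + l * (\<beta> / (r * a)) + l * a"
    by (simp add: algebra_simps)
  then show ?thesis using 1 2 3 by linarith
qed

text \<open>The descent dominates: at most 384 Q^3 levels of at most 362 m n steps each give 139008.
  All other contributions fit into the rounding to 200000.\<close>

lemma (in run) time_bound:
  assumes m: "1 \<le> m" and L: "L \<le> Q" and lg: "lg \<le> m" and Q: "1 \<le> Q" and u: "u \<le> 8 * Q" and D: "D \<le> 384 * Q ^ 3"
  shows "300 + 20 * (L + lg + u) + total_time \<le> 200000 * (Q ^ 3 * (m * n))"
proof -
  define M where "M = m * n"
  define X where "X = Q ^ 3 * M"
  have Mm: "m \<le> M" "n \<le> M" "1 \<le> M" using m n by (simp_all add: M_def)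
  have Q3: "Q \<le> Q ^ 3" using Q by (intro self_le_power) auto
  have QM: "Q ^ 3 * 1 \<le> X" "1 * M \<le> X"
    unfolding X_def using Mm Q by (intro mult_le_mono; simp)+
  have "level_time \<le> 362 * M"
    unfolding level_time_def M_def[symmetric] using Mm by (simp add: M_def[symmetric] algebra_simps)
  then have "D * level_time \<le> 384 * Q ^ 3 * (362 * M)" using D by (intro mult_le_mono)
  then have Dl: "D * level_time \<le> 139008 * X" by (simp add: X_def)
  have "M * u \<le> M * (8 * Q ^ 3)" using u Q3 by (intro mult_le_mono2) linarith
  then have Mu: "M * u \<le> 8 * X" by (simp add: X_def)
  have "total_time = 100 + 20 * (M * u) + 60 * M + D * level_time + 31 * M + 50 * m"
    unfolding total_time_def M_def by (simp add: algebra_simps)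
  then have "total_time \<le> 139409 * X" using Dl Mu Mm QM by linarith
  moreover have "L + lg + u \<le> 10 * X" using Mm QM Q3 L lg u by linarith
  then have "20 * (L + lg + u) \<le> 20 * (10 * X)" by (rule mult_le_mono2)
  ultimately show ?thesis using Mm QM unfolding M_def[symmetric] X_def[symmetric] by simp
qed

definition reconstruct :: "nat \<Rightarrow> com" where
  "reconstruct C = Seq (params C) (Seq draw (Seq (Assign 11 (Reg 8)) (Seq descend take_vote)))"

lemma reconstruct_answers:
  fixes n s C :: nat and \<omega> :: "nat \<Rightarrow> bool"
  assumes n1: "1 \<le> n" and s: "1 \<le> s" and eps: "0 < \<epsilon>" "\<epsilon> < 1" and C: "1 \<le> C"
    and f: "pm n f" and z: "z \<in> cube n"
  defines "P \<equiv> lg2 s * nat \<lceil>1 / \<epsilon>\<rceil>"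
  defines "m \<equiv> num_samples C n P" and "V \<equiv> samples (noise_bits P) n \<omega>"
  shows "\<exists>t. answers (reconstruct C) (2 * (4 * C + 424)) n s \<epsilon> f \<omega> z
      (dt_eval (build (choice n m V) (vote n m V) (depth P) f) z) (depth P * (2 * m) + m) t \<and>
    t \<le> 200000 * ((P + 1) ^ 3 * (m * n))"
proof -
  let ?w = "word_length (2 * (4 * C + 424)) n s \<epsilon>"
  let ?e = "nat \<lceil>1 / \<epsilon>\<rceil>"
  have e: "1 \<le> ?e" using eps by (simp add: Suc_le_eq)
  note big = sizes_less_word[OF n1 s eps, of C]
  note sz = sizes[OF n1 s e C, folded P_def m_def]
  interpret run n ?w f \<omega> z m "noise_bits P" "depth P"
  proof
    \<comment> \<open>In units of the bound from \<open>sizes\<close>, the summands contribute 4, 4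
      C (from the two terms with \<open>m\<close>), 12, 384 and 4, in total 4 C + 404.\<close>
    show "4 * n + 2 * (m * n) + 2 * m + noise_bits P + depth P + 4 < 2 ^ ?w"
      using big sz(1,2,10-13) by (simp add: add_mult_distrib)
  qed (use n1 f z in auto)
  have "1 \<le> lg2 (n + 1)"
  proof -
    have "real 1 \<le> log 2 (real (n + 1))" using n1 by (simp add: le_log_iff)
    then have "real 1 \<le> real (lg2 (n + 1))" using lg2_log(1)[of "n + 1"] by linarith
    then show ?thesis by (simp only: of_nat_le_iff)
  qed
  moreover have lgm: "lg2 (n + 1) \<le> m"
  proof -
    have "1 \<le> Suc_cubed P" by (simp add: Suc_cubed_def)
    then have "1 * (1 * (1 * (1 * lg2 (n + 1)))) \<le> m"
      unfolding m_def num_samples_def by (intro mult_le_mono C order_refl)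
    then show ?thesis by simp
  qed
  ultimately have m1: "1 \<le> m" by linarith
  have L: "lg2 s \<le> P + 1" unfolding P_def using e by (cases ?e) auto
  have u: "noise_bits P \<le> 8 * (P + 1)" unfolding noise_bits_def using lg2_le[of "8 * P + 4"] by simp
  have D: "depth P \<le> 384 * (P + 1) ^ 3"
    unfolding depth_def power3_eq_cube mult.assoc by (intro mult_le_mono) auto
  have "wp n ?w f \<omega> (reconstruct C) (\<lambda>st. decode_bit (regs st 0) = dt_eval (T (depth P) f) z \<and>
      queries st = depth P * (2 * m) + m \<and> time st \<le> 200000 * ((P + 1) ^ 3 * (m * n))) (init_config n s \<epsilon> z)"
    unfolding reconstruct_def
  proof (rule wp_Seq, rule wp_params[OF n1 s e C big, folded P_def m_def], goal_cases)
    case 1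
    show ?case by (simp add: init_config_def)
  next
    case (2 st)
    then have st: "started st" by (simp add: started_def init_config_def)
    show ?case
    proof (rule wp_run[OF st], goal_cases)
      case 1
      show ?case using 2 by (simp add: init_config_def)
    next
      case (2 st')
      have "time st' \<le> 300 + 20 * (lg2 s + lg2 (n + 1) + noise_bits P) + total_time"
        using 2(3) \<open>time st \<le> _\<close> by (simp add: init_config_def)
      also have "\<dots> \<le> 200000 * ((P + 1) ^ 3 * (m * n))"
        by (rule time_bound[OF m1 L lgm _ u D]) simp
      finally show ?case using 2(1,2) \<open>queries st = _\<close> by (simp add: init_config_def)
    qed
  qed
  then show ?thesis unfolding wp_def answers_def V_def by blast
qed


theorem theorem1p1:
  fixes c :: nat
  shows "\<exists>(A :: com) (K :: nat) (C\<^sub>1 :: real) (C\<^sub>2 :: real) (p :: real poly) (q :: real poly).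
    \<forall>(n :: nat) (s :: nat) (\<epsilon> :: real) (f :: (nat \<Rightarrow> int) \<Rightarrow> int).
      n \<ge> 1 \<and> s \<ge> 1 \<and> 0 < \<epsilon> \<and> \<epsilon> < 1 \<and> f \<in> cube n \<rightarrow> {-1, 1} \<longrightarrow>
      (\<exists>T :: (nat \<Rightarrow> bool) \<Rightarrow> dtree.
        (\<forall>\<omega>. decision_tree n (T \<omega>) \<and>
             real (dt_size (T \<omega>)) \<le> real s powr (C\<^sub>1 * (log 2 (real s))\<^sup>2 / \<epsilon> ^ 3)) \<and>
        \<P>(\<omega> in coins. dist_fun n (dt_eval (T \<omega>)) f \<le> C\<^sub>2 * opt n s f + \<epsilon>)
          \<ge> 1 - 1 / real (n + 1) ^ c \<and>
        (\<forall>\<omega>. \<forall>z \<in> cube n. \<exists>k t.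
             answers A K n s \<epsilon> f \<omega> z (dt_eval (T \<omega>) z) k t \<and>
             real k \<le> poly p (log 2 (real s) / \<epsilon>) * log 2 (real (n + 1)) \<and>
             real t \<le> poly q (log 2 (real s) / \<epsilon>) * real n * log 2 (real (n + 1))))"
proof -
  define C where "C = 1179648 * (c + 770)"
  have C: "1 \<le> C" by (simp add: C_def)
  \<comment> \<open>[:1, 4:] is 1 + 4 x, a bound for P + 1 at x = log2 s / \<epsilon>. The power 12
    is 9 from the number of pairs plus 3 from the number of levels. The factors are 2 times 769 and
    2 times 200000, the 2 coming from \<open>lg2\<close> against the true logarithm.\<close>
  define p where "p = smult (1538 * real C) ([:1, 4:] ^ 12)"
  define q where "q = smult (400000 * real C) ([:1, 4:] ^ 12)"
  have "\<exists>T :: (nat \<Rightarrow> bool) \<Rightarrow> dtree.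
        (\<forall>\<omega>. decision_tree n (T \<omega>) \<and>
             real (dt_size (T \<omega>)) \<le> real s powr (24576 * (log 2 (real s))\<^sup>2 / \<epsilon> ^ 3)) \<and>
        \<P>(\<omega> in coins. dist_fun n (dt_eval (T \<omega>)) f \<le> 4 * opt n s f + \<epsilon>)
          \<ge> 1 - 1 / real (n + 1) ^ c \<and>
        (\<forall>\<omega>. \<forall>z \<in> cube n. \<exists>k t.
             answers (reconstruct C) (2 * (4 * C + 424)) n s \<epsilon> f \<omega> z (dt_eval (T \<omega>) z) k t \<and>
             real k \<le> poly p (log 2 (real s) / \<epsilon>) * log 2 (real (n + 1)) \<and>
             real t \<le> poly q (log 2 (real s) / \<epsilon>) * real n * log 2 (real (n + 1)))"
    if n: "1 \<le> n" and s: "1 \<le> s" and eps: "0 < \<epsilon>" "\<epsilon> < 1" and rng: "f \<in> cube n \<rightarrow> {-1, 1}"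
    for n s :: nat and \<epsilon> :: real and f :: "(nat \<Rightarrow> int) \<Rightarrow> int"
  proof -
    have f: "pm n f" using rng by (auto simp: pm_def)
    define l where "l = log 2 (real s)"
    have l0: "0 \<le> l" using s by (simp add: l_def)
    define e where "e = nat \<lceil>1 / \<epsilon>\<rceil>"
    define P where "P = lg2 s * e"
    define x where "x = l / \<epsilon>"
    have x0: "0 \<le> x" using l0 eps by (simp add: x_def)
    have e1: "1 < 1 / \<epsilon>" using eps by simp
    then have e: "1 / \<epsilon> \<le> real e" "real e \<le> 2 * (1 / \<epsilon>)" unfolding e_def by linarith+
    have lg: "l \<le> lg2 s" "lg2 s \<le> 2 * l" unfolding l_def by (rule lg2_log[OF s])+
    have xP: "x \<le> real P"
      unfolding x_def P_def using mult_mono[OF lg(1) e(1)] l0 eps by simp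
    have Px: "real P \<le> 4 * x"
      unfolding x_def P_def using mult_mono[OF lg(2) e(2)] l0 eps by simp
    have lP: "l \<le> \<epsilon> * real P"
      using xP eps by (simp add: x_def field_simps)
    define u where "u = noise_bits P"
    define D where "D = depth P"
    define m where "m = num_samples C n P"
    define r where "r = 2 * (1 / 2 :: real) ^ u"
    define \<eta> where "\<eta> = 1 / (1536 * (real P + 1) ^ 3)"
    note r = noise_rate[of P, folded u_def, folded r_def]
    define B where "B = log 2 (real (n + 1))"
    have B1: "1 \<le> B" using n by (simp add: B_def le_log_iff)
    have lgn: "B \<le> real (lg2 (n + 1))" "real (lg2 (n + 1)) \<le> 2 * B" unfolding B_def by (rule lg2_log; simp)+
    have m0: "0 < m"
      using lgn B1 C by (auto simp: m_def num_samples_def Suc_cubed_def intro!: Nat.gr0I)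
    have \<eta>0: "0 \<le> \<eta>" by (simp add: \<eta>_def)
    have \<eta>8: "\<eta> \<le> 1 / 8"
      unfolding \<eta>_def by (intro divide_left_mono) (auto intro: order_trans[OF _ mult_left_mono[OF one_le_power]])
    define V where "V = samples u n"
    define T where "T \<omega> = build (choice n m (V \<omega>)) (vote n m (V \<omega>)) D f" for \<omega>
    have ch: "choice n m (V \<omega>) G < n" for \<omega> G using n by (intro choice_less) simp
    have vt: "vote n m (V \<omega>) G \<in> {-1, 1}" for \<omega> G by (simp add: vote_def)
    \<comment> \<open>Rounding costs a factor 2 in log s and another in 1 / \<epsilon>, hence P
      \<le> 4 x, and 384 times 4^3 is 24576.\<close>
    have size: "real (dt_size (T \<omega>)) \<le> real s powr (24576 * l\<^sup>2 / \<epsilon> ^ 3)" for \<omega>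
    proof -
      have "real P ^ 3 \<le> (4 * x) ^ 3" using Px by (intro power_mono) auto
      then have "real D \<le> 24576 * x ^ 3"
        unfolding D_def depth_def by (simp add: power3_eq_cube algebra_simps)
      also have "\<dots> = l * (24576 * l\<^sup>2 / \<epsilon> ^ 3)"
        unfolding x_def by (simp add: power_divide power3_eq_cube power2_eq_square)
      finally have "(2 :: real) powr real D \<le> 2 powr (l * (24576 * l\<^sup>2 / \<epsilon> ^ 3))" by simp
      also have "\<dots> = (2 powr l) powr (24576 * l\<^sup>2 / \<epsilon> ^ 3)" by (simp only: powr_powr)
      also have "2 powr l = real s" using s by (simp add: l_def)
      finally show ?thesis by (simp add: T_def dt_size_build powr_realpow)
    qed
    have prob: "\<P>(\<omega> in coins. dist_fun n (dt_eval (T \<omega>)) f \<le> 4 * opt n s f + \<epsilon>) \<ge> 1 - 1 / real (n + 1) ^ c"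
    proof -
      have "\<P>(\<omega> in coins. dist_fun n (dt_eval (T \<omega>)) f \<le> 4 * opt n s f + \<epsilon>)
        \<ge> 1 - real ((2 * n + 1) ^ D) * (real (n + 1) * (2 * exp (- 2 * real m * \<eta>\<^sup>2)))"
      proof (rule prob_accurate[OF f m0 \<eta>0, of u])
        fix \<omega> \<omega>' :: "nat \<Rightarrow> bool"
        assume same: "\<And>k. k < m * n * (u + 1) \<Longrightarrow> \<omega> k = \<omega>' k"
          and good: "dist_fun n (dt_eval (T \<omega>)) f \<le> 4 * opt n s f + \<epsilon>"
        \<comment> \<open>The tree reads its coins only through the cells of the first
          \<open>m\<close> rows, and the last of these ends before coin m n (u + 1).\<close>
        have V: "V \<omega> j i = V \<omega>' j i" if "j < m" "i < n" for j i
          unfolding V_def samples_def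
        proof (rule cell_cong, rule same)
          fix k assume k: "k \<in> {(j * n + i) * (u + 1)..<(j * n + i + 1) * (u + 1)}"
          have "j * n + i + 1 \<le> (j + 1) * n" "(j + 1) * n \<le> m * n"
            using that by (simp, intro mult_le_mono1) simp
          then have "(j * n + i + 1) * (u + 1) \<le> m * n * (u + 1)" by (intro mult_le_mono1) linarith
          then show "k < m * n * (u + 1)" using k by simp
        qed
        have "choice n m (V \<omega>) G = choice n m (V \<omega>') G" for G
          unfolding choice_def by (rule arg_cong[where f = fst], rule first_max_cong, rule score_cong[OF V])
        moreover have "vote n m (V \<omega>) G = vote n m (V \<omega>') G" for G
          unfolding vote_def using ones_cong[OF V] by simp
        ultimately have "choice n m (V \<omega>) = choice n m (V \<omega>')" "vote n m (V \<omega>) = vote n m (V \<omega>')"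
          by (simp_all only: fun_eq_iff simp_thms)
        then show "dist_fun n (dt_eval (T \<omega>')) f \<le> 4 * opt n s f + \<epsilon>" using good by (simp add: T_def)
      next
        fix \<omega>
        assume acc: "\<And>\<pi> k. k \<le> D \<Longrightarrow> \<pi> \<in> paths n k \<Longrightarrow> accurate n u m \<eta> (restrs \<pi> f) (samples u n \<omega>)"
        have one: "dist_fun n (dt_eval (T \<omega>)) f \<le> 4 * dist_fun n f (dt_eval T0) + \<epsilon>"
          if T0: "decision_tree n T0" "dt_size T0 \<le> s" for T0
        proof -
          have best: "gain n r i (restrs \<pi> f) \<le> gain n r (choice n m (V \<omega>) (restrs \<pi> f)) (restrs \<pi> f) + 4 * \<eta>"
            if "t < D" "\<pi> \<in> paths n t" "i < n" for \<pi> t i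
            unfolding r_def V_def using that r(2) \<eta>0 m0 by (intro choice_gain acc[of t]) (auto simp: r_def)
          have label: "1 - vote n m (V \<omega>) (restrs \<pi> f) * mean n (restrs \<pi> f) \<le> 4 * (1 - \<bar>mean n (restrs \<pi> f)\<bar>)"
            if "\<pi> \<in> paths n D" for \<pi>
            unfolding V_def by (rule vote_error[OF acc[OF order_refl that] pm_restrs[OF f that] m0 \<eta>8])
          have D0: "s = 1" if "D = 0"
          proof -
            have "P = 0" using that by (simp add: D_def depth_def)
            then have "lg2 s = 0" using e e1 by (auto simp: P_def)
            then have "s \<le> 1" using lg2_ge[of s] by simp
            with s show ?thesis by simp
          qed
          \<comment> \<open>For P = 0 the formulas would divide by 0. Then the tree is a leaf and
            \<open>l\<close> is 0, so any positive \<open>a\<close> will do.\<close>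
          define a where "a = (if P = 0 then 1 else 1 / (4 * real P))"
          define \<beta> where "\<beta> = (if P = 0 then 0 else 1 / (192 * real P ^ 3))"
          have a: "0 < a" by (simp add: a_def)
          have \<beta>: "1 / real D + 4 * \<eta> \<le> \<beta>" if "0 < D"
          proof -
            have P: "0 < P" using that by (auto simp: D_def depth_def intro: Nat.gr0I)
            have "real D = 384 * real P ^ 3" by (simp add: D_def depth_def power3_eq_cube)
            moreover have "real P ^ 3 \<le> (real P + 1) ^ 3" by (intro power_mono) auto
            then have "\<eta> \<le> 1 / (1536 * real P ^ 3)"
              unfolding \<eta>_def using P by (intro divide_left_mono) auto
            ultimately show ?thesis using P by (simp add: \<beta>_def)
          qed
          have "dist_fun n f (dt_eval (T \<omega>))
            \<le> 4 * (dist_fun n f (dt_eval T0) + r * l / 2 + l / 2 * ((\<beta> / (r * a) + a) / 2))"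
            unfolding T_def l_def by (rule build_error[OF ch vt f T0 r(1,2) a best label D0 \<beta>])
          also have "\<dots> \<le> 4 * dist_fun n f (dt_eval T0) + \<epsilon>"
          proof (cases "P = 0")
            case True
            then have "l = 0" using lP l0 by simp
            then show ?thesis using eps by simp
          next
            case False
            then show ?thesis
              using total_error[OF l0 lP _ eps(1), of "dist_fun n f (dt_eval T0)"]
              unfolding a_def \<beta>_def r_def u_def by simp
          qed
          finally show ?thesis by (simp add: dist_fun_commute)
        qed
        \<comment> \<open>\<open>opt\<close> is an infimum, so the bound against every single size-s
          tree is rearranged into a lower bound for it.\<close>
        have "(dist_fun n (dt_eval (T \<omega>)) f - \<epsilon>) / 4 \<le> opt n s f"
          unfolding opt_def
        proof (rule cINF_greatest)
          show "{T. decision_tree n T \<and> dt_size T \<le> s} \<noteq> {}"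
            using s by (auto intro!: exI[of _ "Leaf 1"])
        qed (use one in \<open>simp add: field_simps\<close>)
        then show "dist_fun n (dt_eval (T \<omega>)) f \<le> 4 * opt n s f + \<epsilon>" by (simp add: field_simps)
      qed
      moreover have "real ((2 * n + 1) ^ D) * (real (n + 1) * (2 * exp (- 2 * real m * \<eta>\<^sup>2))) \<le> 1 / real (n + 1) ^ c"
        unfolding D_def m_def C_def \<eta>_def by (rule failure_probability[OF n])
      ultimately show ?thesis by linarith
    qed
    have run: "\<exists>k t. answers (reconstruct C) (2 * (4 * C + 424)) n s \<epsilon> f \<omega> z (dt_eval (T \<omega>) z) k t \<and>
        real k \<le> poly p x * B \<and> real t \<le> poly q x * real n * B" if z: "z \<in> cube n" for \<omega> z
    proof -
      obtain t where t: "answers (reconstruct C) (2 * (4 * C + 424)) n s \<epsilon> f \<omega> z (dt_eval (T \<omega>) z) (D * (2 * m) + m) t"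
        "t \<le> 200000 * ((P + 1) ^ 3 * (m * n))"
        using reconstruct_answers[OF n s eps C f z, of \<omega>]
        unfolding T_def V_def u_def D_def m_def P_def e_def by blast
      define y where "y = 1 + 4 * x"
      have Py: "real P + 1 \<le> y" using Px by (simp add: y_def)
      have y3: "(real P + 1) ^ 3 \<le> y ^ 3" using Py by (intro power_mono) auto
      have y0: "0 \<le> y" using x0 by (simp add: y_def)
      have y1: "1 \<le> y ^ 3" using x0 by (simp add: y_def)
      have cs: "real (Suc_cubed P) = (real P + 1) ^ 3"
        unfolding Suc_cubed_def power3_eq_cube mult.assoc by (simp only: of_nat_mult of_nat_add of_nat_1)
      have "real m = real C * ((real P + 1) ^ 3 * ((real P + 1) ^ 3 * ((real P + 1) ^ 3 * lg2 (n + 1))))"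
        unfolding m_def num_samples_def of_nat_mult cs ..
      also have "\<dots> \<le> real C * (y ^ 3 * (y ^ 3 * (y ^ 3 * (2 * B))))"
        using y3 y0 lgn(2) by (intro mult_left_mono mult_mono) auto
      finally have my: "real m \<le> real C * (y ^ 3 * (y ^ 3 * (y ^ 3 * (2 * B))))" .
      have poly: "poly p x = 1538 * real C * (y ^ 3 * (y ^ 3 * (y ^ 3 * y ^ 3)))"
        "poly q x = 400000 * real C * (y ^ 3 * (y ^ 3 * (y ^ 3 * y ^ 3)))"
        by (simp_all add: p_def q_def y_def poly_power mult.commute flip: power_add)
      have "real P ^ 3 \<le> (real P + 1) ^ 3" by (intro power_mono) auto
      then have "real P ^ 3 \<le> y ^ 3" using y3 by linarith
      then have "2 * real D + 1 \<le> 769 * y ^ 3"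
        using y1 unfolding D_def depth_def by (simp add: power3_eq_cube)
      then have "(2 * real D + 1) * real m \<le> 769 * y ^ 3 * (real C * (y ^ 3 * (y ^ 3 * (y ^ 3 * (2 * B)))))"
        using my y0 by (intro mult_mono) auto
      moreover have "real (D * (2 * m) + m) = (2 * real D + 1) * real m" by (simp add: algebra_simps)
      ultimately have k: "real (D * (2 * m) + m) \<le> poly p x * B" unfolding poly by (simp add: mult_ac)
      have "real t \<le> real (200000 * ((P + 1) ^ 3 * (m * n)))" using t(2) by (simp only: of_nat_le_iff)
      also have "\<dots> = 200000 * ((real P + 1) ^ 3 * (real m * real n))"
        by (simp only: of_nat_mult of_nat_power of_nat_add of_nat_1 of_nat_numeral)
      also have "\<dots> \<le> 200000 * (y ^ 3 * (real C * (y ^ 3 * (y ^ 3 * (y ^ 3 * (2 * B)))) * real n))"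
        using y3 my y0 by (intro mult_left_mono mult_mono mult_right_mono) auto
      finally have "real t \<le> poly q x * real n * B" unfolding poly by (simp add: mult_ac)
      with t(1) k show ?thesis by blast
    qed
    show ?thesis
    proof (intro exI[of _ T] conjI allI ballI)
      show "decision_tree n (T \<omega>)" for \<omega> unfolding T_def by (intro decision_tree_build ch vt)
      show "real (dt_size (T \<omega>)) \<le> real s powr (24576 * (log 2 (real s))\<^sup>2 / \<epsilon> ^ 3)" for \<omega>
        using size unfolding l_def .
    qed (use prob run in \<open>simp_all only: x_def l_def B_def\<close>)
  qed
  then show ?thesis by blast
qed

end
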